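(* Let $\mathfrak{M}$ be a weight matrix, let $f:\operatorname{Sym}(n)\to\mathbb R$ be an isotropic function and let $F:\mathbb R^n\to\mathbb R$ be its symmetric companion. (Beurling case) If $\mathfrak M$ is regular in the Beurling sense, then $f$ is of class $\mathcal E^{(\mathfrak M)}$ if and only if $F$ is of class $\mathcal E^{(\mathfrak M)}$, and $f$ is of class $\mathcal S^{(\mathfrak M)}$ if and only if $F$ is of class $\mathcal S^{(\mathfrak M)}$. (Roumieu case) If $\mathfrak M$ is regular in the Roumieu sense, then $f$ is of class $\mathcal E^{\{\mathfrak M\}}$ if and only if $F$ is of class $\mathcal E^{\{\mathfrak M\}}$, and $f$ is of class $\mathcal S^{\{\mathfrak M\}}$ if and only if $F$ is of class $\mathcal S^{\{\mathfrak M\}}$.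
   Context: **Isotropic functions.** $\operatorname{Sym}(n)$ is the vector space of real symmetric $n\times n$ matrices. A function $f:\operatorname{Sym}(n)\to\mathbb R$ is isotropic if $f(SAS^t)=f(A)$ for all $A\in\operatorname{Sym}(n)$ and $S\in\operatorname{SO}(n)$. Equivalently, there is a unique symmetric (i.e. permutation-invariant) function $F:\mathbb R^n\to\mathbb R$, called the symmetric companion of $f$, such that $f(A)=F(a_1,\dots,a_n)$ for all $A\in \operatorname{Sym}(n)$, where $a_1,\dots,a_n$ are the eigenvalues of $A$ repeated according to multiplicity; $F$ is the restriction of $f$ to diagonal matrices. **Weight sequences and matrices.** $\mathbb N=\{0,1,2,\dots\}$. A weight sequence is a positive sequence $M=(M_k)_{k\in\mathbb N}$ with $M_k^2\le M_{k-1}M_{k+1}$ for all $k\ge 1$, $M_0=1\le M_1$, and $M_k^{1/k}\to\infty$. A weight matrix $\mathfrak M$ is a family of weight sequences which is totally ordered with respect to the pointwise order on sequences. $\mathfrak M$ is regular in the Beurling sense if: $(k!/M_k)^{1/k}\to 0$ as $k\to\infty$ for every $M\in\mathfrak M$; and for every $M\in\mathfrak M$ there are $L\in\mathfrak M$ and $C>0$ such that $L_{k+\ell}\le C^{k+\ell}M_kM_\ell$ for all $k,\ell\in\mathbb N$. $\mathfrak M$ is regular in the Roumieu sense if: $(k!/M_k)^{1/k}$ is bounded for every $M\in\mathfrak M$; and for every $M\in\mathfrak M$ there are $N\in\mathfrak M$ and $C>0$ such that $M_{k+\ell}\le C^{k+\ell}N_kN_\ell$ for all $k,\ell\in\mathbb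 N$. **Local classes.** Let $D_j=-i\partial_j$. For $U\subseteq\mathbb R^d$ open, $K\subseteq U$ compact, $\rho>0$ and $f\in C^\infty(U)$ let $$\|f\|^M_{K,\rho}:=\sup_{x\in K,\ \alpha\in\mathbb N^d}\frac{|D^\alpha f(x)|}{\rho^{|\alpha|}M_{|\alpha|}}.$$ The Roumieu class $\mathcal E^{\{\mathfrak M\}}(U)$ is the set of $f\in C^\infty(U)$ such that for every compact $K\subseteq U$ there exist $M\in\mathfrak M$ and $\rho>0$ with $\|f\|^M_{K,\rho}<\infty$. The Beurling class $\mathcal E^{(\mathfrak M)}(U)$ is the set of $f\in C^\infty(U)$ such that for every compact $K\subseteq U$, every $M\in\mathfrak M$ and every $\rho>0$ one has $\|f\|^M_{K,\rho}<\infty$. **Gelfand–Shilov classes.** Let $\mathcal S(\mathbb R^d)$ be the Schwartz space. For $f\in\mathcal S(\mathbb R^d)$ put $$q^M_\rho(f):=\sup_{k,\ell\in\mathbb N}\ \sup_{|\alpha|=\ell}\frac{\big\||x|^kD^\alpha f\big\|_{L^\infty(\mathbb R^d)}}{\rho^{k+\ell}M_kM_\ell}.$$ $\mathcal S^{\{\mathfrak M\}}(\mathbb R^d)$ is the set of $f\in\mathcal S(\mathbb R^d)$ with $q^M_\rho(f)<\infty$ for some $M\in\mathfrak M$ and some $\rho>0$; $\mathcal S^{(\mathfrak M)}(\mathbb R^d)$ is the set of $f\in\mathcal S(\mathbb R^d)$ with $q^M_\rho(f)<\infty$ for all $M\in\mathfrak M$ and all $\rho>0$. On $\operatorname{Sym}(n)\cong\mathbb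 R^{n(n+1)/2}$ all classes are defined via linear coordinates (the choice is immaterial). *)

theory Defs
  imports "HOL-Analysis.Analysis" "HOL-Probability.Essential_Supremum"
begin

section \<open>The Euclidean space of real symmetric matrices\<close>

typedef ('n::finite) symmat = "{A :: real^'n^'n. transpose A = A}"
  morphisms mat_of_symmat symmat_of_mat
  by (rule exI[of _ 0]) (simp add: transpose_def vec_eq_iff)

setup_lifting type_definition_symmat

text \<open>The inner product is the Frobenius inner product \<open>trace (A B)\<close> inherited from \<^typ>\<open>real^'n^'n\<close>.\<close>

instantiation symmat :: (finite) real_inner
begin

lift_definition zero_symmat :: "'a symmat" is 0
  by (simp add: transpose_def vec_eq_iff)

lift_definition plus_symmat :: "'a symmat \<Rightarrow> 'a symmat \<Rightarrow> 'a symmat" is "(+)"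
  by (simp add: transpose_def vec_eq_iff)

lift_definition minus_symmat :: "'a symmat \<Rightarrow> 'a symmat \<Rightarrow> 'a symmat" is "(-)"
  by (simp add: transpose_def vec_eq_iff)

lift_definition uminus_symmat :: "'a symmat \<Rightarrow> 'a symmat" is uminus
  by (simp add: transpose_def vec_eq_iff)

lift_definition scaleR_symmat :: "real \<Rightarrow> 'a symmat \<Rightarrow> 'a symmat" is "(*\<^sub>R)"
  by (simp add: transpose_def vec_eq_iff)

lift_definition inner_symmat :: "'a symmat \<Rightarrow> 'a symmat \<Rightarrow> real" is inner .

lift_definition norm_symmat :: "'a symmat \<Rightarrow> real" is norm .

definition dist_symmat :: "'a symmat \<Rightarrow> 'a symmat \<Rightarrow> real"
  where "dist_symmat A B = norm (A - B)"

definition sgn_symmat :: "'a symmat \<Rightarrow> 'a symmat"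
  where "sgn_symmat A = inverse (norm A) *\<^sub>R A"

definition uniformity_symmat :: "('a symmat \<times> 'a symmat) filter"
  where "uniformity_symmat = (INF e\<in>{0<..}. principal {(x, y). dist x y < e})"

definition open_symmat :: "'a symmat set \<Rightarrow> bool"
  where "open_symmat S = (\<forall>x\<in>S. \<forall>\<^sub>F (x', y) in uniformity. x' = x \<longrightarrow> y \<in> S)"

instance
  apply standard
  unfolding dist_symmat_def open_symmat_def sgn_symmat_def uniformity_symmat_def
  apply (rule refl | (transfer, simp add: algebra_simps inner_left_distrib
           norm_eq_sqrt_inner inner_commute))+
  done

end

lemma mat_of_symmat_commute: "mat_of_symmat A $ i $ j = mat_of_symmat A $ j $ i"
  using mat_of_symmat[of A] by (simp add: transpose_def vec_eq_iff)

text \<open>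
  The coordinate directions are the orthonormal basis \<open>E\<^sub>i\<^sub>i\<close> and
  \<open>(E\<^sub>i\<^sub>j + E\<^sub>j\<^sub>i) / \<surd>2\<close> for \<open>i \<noteq> j\<close>. Note that \<open>sym_unit i j = sym_unit j i\<close>.
\<close>

lift_definition sym_unit :: "'n::finite \<Rightarrow> 'n \<Rightarrow> 'n symmat" is
  "\<lambda>i j. \<chi> r c. if r = i \<and> c = j \<or> r = j \<and> c = i then (if i = j then 1 else 1 / sqrt 2) else 0"
  by (auto simp: transpose_def vec_eq_iff)

lemma sym_unit_commute: "sym_unit i j = sym_unit j i"
  by transfer (auto simp: vec_eq_iff)

lemma inner_sym_unit:
  "inner A (sym_unit i j) =
     (if i = j then mat_of_symmat A $ i $ i else sqrt 2 * mat_of_symmat A $ i $ j)"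
proof (cases "i = j")
  case True
  have "inner A (sym_unit i j) =
      (\<Sum>r\<in>UNIV. \<Sum>c\<in>UNIV. if r = i then (if c = i then mat_of_symmat A $ r $ c else 0) else 0)"
    unfolding inner_symmat.rep_eq sym_unit.rep_eq inner_vec_def using True
    by (intro sum.cong refl) auto
  also have "\<dots> = (\<Sum>r\<in>UNIV. if r = i then mat_of_symmat A $ r $ i else 0)"
    by (intro sum.cong refl) simp
  finally show ?thesis using True by simp
next
  case False
  have "inner A (sym_unit i j) =
      (\<Sum>r\<in>UNIV. \<Sum>c\<in>UNIV. (if r = i then (if c = j then mat_of_symmat A $ r $ c / sqrt 2 else 0) else 0)
         + (if r = j then (if c = i then mat_of_symmat A $ r $ c / sqrt 2 else 0) else 0))"
    unfolding inner_symmat.rep_eq sym_unit.rep_eq inner_vec_def using False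
    by (intro sum.cong refl) auto
  also have "\<dots> = (\<Sum>r\<in>UNIV. if r = i then mat_of_symmat A $ r $ j / sqrt 2 else 0)
       + (\<Sum>r\<in>UNIV. if r = j then mat_of_symmat A $ r $ i / sqrt 2 else 0)"
    unfolding sum.distrib by (intro arg_cong2[where f="(+)"] sum.cong refl) simp_all
  also have "\<dots> = 2 * (mat_of_symmat A $ i $ j / sqrt 2)"
    by (simp add: mat_of_symmat_commute[of A j i])
  also have "\<dots> = (2 / sqrt 2) * mat_of_symmat A $ i $ j"
    by simp
  also have "\<dots> = sqrt 2 * mat_of_symmat A $ i $ j"
    by (simp only: real_div_sqrt zero_le_numeral)
  finally show ?thesis using False by simp
qed

instantiation symmat :: (finite) euclidean_space
begin

definition Basis_symmat :: "'a symmat set"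
  where "Basis_symmat = {sym_unit i j | i j. True}"

instance
proof
  show "(Basis :: 'a symmat set) \<noteq> {}"
    by (auto simp: Basis_symmat_def)
  have "(Basis :: 'a symmat set) = (\<lambda>(i, j). sym_unit i j) ` UNIV"
    by (auto simp: Basis_symmat_def)
  then show "finite (Basis :: 'a symmat set)"
    by (metis finite_imageI finite_class.finite_UNIV)
next
  fix u v :: "'a symmat"
  assume "u \<in> Basis" "v \<in> Basis"
  then obtain i j k l where u: "u = sym_unit i j" and v: "v = sym_unit k l"
    by (auto simp: Basis_symmat_def)
  have inner: "inner (sym_unit i j) (sym_unit k l) = (if {i, j} = {k, l} then 1 else 0)"
    for i j k l :: 'a
    unfolding inner_sym_unit sym_unit.rep_eq by (auto simp: doubleton_eq_iff)
  have "u = v \<longleftrightarrow> {i, j} = {k, l}"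
  proof
    assume "u = v"
    then have "inner (sym_unit i j) (sym_unit k l) = inner (sym_unit k l) (sym_unit k l)"
      unfolding u v by (rule arg_cong)
    then show "{i, j} = {k, l}"
      unfolding inner by (metis zero_neq_one)
  next
    assume "{i, j} = {k, l}"
    then show "u = v"
      unfolding u v doubleton_eq_iff using sym_unit_commute[of i j] by metis
  qed
  then show "inner u v = (if u = v then 1 else 0)"
    unfolding u v inner by metis
next
  fix A :: "'a symmat"
  show "(\<forall>u\<in>Basis. inner A u = 0) \<longleftrightarrow> A = 0"
  proof
    assume "\<forall>u\<in>Basis. inner A u = 0"
    then have 0: "inner A (sym_unit i j) = 0" for i j
      by (auto simp: Basis_symmat_def)
    have "mat_of_symmat A $ i $ j = 0" for i j
      by (cases "i = j") (use inner_sym_unit[of A i j] 0[of i j] in auto)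
    then have "mat_of_symmat A = mat_of_symmat 0"
      by (simp add: vec_eq_iff zero_symmat.rep_eq)
    then show "A = 0"
      by (simp add: mat_of_symmat_inject)
  qed simp
qed

end


section \<open>Isotropic functions\<close>

lift_definition conj_symmat :: "real^'n::finite^'n \<Rightarrow> 'n symmat \<Rightarrow> 'n symmat" is
  "\<lambda>S A. S ** A ** transpose S"
  by (simp add: matrix_transpose_mul matrix_mul_assoc)

definition isotropic :: "('n::finite symmat \<Rightarrow> real) \<Rightarrow> bool"
  where "isotropic f \<longleftrightarrow> (\<forall>A S. rotation_matrix S \<longrightarrow> f (conj_symmat S A) = f A)"

definition symmetric_fun :: "(real^'n::finite \<Rightarrow> real) \<Rightarrow> bool"
  where "symmetric_fun F \<longleftrightarrow> (\<forall>p x. p permutes UNIV \<longrightarrow> F (\<chi> i. x $ p i) = F x)"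

text \<open>The entries of \<open>a\<close> are the roots of the characteristic polynomial of \<open>A\<close> with multiplicity.\<close>

definition eigenvalue_tuple :: "'n::finite symmat \<Rightarrow> real^'n \<Rightarrow> bool"
  where "eigenvalue_tuple A a \<longleftrightarrow>
    (\<forall>t. det (mat t - mat_of_symmat A) = (\<Prod>i\<in>UNIV. t - a $ i))"

definition symmetric_companion :: "('n::finite symmat \<Rightarrow> real) \<Rightarrow> (real^'n \<Rightarrow> real) \<Rightarrow> bool"
  where "symmetric_companion f F \<longleftrightarrow>
    symmetric_fun F \<and> (\<forall>A a. eigenvalue_tuple A a \<longrightarrow> f A = F a)"

lift_definition diag_symmat :: "real^'n::finite \<Rightarrow> 'n symmat" is
  "\<lambda>a. \<chi> i j. if i = j then a $ i else 0"
  by (simp add: transpose_def vec_eq_iff)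

lemma eigenvalue_tuple_diag: "eigenvalue_tuple (diag_symmat a) a"
  unfolding eigenvalue_tuple_def diag_symmat.rep_eq
  by (intro allI, subst det_diagonal) (auto simp: mat_def)

lemma symmetric_companion_diag:
  assumes "symmetric_companion f F"
  shows "F a = f (diag_symmat a)"
  using assms eigenvalue_tuple_diag by (metis symmetric_companion_def)


section \<open>Partial derivatives\<close>

definition partial :: "'a::euclidean_space \<Rightarrow> ('a \<Rightarrow> real) \<Rightarrow> 'a \<Rightarrow> real"
  where "partial b f x = frechet_derivative f (at x) b"

text \<open>\<open>C_on k U f\<close> is meant for open \<open>U\<close>.\<close>

primrec C_on :: "nat \<Rightarrow> 'a::euclidean_space set \<Rightarrow> ('a \<Rightarrow> real) \<Rightarrow> bool" where
  "C_on 0 U f \<longleftrightarrow> continuous_on U f"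
| "C_on (Suc k) U f \<longleftrightarrow>
     (\<forall>x\<in>U. f differentiable (at x)) \<and> (\<forall>b\<in>Basis. C_on k U (partial b f))"

definition smooth_on :: "'a::euclidean_space set \<Rightarrow> ('a \<Rightarrow> real) \<Rightarrow> bool"
  where "smooth_on U f \<longleftrightarrow> (\<forall>k. C_on k U f)"

text \<open>
  A multi-index assigns to every coordinate direction \<open>b \<in> Basis\<close> an order of differentiation;
  its values outside \<open>Basis\<close> play no role. The derivatives are taken in the order of a fixed
  enumeration of \<open>Basis\<close>, which for smooth functions does not matter.
\<close>

definition mi_order :: "('a::euclidean_space \<Rightarrow> nat) \<Rightarrow> nat"
  where "mi_order \<alpha> = (\<Sum>b\<in>Basis. \<alpha> b)"

definition coord_list :: "'a::euclidean_space list"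
  where "coord_list = (SOME bs. distinct bs \<and> set bs = Basis)"

definition mi_partial :: "('a::euclidean_space \<Rightarrow> nat) \<Rightarrow> ('a \<Rightarrow> real) \<Rightarrow> 'a \<Rightarrow> real"
  where "mi_partial \<alpha> f = foldr (\<lambda>b. partial b ^^ \<alpha> b) coord_list f"

text \<open>\<open>D\<^sup>\<alpha>\<close> for \<open>D\<^sub>j = -i \<partial>\<^sub>j\<close>.\<close>

definition mi_D :: "('a::euclidean_space \<Rightarrow> nat) \<Rightarrow> ('a \<Rightarrow> real) \<Rightarrow> 'a \<Rightarrow> complex"
  where "mi_D \<alpha> f x = (- \<i>) ^ mi_order \<alpha> * complex_of_real (mi_partial \<alpha> f x)"


section \<open>Weight matrices\<close>

definition weight_sequence :: "(nat \<Rightarrow> real) \<Rightarrow> bool"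
  where "weight_sequence M \<longleftrightarrow>
    (\<forall>k. 0 < M k) \<and>
    (\<forall>k\<ge>1. (M k)\<^sup>2 \<le> M (k - 1) * M (k + 1)) \<and>
    M 0 = 1 \<and> 1 \<le> M 1 \<and>
    filterlim (\<lambda>k. root k (M k)) at_top sequentially"

definition weight_matrix :: "(nat \<Rightarrow> real) set \<Rightarrow> bool"
  where "weight_matrix W \<longleftrightarrow>
    (\<forall>M\<in>W. weight_sequence M) \<and>
    (\<forall>M\<in>W. \<forall>N\<in>W. (\<forall>k. M k \<le> N k) \<or> (\<forall>k. N k \<le> M k))"

definition beurling_regular :: "(nat \<Rightarrow> real) set \<Rightarrow> bool"
  where "beurling_regular W \<longleftrightarrow>
    (\<forall>M\<in>W. (\<lambda>k. root k (fact k / M k)) \<longlonglongrightarrow> 0) \<and>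
    (\<forall>M\<in>W. \<exists>L\<in>W. \<exists>C>0. \<forall>k l. L (k + l) \<le> C ^ (k + l) * M k * M l)"

definition roumieu_regular :: "(nat \<Rightarrow> real) set \<Rightarrow> bool"
  where "roumieu_regular W \<longleftrightarrow>
    (\<forall>M\<in>W. bounded (range (\<lambda>k. root k (fact k / M k)))) \<and>
    (\<forall>M\<in>W. \<exists>N\<in>W. \<exists>C>0. \<forall>k l. M (k + l) \<le> C ^ (k + l) * N k * N l)"


section \<open>Local classes\<close>

definition local_norm ::
    "'a::euclidean_space set \<Rightarrow> real \<Rightarrow> (nat \<Rightarrow> real) \<Rightarrow> ('a \<Rightarrow> real) \<Rightarrow> ennreal"
  where "local_norm K \<rho> M f =
    (SUP x\<in>K. SUP \<alpha>. ennreal (cmod (mi_D \<alpha> f x) / (\<rho> ^ mi_order \<alpha> * M (mi_order \<alpha>))))"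

definition E_beurling ::
    "(nat \<Rightarrow> real) set \<Rightarrow> 'a::euclidean_space set \<Rightarrow> ('a \<Rightarrow> real) set"
  where "E_beurling W U =
    {f. smooth_on U f \<and>
        (\<forall>K. compact K \<and> K \<subseteq> U \<longrightarrow> (\<forall>M\<in>W. \<forall>\<rho>>0. local_norm K \<rho> M f < \<infinity>))}"

definition E_roumieu ::
    "(nat \<Rightarrow> real) set \<Rightarrow> 'a::euclidean_space set \<Rightarrow> ('a \<Rightarrow> real) set"
  where "E_roumieu W U =
    {f. smooth_on U f \<and>
        (\<forall>K. compact K \<and> K \<subseteq> U \<longrightarrow> (\<exists>M\<in>W. \<exists>\<rho>>0. local_norm K \<rho> M f < \<infinity>))}"


section \<open>Gelfand-Shilov classes\<close>

definition schwartz :: "('a::euclidean_space \<Rightarrow> real) set"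
  where "schwartz =
    {f. smooth_on UNIV f \<and> (\<forall>k \<alpha>. bounded (range (\<lambda>x. norm x ^ k * cmod (mi_D \<alpha> f x))))}"

definition gs_norm :: "real \<Rightarrow> (nat \<Rightarrow> real) \<Rightarrow> ('a::euclidean_space \<Rightarrow> real) \<Rightarrow> ennreal"
  where "gs_norm \<rho> M f =
    (SUP k. SUP l. SUP \<alpha>\<in>{\<alpha>. mi_order \<alpha> = l}.
       esssup lborel (\<lambda>x. ennreal (norm x ^ k * cmod (mi_D \<alpha> f x)))
         / ennreal (\<rho> ^ (k + l) * M k * M l))"

definition S_beurling :: "(nat \<Rightarrow> real) set \<Rightarrow> ('a::euclidean_space \<Rightarrow> real) set"
  where "S_beurling W = {f \<in> schwartz. \<forall>M\<in>W. \<forall>\<rho>>0. gs_norm \<rho> M f < \<infinity>}"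

definition S_roumieu :: "(nat \<Rightarrow> real) set \<Rightarrow> ('a::euclidean_space \<Rightarrow> real) set"
  where "S_roumieu W = {f \<in> schwartz. \<exists>M\<in>W. \<exists>\<rho>>0. gs_norm \<rho> M f < \<infinity>}"

end

theory Submission
  imports Defs "HOL-Probability.Infinite_Product_Measure"
begin

text \<open>
  One direction is easy: \<open>F\<close> is the composition of \<open>f\<close> with the isometric linear embedding of diagonal
  matrices, which maps basis directions to basis directions, so every bound for \<open>f\<close> restricts to \<open>F\<close>.

  For the converse, \<open>f\<close> is recovered from \<open>F\<close> by an explicit integral
  (\<open>isotropic_integral_representation\<close>): up to a constant, \<open>f A\<close> is the average of
  \<open>H (q u\<^sub>1 A, ..., q u\<^sub>n A)\<close> over \<open>n\<close> independent vectors \<open>u\<^sub>j\<close>, uniformly distributed in the unit ball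
  of complex \<open>n\<close>-space, where \<open>q u A\<close> is the Hermitian form of \<open>A\<close> at \<open>u\<close> and \<open>H\<close> arises from \<open>F\<close> by
  multiplication with polynomials and \<open>n\<^sup>2\<close> differentiations. To see this, let \<open>A\<close> have distinct
  nonzero eigenvalues \<open>a\<^sub>1, ..., a\<^sub>n\<close>. By orthogonal invariance \<open>q u A\<close> has the distribution of \<open>\<Sum>\<^sub>i a\<^sub>i t\<^sub>i\<close> with \<open>t\<^sub>i\<close> the squared moduli of the
  coordinates of \<open>u\<close>, and these are uniformly distributed on a simplex. The Hermite-Genocchi formula
  (\<open>ball_average_divided_difference\<close>) therefore identifies averages of derivatives of a function of one
  variable with its divided differences \<open>\<Sum>\<^sub>i d\<^sub>i \<psi> a\<^sub>i\<close>, where \<open>1 / d\<^sub>i\<close> is the product of the differences \<open>a\<^sub>i - a\<^sub>m\<close>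
  over \<open>m \<noteq> i\<close>. Applied in each of \<open>n\<close> variables to a function \<open>h\<close>, this gives the sum over all maps \<open>\<sigma>\<close> of
  \<open>{1, ..., n}\<close> to itself of \<open>(\<Prod>\<^sub>j d (\<sigma> j)) * h (a \<circ> \<sigma>)\<close>. For \<open>h x = V x * F x\<close>, with \<open>V x\<close> the product of all differences
  \<open>x\<^sub>i - x\<^sub>m\<close> for \<open>i \<noteq> m\<close>, only the permutations remain, and each of them contributes \<open>F a\<close>, by symmetry.

  The forms \<open>q u A\<close> are linear in \<open>A\<close> and bounded by the norm of \<open>A\<close>. Differentiating under the integral
  thus bounds the derivatives of \<open>f\<close> of order \<open>l\<close>, up to a constant, by \<open>n ^ l\<close> times the bounds for derivatives of \<open>F\<close> of
  order \<open>l + n\<^sup>2\<close> (\<open>lpartial_bound_transfer\<close>). The loss of a fixed number of derivatives and of geometric factors is what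
  the regularity conditions on the weight matrix can absorb, and the local classes are settled.

  For the Gelfand-Shilov classes one also needs decay. The functions \<open>norm A ^ (2 * k) * f A\<close> are isotropic
  with companions \<open>norm x ^ (2 * k) * F x\<close>, so their derivatives are bounded in the same way; the powers of
  the norm are then moved out of the derivatives by a recursion (\<open>decay_of_norm_pow_bounds\<close>).

  In the Beurling case all bounds must survive arbitrarily small radii \<open>\<rho>\<close>. The estimates are therefore
  carried out for normalised weights with \<open>(k + 1) * M k \<le> M (k + 1)\<close>, into which \<open>\<rho>\<close> has been absorbed
  (\<open>factorial_growth_majorant\<close>), with geometric losses that depend on \<open>n\<close> only.
\<close>

section \<open>Iterated partial derivatives of smooth functions\<close>

abbreviation smooth :: "('a::euclidean_space \<Rightarrow> real) \<Rightarrow> bool"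
  where "smooth f \<equiv> smooth_on UNIV f"

definition lpartial :: "'a::euclidean_space list \<Rightarrow> ('a \<Rightarrow> real) \<Rightarrow> 'a \<Rightarrow> real"
  where "lpartial bs f = foldr partial bs f"

lemma lpartial_Nil [simp]: "lpartial [] f = f"
  and lpartial_Cons [simp]: "lpartial (b # bs) f = partial b (lpartial bs f)"
  and lpartial_append: "lpartial (bs @ cs) f = lpartial bs (lpartial cs f)"
  by (simp_all add: lpartial_def)

lemma smooth_differentiable: "smooth f \<Longrightarrow> f differentiable (at x)"
  unfolding smooth_on_def by (metis C_on.simps(2) UNIV_I)

lemma smooth_partial: "smooth f \<Longrightarrow> b \<in> Basis \<Longrightarrow> smooth (partial b f)"
  unfolding smooth_on_def by (metis C_on.simps(2))

text \<open>
  Smoothness of a concrete function is shown below by exhibiting a family of functions that contains it and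
  is closed under first-order partial derivatives; no formula for higher derivatives is then needed.
\<close>

lemma smooth_coinduct:
  assumes "X f"
    and diff: "\<And>f x. X f \<Longrightarrow> f differentiable (at x)"
    and step: "\<And>f b. X f \<Longrightarrow> b \<in> Basis \<Longrightarrow> X (partial b f)"
  shows "smooth f"
proof -
  have "C_on k UNIV f" if "X f" for k f
    using that
  proof (induction k arbitrary: f)
    case 0
    then show ?case
      using diff by (simp add: continuous_on_eq_continuous_at differentiable_imp_continuous_within)
  next
    case (Suc k)
    then show ?case using diff step by simp
  qed
  with assms(1) show ?thesis by (simp add: smooth_on_def)
qed

lemma smooth_lpartial: "smooth f \<Longrightarrow> set bs \<subseteq> Basis \<Longrightarrow> smooth (lpartial bs f)"
  by (induction bs) (auto intro: smooth_partial)

lemma smooth_continuous: "smooth f \<Longrightarrow> continuous_on S f"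
  using smooth_differentiable differentiable_imp_continuous_within continuous_at_imp_continuous_on
  by blast

lemma frechet_derivative_smooth:
  "smooth f \<Longrightarrow> (f has_derivative frechet_derivative f (at x)) (at x)"
  using smooth_differentiable frechet_derivative_works by blast

lemma partial_eqI: "(f has_derivative f') (at x) \<Longrightarrow> partial b f x = f' b"
  unfolding partial_def by (metis frechet_derivative_at)

lemma has_derivative_partials:
  fixes f :: "'a::euclidean_space \<Rightarrow> real"
  assumes "smooth f"
  shows "(f has_derivative (\<lambda>h. \<Sum>b\<in>Basis. (h \<bullet> b) * partial b f x)) (at x)"
proof -
  have d: "(f has_derivative frechet_derivative f (at x)) (at x)"
    using assms by (rule frechet_derivative_smooth)
  interpret L: linear "frechet_derivative f (at x)"
    using d has_derivative_linear by blast
  have "frechet_derivative f (at x) h = (\<Sum>b\<in>Basis. (h \<bullet> b) * partial b f x)" for h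
  proof -
    have "frechet_derivative f (at x) h = frechet_derivative f (at x) (\<Sum>b\<in>Basis. (h \<bullet> b) *\<^sub>R b)"
      by (simp add: euclidean_representation)
    also have "\<dots> = (\<Sum>b\<in>Basis. (h \<bullet> b) * partial b f x)"
      by (simp add: L.sum L.scaleR partial_def)
    finally show ?thesis .
  qed
  then have "frechet_derivative f (at x) = (\<lambda>h. \<Sum>b\<in>Basis. (h \<bullet> b) * partial b f x)"
    by blast
  with d show ?thesis by metis
qed

lemma partial_line_derivative:
  assumes "smooth f"
  shows "((\<lambda>t. f (x + t *\<^sub>R b)) has_real_derivative partial b f (x + t *\<^sub>R b)) (at t)"
proof -
  have "(f has_derivative frechet_derivative f (at (x + t *\<^sub>R b))) (at (x + t *\<^sub>R b))"
    using assms by (rule frechet_derivative_smooth)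
  moreover have "((\<lambda>t. x + t *\<^sub>R b) has_derivative (\<lambda>s. s *\<^sub>R b)) (at t)"
    by (auto intro!: derivative_eq_intros)
  ultimately have "((\<lambda>t. f (x + t *\<^sub>R b)) has_derivative
      (\<lambda>s. frechet_derivative f (at (x + t *\<^sub>R b)) (s *\<^sub>R b))) (at t)"
    using has_derivative_compose by blast
  moreover have "linear (frechet_derivative f (at (x + t *\<^sub>R b)))"
    using frechet_derivative_smooth[OF assms] has_derivative_linear by blast
  ultimately show ?thesis
    unfolding has_field_derivative_def partial_def
    by (simp add: linear_scale mult.commute[of _ "frechet_derivative _ _ _"] mult_commute_abs)
qed

lemma partial_add:
  "smooth f \<Longrightarrow> smooth g \<Longrightarrow> partial b (\<lambda>x. f x + g x) = (\<lambda>x. partial b f x + partial b g x)"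
  by (intro ext partial_eqI[THEN trans, OF has_derivative_add[OF frechet_derivative_smooth frechet_derivative_smooth]])
     (simp_all add: partial_def)

lemma partial_linear_mult:
  assumes "smooth g"
  shows "partial b (\<lambda>x. (x \<bullet> v) * g x) = (\<lambda>x. (x \<bullet> v) * partial b g x + (b \<bullet> v) * g x)"
proof
  fix x
  have "(g has_derivative frechet_derivative g (at x)) (at x)"
    using assms by (rule frechet_derivative_smooth)
  then have "((\<lambda>x. (x \<bullet> v) * g x) has_derivative
     (\<lambda>h. (x \<bullet> v) * frechet_derivative g (at x) h + (h \<bullet> v) * g x)) (at x)"
    by (auto intro!: derivative_eq_intros)
  from partial_eqI[OF this, of b]
  show "partial b (\<lambda>x. (x \<bullet> v) * g x) x = (x \<bullet> v) * partial b g x + (b \<bullet> v) * g x"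
    by (simp add: partial_def)
qed

lemma partial_const: "partial b (\<lambda>_. c) = (\<lambda>_. 0)"
  by (intro ext partial_eqI[THEN trans, OF has_derivative_const]) simp

lemma smooth_const [simp]: "smooth (\<lambda>_. c)"
proof (rule smooth_coinduct[where X="\<lambda>f. \<exists>c. f = (\<lambda>_. c)"])
  fix f :: "'a \<Rightarrow> real" and b :: 'a assume "\<exists>c. f = (\<lambda>_. c)"
  then show "\<exists>c. partial b f = (\<lambda>_. c)"
    by (metis partial_const)
qed auto

lemma C_on_add: "C_on k UNIV f \<Longrightarrow> C_on k UNIV g \<Longrightarrow> C_on k UNIV (\<lambda>x. f x + g x)"
proof (induction k arbitrary: f g)
  case (Suc k)
  have "partial b (\<lambda>x. f x + g x) = (\<lambda>x. partial b f x + partial b g x)" for b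
    using Suc.prems
    by (intro ext partial_eqI[THEN trans, OF has_derivative_add])
       (auto simp: partial_def frechet_derivative_works[symmetric])
  with Suc show ?case by (auto intro!: differentiable_add)
qed (auto intro: continuous_intros)

lemma C_on_sum: "(\<And>i. i \<in> I \<Longrightarrow> C_on k UNIV (f i)) \<Longrightarrow> C_on k UNIV (\<lambda>x. \<Sum>i\<in>I. f i x)"
proof (induction I rule: infinite_finite_induct)
  case (insert i I)
  then show ?case using C_on_add[of k "f i" "\<lambda>x. \<Sum>i\<in>I. f i x"] by simp
qed (use smooth_const in \<open>auto simp: smooth_on_def\<close>)

lemma smooth_add: "smooth f \<Longrightarrow> smooth g \<Longrightarrow> smooth (\<lambda>x. f x + g x)"
  by (simp add: smooth_on_def C_on_add)

lemma smooth_sum: "(\<And>i. i \<in> I \<Longrightarrow> smooth (f i)) \<Longrightarrow> smooth (\<lambda>x. \<Sum>i\<in>I. f i x)"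
  by (induction I rule: infinite_finite_induct) (auto intro: smooth_add)

lemma partial_sum:
  "(\<And>i. i \<in> I \<Longrightarrow> smooth (f i)) \<Longrightarrow> partial b (\<lambda>x. \<Sum>i\<in>I. f i x) = (\<lambda>x. \<Sum>i\<in>I. partial b (f i) x)"
proof (induction I rule: infinite_finite_induct)
  case (insert i I)
  then show ?case by (simp add: partial_add smooth_sum)
qed (auto simp: partial_const)

lemma partial_cmult: "smooth g \<Longrightarrow> partial b (\<lambda>x. c * g x) = (\<lambda>x. c * partial b g x)"
  by (intro ext partial_eqI[THEN trans, OF has_derivative_mult_right[OF frechet_derivative_smooth]])
     (simp_all add: partial_def)

lemma smooth_cmult:
  assumes "smooth g" shows "smooth (\<lambda>x. c * g x)"
proof (rule smooth_coinduct[where X="\<lambda>f. \<exists>g. smooth g \<and> f = (\<lambda>x. c * g x)"])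
  fix f :: "'a \<Rightarrow> real" and x assume "\<exists>g. smooth g \<and> f = (\<lambda>x. c * g x)"
  then show "f differentiable at x"
    using smooth_differentiable differentiable_mult[OF differentiable_const] by blast
next
  fix f :: "'a \<Rightarrow> real" and b :: 'a
  assume "\<exists>g. smooth g \<and> f = (\<lambda>x. c * g x)" "b \<in> Basis"
  then show "\<exists>g. smooth g \<and> partial b f = (\<lambda>x. c * g x)"
    by (metis partial_cmult smooth_partial)
qed (use assms in blast)

lemma lpartial_cmult:
  "smooth g \<Longrightarrow> set bs \<subseteq> Basis \<Longrightarrow> lpartial bs (\<lambda>x. c * g x) = (\<lambda>x. c * lpartial bs g x)"
  by (induction bs) (simp_all add: partial_cmult smooth_lpartial)

lemma smooth_linear_mult_add:
  assumes "smooth g" "smooth h" shows "smooth (\<lambda>x. (x \<bullet> v) * g x + h x)"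
proof (rule smooth_coinduct[where X="\<lambda>f. \<exists>g h. smooth g \<and> smooth h \<and> f = (\<lambda>x. (x \<bullet> v) * g x + h x)"])
  fix f :: "'a \<Rightarrow> real" and x assume "\<exists>g h. smooth g \<and> smooth h \<and> f = (\<lambda>x. (x \<bullet> v) * g x + h x)"
  then obtain g h where gh: "smooth g" "smooth h" and f: "f = (\<lambda>x. (x \<bullet> v) * g x + h x)" by blast
  have "(f has_derivative (\<lambda>y. (x \<bullet> v) * frechet_derivative g (at x) y + (y \<bullet> v) * g x
      + frechet_derivative h (at x) y)) (at x)"
    unfolding f by (rule derivative_eq_intros frechet_derivative_smooth gh refl)+ simp
  then show "f differentiable at x" by (rule differentiableI)
next
  fix f :: "'a \<Rightarrow> real" and b :: 'a
  assume "\<exists>g h. smooth g \<and> smooth h \<and> f = (\<lambda>x. (x \<bullet> v) * g x + h x)" and b: "b \<in> Basis"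
  then obtain g h where gh: "smooth g" "smooth h" and f: "f = (\<lambda>x. (x \<bullet> v) * g x + h x)" by blast
  have d: "partial b (\<lambda>x. x \<bullet> v * g x + h x) x = (x \<bullet> v) * partial b g x + ((b \<bullet> v) * g x + partial b h x)" for x
    by (rule partial_eqI[THEN trans], (rule derivative_eq_intros frechet_derivative_smooth gh refl)+)
       (simp add: partial_def algebra_simps)
  show "\<exists>g h. smooth g \<and> smooth h \<and> partial b f = (\<lambda>x. (x \<bullet> v) * g x + h x)"
    by (rule exI[of _ "partial b g"], rule exI[of _ "\<lambda>x. (b \<bullet> v) * g x + partial b h x"])
       (use gh b in \<open>auto simp: f d fun_eq_iff intro!: smooth_add smooth_partial smooth_cmult\<close>)
qed (use assms in blast)

lemma smooth_linear_mult: "smooth g \<Longrightarrow> smooth (\<lambda>x. (x \<bullet> v) * g x)"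
  using smooth_linear_mult_add[of g "\<lambda>_. 0" v] by simp

lemma lpartial_sum:
  assumes "\<And>i. i \<in> I \<Longrightarrow> smooth (f i)" "set bs \<subseteq> Basis"
  shows "lpartial bs (\<lambda>x. \<Sum>i\<in>I. f i x) = (\<lambda>x. \<Sum>i\<in>I. lpartial bs (f i) x)"
  using assms(2) by (induction bs) (simp_all add: partial_sum assms smooth_lpartial)

text \<open>
  Every multiplier that occurs below is a sum of products of linear functions, so the Leibniz rule is only needed
  for one linear factor. A linear factor absorbs at most one derivative, which is why the sum runs over
  the positions \<open>p\<close> at which a direction is deleted from the list.
\<close>

lemma lpartial_linear_mult:
  assumes "smooth g" "set bs \<subseteq> Basis"
  shows "lpartial bs (\<lambda>x. (x \<bullet> v) * g x) =
    (\<lambda>x. (x \<bullet> v) * lpartial bs g x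
        + (\<Sum>p<length bs. (bs ! p \<bullet> v) * lpartial (take p bs @ drop (Suc p) bs) g x))"
  using assms(2)
proof (induction bs)
  case (Cons b bs)
  have sub: "set (take p bs @ drop (Suc p) bs) \<subseteq> Basis" for p
    using Cons.prems by (auto dest: in_set_takeD in_set_dropD)
  have s: "smooth (\<lambda>x. (bs ! p \<bullet> v) * lpartial (take p bs @ drop (Suc p) bs) g x)" for p
    using smooth_cmult smooth_lpartial[OF assms(1) sub] by blast
  have s2: "smooth (lpartial bs g)" using Cons.prems assms smooth_lpartial by auto
  have "lpartial (b # bs) (\<lambda>x. (x \<bullet> v) * g x) =
     partial b (\<lambda>x. (x \<bullet> v) * lpartial bs g x
        + (\<Sum>p<length bs. (bs ! p \<bullet> v) * lpartial (take p bs @ drop (Suc p) bs) g x))"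
    using Cons by simp
  also have "\<dots> = (\<lambda>x. (x \<bullet> v) * partial b (lpartial bs g) x + (b \<bullet> v) * lpartial bs g x
      + (\<Sum>p<length bs. partial b (\<lambda>x. (bs ! p \<bullet> v) * lpartial (take p bs @ drop (Suc p) bs) g x) x))"
    using s s2 by (simp add: partial_add partial_sum smooth_linear_mult smooth_sum partial_linear_mult)
  also have "\<dots> = (\<lambda>x. (x \<bullet> v) * partial b (lpartial bs g) x + (b \<bullet> v) * lpartial bs g x
      + (\<Sum>p<length bs. (bs ! p \<bullet> v) * lpartial (b # take p bs @ drop (Suc p) bs) g x))"
    using lpartial_cmult[OF smooth_lpartial[OF assms(1) sub], of "[b]"] Cons.prems by simp
  finally show ?case
    by (simp add: fun_eq_iff lessThan_Suc_eq_insert_0 sum.reindex)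
qed simp

text \<open>
  The second difference of \<open>f\<close> over a square of side \<open>h\<close>, divided by \<open>h\<^sup>2\<close>, equals either mixed partial
  at some point of the square, by applying the mean value theorem once in each direction. Both orders
  therefore have the same limit.
\<close>

lemma partial_commute:
  fixes f :: "'a::euclidean_space \<Rightarrow> real"
  assumes f: "smooth f" and a: "a \<in> Basis" and b: "b \<in> Basis"
  shows "partial a (partial b f) = partial b (partial a f)"
proof
  fix x
  define D where "D h = f (x + h *\<^sub>R a + h *\<^sub>R b) - f (x + h *\<^sub>R a) - f (x + h *\<^sub>R b) + f x" for h
  have key: "\<exists>s t. 0 < s \<and> s < h \<and> 0 < t \<and> t < h \<and>
        f (x + h *\<^sub>R a + h *\<^sub>R b) - f (x + h *\<^sub>R a) - f (x + h *\<^sub>R b) + f x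
          = h\<^sup>2 * partial b (partial a f) (x + s *\<^sub>R a + t *\<^sub>R b)"
    if h: "h > 0" and a: "a \<in> Basis" and b: "b \<in> Basis" for h and a b :: 'a
  proof -
    let ?g = "\<lambda>s. f ((x + h *\<^sub>R b) + s *\<^sub>R a) - f (x + s *\<^sub>R a)"
    have "\<And>s. (?g has_real_derivative
        (partial a f ((x + h *\<^sub>R b) + s *\<^sub>R a) - partial a f (x + s *\<^sub>R a))) (at s)"
      by (intro DERIV_diff partial_line_derivative f)
    from MVT2[OF h this] obtain s where s: "0 < s" "s < h" and
      e1: "?g h - ?g 0 = (h - 0) * (partial a f ((x + h *\<^sub>R b) + s *\<^sub>R a) - partial a f (x + s *\<^sub>R a))"
      by blast
    have "\<And>t. ((\<lambda>t. partial a f ((x + s *\<^sub>R a) + t *\<^sub>R b)) has_real_derivative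
        partial b (partial a f) ((x + s *\<^sub>R a) + t *\<^sub>R b)) (at t)"
      by (intro partial_line_derivative smooth_partial f a)
    from MVT2[OF h this] obtain t where t: "0 < t" "t < h" and
      e2: "partial a f ((x + s *\<^sub>R a) + h *\<^sub>R b) - partial a f ((x + s *\<^sub>R a) + 0 *\<^sub>R b)
        = (h - 0) * partial b (partial a f) ((x + s *\<^sub>R a) + t *\<^sub>R b)"
      by blast
    have "?g h - ?g 0 = h * (h * partial b (partial a f) ((x + s *\<^sub>R a) + t *\<^sub>R b))"
      using e1 e2 by (simp add: add_ac)
    then show ?thesis
      using s t by (intro exI[of _ s] exI[of _ t]) (simp add: power2_eq_square algebra_simps)
  qed
  have lim: "((\<lambda>h. D h / h\<^sup>2) \<longlongrightarrow> partial b (partial a f) x) (at_right 0)"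
    if D: "\<And>h. h > 0 \<Longrightarrow> \<exists>s t. 0 < s \<and> s < h \<and> 0 < t \<and> t < h \<and>
         D h = h\<^sup>2 * partial b (partial a f) (x + s *\<^sub>R a + t *\<^sub>R b)"
      and a: "a \<in> Basis" and b: "b \<in> Basis" for a b
  proof (rule tendstoI)
    fix e :: real assume e: "e > 0"
    have "isCont (partial b (partial a f)) x"
      using smooth_continuous[OF smooth_partial[OF smooth_partial[OF f a] b], of UNIV]
      by (simp add: continuous_on_eq_continuous_at)
    then obtain d where d: "d > 0" "\<And>y. dist y x < d \<Longrightarrow>
        dist (partial b (partial a f) y) (partial b (partial a f) x) < e"
      unfolding continuous_at_eps_delta using e by blast
    have "dist (D h / h\<^sup>2) (partial b (partial a f) x) < e" if h: "0 < h" "h < d / 2" for h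
    proof -
      obtain s t where st: "0 < s" "s < h" "0 < t" "t < h"
         "D h = h\<^sup>2 * partial b (partial a f) (x + s *\<^sub>R a + t *\<^sub>R b)"
        using D[OF h(1)] by blast
      have "norm (s *\<^sub>R a + t *\<^sub>R b) \<le> s + t"
        using norm_triangle_ineq[of "s *\<^sub>R a" "t *\<^sub>R b"] st a b by simp
      then have "dist (x + s *\<^sub>R a + t *\<^sub>R b) x < d"
        using st h by (simp add: dist_norm add.assoc)
      with d(2) st h show ?thesis by simp
    qed
    then show "\<forall>\<^sub>F h in at_right 0. dist (D h / h\<^sup>2) (partial b (partial a f) x) < e"
      using d(1) by (intro eventually_at_rightI[of 0 "d/2"]) auto
  qed
  have "((\<lambda>h. D h / h\<^sup>2) \<longlongrightarrow> partial b (partial a f) x) (at_right 0)"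
    by (rule lim[OF _ a b]) (use key[OF _ a b] in \<open>auto simp: D_def\<close>)
  moreover have "((\<lambda>h. D h / h\<^sup>2) \<longlongrightarrow> partial a (partial b f) x) (at_right 0)"
  proof (rule lim[OF _ b a])
    fix h :: real assume "h > 0"
    from key[OF this b a] show "\<exists>s t. 0 < s \<and> s < h \<and> 0 < t \<and> t < h \<and>
         D h = h\<^sup>2 * partial a (partial b f) (x + s *\<^sub>R b + t *\<^sub>R a)"
      by (simp add: D_def algebra_simps)
  qed
  ultimately show "partial a (partial b f) x = partial b (partial a f) x"
    using tendsto_unique trivial_limit_at_right_real by blast
qed

text \<open>
  The classes are defined through multi-indices, with one fixed order of differentiation, whereas the chain
  rule produces directions in arbitrary order. Swapping neighbours reconciles the two.
\<close>

lemma lpartial_mset_cong: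
  assumes "smooth f" "mset bs = mset cs" "set bs \<subseteq> Basis"
  shows "lpartial bs f = lpartial cs f"
proof -
  have move: "lpartial (xs @ b # ys) f = lpartial (b # xs @ ys) f"
    if "set (b # xs @ ys) \<subseteq> Basis" for b xs ys
    using that
  proof (induction xs)
    case (Cons x xs)
    then have "lpartial ((x # xs) @ b # ys) f = partial x (lpartial (b # xs @ ys) f)" by simp
    also have "\<dots> = partial b (partial x (lpartial (xs @ ys) f))"
      using Cons.prems by (simp, intro partial_commute smooth_lpartial assms(1)) auto
    finally show ?case by simp
  qed simp
  show ?thesis using assms(2,3)
  proof (induction bs arbitrary: cs)
    case (Cons b bs)
    then have "b \<in> set cs" by (metis list.set_intros(1) mset_eq_setD)
    then obtain xs ys where cs: "cs = xs @ b # ys" by (meson split_list)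
    have "set cs \<subseteq> Basis" using Cons.prems mset_eq_setD by metis
    then have "lpartial cs f = lpartial (b # xs @ ys) f" unfolding cs by (intro move) auto
    moreover have "lpartial bs f = lpartial (xs @ ys) f"
      using Cons.prems cs by (intro Cons.IH) auto
    ultimately show ?case by simp
  qed auto
qed

lemma coord_list: "distinct (coord_list :: 'a::euclidean_space list)" "set (coord_list :: 'a list) = Basis"
proof -
  have "\<exists>bs :: 'a list. distinct bs \<and> set bs = Basis"
    using finite_distinct_list[OF finite_Basis] by blast
  from someI_ex[OF this] show "distinct (coord_list :: 'a list)" "set (coord_list :: 'a list) = Basis"
    unfolding coord_list_def by auto
qed

text \<open>
  The list of directions, in the order in which \<open>mi_partial\<close> differentiates.
\<close>

definition mi_list :: "('a::euclidean_space \<Rightarrow> nat) \<Rightarrow> 'a list"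
  where "mi_list \<alpha> = concat (map (\<lambda>b. replicate (\<alpha> b) b) coord_list)"

lemma mi_partial_eq_lpartial: "mi_partial \<alpha> f = lpartial (mi_list \<alpha>) f"
proof -
  have "foldr (\<lambda>b. partial b ^^ \<alpha> b) bs f = lpartial (concat (map (\<lambda>b. replicate (\<alpha> b) b) bs)) f" for bs
  proof (induction bs)
    case (Cons b bs)
    have "lpartial (replicate k b) g = (partial b ^^ k) g" for k g
      by (induction k) auto
    with Cons show ?case by (simp add: lpartial_append)
  qed simp
  then show ?thesis unfolding mi_partial_def mi_list_def .
qed

lemma mi_list: "length (mi_list \<alpha>) = mi_order \<alpha>" "set (mi_list \<alpha>) \<subseteq> Basis"
proof -
  show "length (mi_list \<alpha>) = mi_order \<alpha>"
    unfolding mi_list_def mi_order_def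
    by (simp add: length_concat comp_def sum_list_distinct_conv_sum_set coord_list)
  show "set (mi_list \<alpha>) \<subseteq> Basis"
    unfolding mi_list_def by (auto simp: coord_list)
qed

lemma mset_mi_list:
  fixes bs :: "'a::euclidean_space list"
  assumes "set bs \<subseteq> Basis"
  shows "mset (mi_list (count_list bs)) = mset bs"
proof (rule multiset_eqI)
  fix b
  have "count (mset (concat (map (\<lambda>b. replicate (\<alpha> b) b) cs))) b = (if b \<in> set cs then \<alpha> b else 0)"
    if "distinct cs" for cs :: "'a list" and \<alpha>
    using that by (induction cs) auto
  from this[OF coord_list(1)]
  show "count (mset (mi_list (count_list bs))) b = count (mset bs) b"
    using assms unfolding mi_list_def by (auto simp: coord_list count_mset count_list_0_iff)
qed

text \<open>
  A bound \<open>P\<close> that depends only on the order of differentiation may thus be stated for lists of basis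
  directions, a form that suits induction better than multi-indices.
\<close>

lemma mi_D_iff_lpartial:
  fixes f :: "'a::euclidean_space \<Rightarrow> real"
  assumes "smooth f"
  shows "(\<forall>\<alpha>. P (mi_order \<alpha>) (cmod (mi_D \<alpha> f x))) \<longleftrightarrow>
    (\<forall>bs. set bs \<subseteq> Basis \<longrightarrow> P (length bs) \<bar>lpartial bs f x\<bar>)"
proof -
  have c: "cmod (mi_D \<alpha> f x) = \<bar>lpartial (mi_list \<alpha>) f x\<bar>" for \<alpha>
    by (simp add: mi_D_def norm_mult norm_power mi_partial_eq_lpartial)
  show ?thesis
  proof (intro iffI allI impI)
    fix bs :: "'a list" assume "\<forall>\<alpha>. P (mi_order \<alpha>) (cmod (mi_D \<alpha> f x))" and bs: "set bs \<subseteq> Basis"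
    then have "P (mi_order (count_list bs)) \<bar>lpartial (mi_list (count_list bs)) f x\<bar>" using c by metis
    moreover have "lpartial (mi_list (count_list bs)) f = lpartial bs f"
      by (intro lpartial_mset_cong assms mset_mi_list bs mi_list)
    moreover have "mi_order (count_list bs) = length bs"
      using mset_mi_list[OF bs] mi_list(1) by (metis size_mset)
    ultimately show "P (length bs) \<bar>lpartial bs f x\<bar>" by simp
  next
    fix \<alpha> assume "\<forall>bs. set bs \<subseteq> Basis \<longrightarrow> P (length bs) \<bar>lpartial bs f x\<bar>"
    then show "P (mi_order \<alpha>) (cmod (mi_D \<alpha> f x))" using mi_list[of \<alpha>] c by metis
  qed
qed

section \<open>Diagonalisation of symmetric matrices\<close>

text \<open>
  The eigenvector maximises \<open>x \<bullet> A x\<close> on the unit sphere of \<open>V\<close>. Along \<open>x + t y\<close>, for \<open>y\<close> in \<open>V\<close> orthogonal to \<open>x\<close>, the quadratic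
  polynomial in \<open>t\<close> that expresses maximality has no linear term, so \<open>A x\<close> is orthogonal to all such \<open>y\<close>, and
  in particular to the component of \<open>A x\<close> itself that is orthogonal to \<open>x\<close>.
\<close>

lemma symmetric_matrix_invariant_eigenvector:
  fixes A :: "real^'n^'n"
  assumes sym: "transpose A = A" and V: "subspace V" "\<And>x. x \<in> V \<Longrightarrow> A *v x \<in> V" and ne: "V \<noteq> {0}"
  obtains x l where "x \<in> V" "norm x = 1" "A *v x = l *\<^sub>R x"
proof -
  have sa: "(A *v x) \<bullet> y = x \<bullet> (A *v y)" for x y
    using dot_lmul_matrix[of x A y] sym
    by (metis inner_commute transpose_matrix_vector)
  define g where "g x = x \<bullet> (A *v x)" for x
  obtain v where v: "v \<in> V" "v \<noteq> 0" using ne V(1) subspace_0 by fastforce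
  let ?K = "V \<inter> sphere 0 1"
  have "compact ?K"
    by (metis V(1) closed_subspace compact_Int_closed compact_sphere inf_commute)
  moreover have "(1 / norm v) *\<^sub>R v \<in> ?K"
    using v V(1) by (auto simp: subspace_scale)
  moreover have "continuous_on ?K g"
    unfolding g_def by (intro continuous_intros matrix_vector_mult_linear_continuous_on)
  ultimately obtain x where x: "x \<in> ?K" and max: "\<And>y. y \<in> ?K \<Longrightarrow> g y \<le> g x"
    using continuous_attains_sup[of ?K g] by blast
  have nx: "norm x = 1" "x \<in> V" using x by auto
  then have xx: "x \<bullet> x = 1" by (simp add: norm_eq_1)
  have le: "g y \<le> g x * (y \<bullet> y)" if "y \<in> V" for y
  proof (cases "y = 0")
    case False
    have "g ((1 / norm y) *\<^sub>R y) \<le> g x"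
      using False that V(1) by (intro max) (auto simp: subspace_scale)
    then have "(1 / norm y)\<^sup>2 * g y \<le> g x"
      by (simp add: g_def matrix_vector_mult_scaleR power2_eq_square)
    then show ?thesis
      using False by (simp add: field_simps dot_square_norm)
  qed (simp add: g_def)
  have orth: "(A *v x) \<bullet> y = 0" if y: "y \<in> V" "x \<bullet> y = 0" for y
  proof -
    let ?c = "(A *v x) \<bullet> y" and ?k = "g x * (y \<bullet> y) - g y"
    have q: "2 * t * ?c \<le> t\<^sup>2 * ?k" for t
    proof -
      have "x + t *\<^sub>R y \<in> V" using y(1) nx V(1) by (simp add: subspace_add subspace_scale)
      from le[OF this]
      have "g x + 2 * t * ?c + t\<^sup>2 * g y \<le> g x * (1 + t\<^sup>2 * (y \<bullet> y))"
        using y(2) xx sa[of x y]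
        by (simp add: g_def matrix_vector_right_distrib matrix_vector_mult_scaleR inner_add_left
            inner_add_right inner_commute algebra_simps power2_eq_square)
      then show ?thesis by (simp add: algebra_simps)
    qed
    have k: "?k \<ge> 0" using le[OF y(1)] by simp
    show ?thesis
    proof (rule ccontr)
      assume c: "?c \<noteq> 0"
      \<comment> \<open>The summand \<open>1\<close> excludes a zero denominator.\<close>
      define t where "t = ?c / (?k + 1)"
      have "t\<^sup>2 * ?k \<le> t\<^sup>2 * (?k + 1)" by (simp add: mult_left_mono)
      also have "\<dots> = t * ?c" using k by (simp add: t_def power2_eq_square)
      finally have "2 * (t * ?c) \<le> t * ?c" using q[of t] by simp
      moreover have "t * ?c > 0" using c k unfolding t_def
        by (metis add_nonneg_pos divide_pos_pos not_real_square_gt_zero times_divide_eq_left zero_less_one)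
      ultimately show False by simp
    qed
  qed
  let ?y = "A *v x - g x *\<^sub>R x"
  have yV: "?y \<in> V" using nx V by (simp add: subspace_diff subspace_scale)
  have xy: "x \<bullet> ?y = 0" by (simp add: inner_diff_right g_def xx)
  have "?y \<bullet> ?y = (A *v x) \<bullet> ?y - g x * (x \<bullet> ?y)" by (simp add: inner_diff_left)
  also have "\<dots> = 0" using orth[OF yV xy] xy by simp
  finally have "A *v x = g x *\<^sub>R x" by simp
  with nx that show ?thesis by blast
qed

text \<open>
  An orthonormal family of eigenvectors of largest size spans the space: its orthogonal complement is
  invariant, hence would contain a further eigenvector.
\<close>

theorem symmat_diagonalise:
  fixes A :: "'n::finite symmat"
  obtains S a where "orthogonal_matrix S" "A = conj_symmat S (diag_symmat a)"
proof -
  let ?A = "mat_of_symmat A"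
  have sym: "transpose ?A = ?A" using mat_of_symmat[of A] by simp
  have sa: "(?A *v x) \<bullet> y = x \<bullet> (?A *v y)" for x y
    using dot_lmul_matrix[of x ?A y] sym by (metis inner_commute transpose_matrix_vector)
  define \<B> where "\<B> = {B. pairwise orthogonal B \<and> (\<forall>b\<in>B. norm b = 1 \<and> (\<exists>l. ?A *v b = l *\<^sub>R b))}"
  have ind: "independent B" if "B \<in> \<B>" for B
    using that by (intro pairwise_orthogonal_independent) (auto simp: \<B>_def)
  have bd: "finite B \<and> card B \<le> CARD('n)" if "B \<in> \<B>" for B
    using independent_bound[OF ind[OF that]] by simp
  have "{} \<in> \<B>" by (simp add: \<B>_def)
  then obtain B where B: "B \<in> \<B>" and max: "\<And>C. C \<in> \<B> \<Longrightarrow> card C \<le> card B"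
    using ex_has_greatest_nat[of "\<lambda>B. B \<in> \<B>" "{}" card "Suc CARD('n)"] bd less_Suc_eq_le by metis
  define V where "V = {y. \<forall>b\<in>B. b \<bullet> y = 0}"
  have "V = {0}"
  proof (rule ccontr)
    assume ne: "V \<noteq> {0}"
    have "subspace V" by (auto simp: V_def subspace_def inner_add_right)
    moreover have "?A *v y \<in> V" if "y \<in> V" for y
      unfolding V_def
    proof safe
      fix b assume b: "b \<in> B"
      then obtain l where "?A *v b = l *\<^sub>R b" using B by (auto simp: \<B>_def)
      then show "b \<bullet> (?A *v y) = 0" using that b sa[of b y] by (simp add: V_def)
    qed
    ultimately obtain x l where x: "x \<in> V" "norm x = 1" "?A *v x = l *\<^sub>R x"
      using symmetric_matrix_invariant_eigenvector[OF sym _ _ ne] by blast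
    have "x \<notin> B"
      using x by (auto simp: V_def)
    moreover have "insert x B \<in> \<B>"
      using B x by (auto simp: \<B>_def V_def pairwise_insert orthogonal_def inner_commute)
    ultimately show False using max[of "insert x B"] bd[OF B] by simp
  qed
  have "span B = UNIV"
  proof (rule ccontr)
    assume "span B \<noteq> UNIV"
    then obtain y where "y \<noteq> 0" "\<forall>x\<in>span B. y \<bullet> x = 0" using span_not_UNIV_orthogonal by blast
    then have "y \<in> V" by (auto simp: V_def span_base inner_commute)
    then show False using \<open>y \<noteq> 0\<close> \<open>V = {0}\<close> by simp
  qed
  then have "card B = CARD('n)"
    using dim_eq_card[of B UNIV] ind[OF B] by simp
  then obtain \<beta> :: "'n \<Rightarrow> real^'n" where \<beta>: "bij_betw \<beta> UNIV B"
    using bd[OF B] by (metis finite_class.finite_UNIV finite_same_card_bij)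
  have inB: "\<beta> i \<in> B" for i using \<beta> by (auto simp: bij_betw_def)
  have "\<exists>l. ?A *v \<beta> i = l *\<^sub>R \<beta> i" for i using inB B by (auto simp: \<B>_def)
  then obtain a where a: "\<And>i. ?A *v \<beta> i = a i *\<^sub>R \<beta> i" by metis
  define S :: "real^'n^'n" where "S = (\<chi> r i. \<beta> i $ r)"
  have on: "\<beta> i \<bullet> \<beta> j = (if i = j then 1 else 0)" for i j
  proof (cases "i = j")
    case True
    then show ?thesis using inB B by (auto simp: \<B>_def norm_eq_1)
  next
    case False
    then have "\<beta> i \<noteq> \<beta> j" using \<beta> by (metis UNIV_I bij_betw_def injD)
    then show ?thesis
      using inB B False by (auto simp: \<B>_def pairwise_def orthogonal_def)
  qed
  have S1: "transpose S ** S = mat 1"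
    using on by (simp add: S_def matrix_matrix_mult_def transpose_def mat_def vec_eq_iff inner_vec_def)
  then have S2: "S ** transpose S = mat 1"
    using matrix_left_right_inverse by blast
  have orth: "orthogonal_matrix S" using S1 S2 by (simp add: orthogonal_matrix_def)
  let ?D = "mat_of_symmat (diag_symmat (\<chi> i. a i))"
  have "?A ** S = S ** ?D"
  proof -
    have "(\<Sum>k\<in>UNIV. ?A $ r $ k * \<beta> i $ k) = \<beta> i $ r * a i" for r i
      using a[of i] by (simp add: vec_eq_iff matrix_vector_mult_def)
    then show ?thesis
      by (simp add: vec_eq_iff matrix_matrix_mult_def S_def diag_symmat.rep_eq if_distrib
          sum.delta cong: if_cong)
  qed
  then have "?A = S ** ?D ** transpose S"
    using S2 by (metis matrix_mul_assoc matrix_mul_rid)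
  then have "A = conj_symmat S (diag_symmat (\<chi> i. a i))"
    by (metis conj_symmat.rep_eq mat_of_symmat_inject)
  with orth that show ?thesis by blast
qed

lemma eigenvalue_tuple_conj_diag:
  assumes "orthogonal_matrix S"
  shows "eigenvalue_tuple (conj_symmat S (diag_symmat a)) a"
  unfolding eigenvalue_tuple_def
proof
  fix t
  let ?D = "mat_of_symmat (diag_symmat a)"
  have S: "S ** transpose S = mat 1" using assms by (simp add: orthogonal_matrix_def)
  have "S ** mat t = t *\<^sub>R S"
    by (simp add: matrix_matrix_mult_def mat_def vec_eq_iff if_distrib sum.delta mult.commute cong: if_cong)
  then have "S ** mat t ** transpose S = t *\<^sub>R (S ** transpose S)"
    by (simp add: matrix_matrix_mult_def vec_eq_iff sum_distrib_left mult.assoc)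
  also have "\<dots> = mat t"
    unfolding S by (simp add: mat_def vec_eq_iff)
  finally have m: "S ** mat t ** transpose S = mat t" .
  have "S ** (mat t - ?D) ** transpose S = S ** mat t ** transpose S - S ** ?D ** transpose S"
    by (simp add: matrix_matrix_mult_def vec_eq_iff sum_subtractf left_diff_distrib right_diff_distrib)
  then have "mat t - S ** ?D ** transpose S = S ** (mat t - ?D) ** transpose S"
    using m by simp
  then have "det (mat t - mat_of_symmat (conj_symmat S (diag_symmat a)))
      = det (S ** transpose S) * det (mat t - ?D)"
    by (simp add: conj_symmat.rep_eq det_mul mult_ac)
  also have "\<dots> = (\<Prod>i\<in>UNIV. t - a $ i)"
    using eigenvalue_tuple_diag[of a] S by (simp add: eigenvalue_tuple_def)
  finally show "det (mat t - mat_of_symmat (conj_symmat S (diag_symmat a))) = (\<Prod>i\<in>UNIV. t - a $ i)" .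
qed

section \<open>Divided differences as averages over a ball\<close>

text \<open>
  The partial fraction expansion of \<open>1 / \<Prod>(x - p)\<close>. It supplies the coefficient of the new node when a node
  is added to a divided difference.
\<close>

lemma sum_partial_fractions:
  fixes x :: "'a::field"
  assumes "finite P" "P \<noteq> {}" "x \<notin> P"
  shows "(\<Sum>p\<in>P. 1 / ((x - p) * (\<Prod>q\<in>P - {p}. p - q))) = 1 / (\<Prod>p\<in>P. x - p)"
  using assms
proof (induction P arbitrary: x rule: finite_ne_induct)
  case (insert q P)
  define w where "w p = 1 / (\<Prod>q\<in>P - {p}. p - q)" for p
  have IH: "(\<Sum>p\<in>P. w p / (y - p)) = 1 / (\<Prod>p\<in>P. y - p)" if "y \<notin> P" for y
    using insert.IH[OF that] by (simp add: w_def mult.commute)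
  have split: "1 / ((x - p) * (\<Prod>r\<in>insert q P - {p}. p - r))
      = (w p / (x - p) - w p / (q - p)) / (x - q)" if "p \<in> P" for p
  proof -
    have "insert q P - {p} = insert q (P - {p})" using that insert.hyps by auto
    then have "1 / ((x - p) * (\<Prod>r\<in>insert q P - {p}. p - r)) = w p / ((x - p) * (p - q))"
      using insert.hyps by (simp add: w_def)
    also have "\<dots> = (w p / (x - p) - w p / (q - p)) / (x - q)"
    proof -
      have "x - p \<noteq> 0" "p - q \<noteq> 0" "q - p \<noteq> 0" "x - q \<noteq> 0" using that insert by auto
      then show ?thesis by (simp add: divide_simps) (simp add: algebra_simps)
    qed
    finally show ?thesis .
  qed
  have "insert q P - {q} = P" using insert.hyps by auto
  then have "(\<Sum>p\<in>insert q P. 1 / ((x - p) * (\<Prod>r\<in>insert q P - {p}. p - r)))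
     = 1 / ((x - q) * (\<Prod>r\<in>P. q - r)) + (\<Sum>p\<in>P. (w p / (x - p) - w p / (q - p)) / (x - q))"
    using insert.hyps split by simp
  also have "\<dots> = 1 / ((x - q) * (\<Prod>r\<in>P. q - r))
     + (1 / (\<Prod>p\<in>P. x - p) - 1 / (\<Prod>p\<in>P. q - p)) / (x - q)"
    using IH[of x] IH[of q] insert by (simp add: sum_subtractf flip: sum_divide_distrib)
  also have "\<dots> = 1 / (\<Prod>p\<in>insert q P. x - p)"
  proof -
    have "1 / (d * B) + (1 / A - 1 / B) / d = 1 / (d * A)" if "d \<noteq> 0" "A \<noteq> 0" "B \<noteq> 0" for d A B :: 'a
      using that by (simp add: divide_simps)
    moreover have "(\<Prod>p\<in>P. x - p) \<noteq> 0" "(\<Prod>p\<in>P. q - p) \<noteq> 0" "x - q \<noteq> 0"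
      using insert by auto
    ultimately show ?thesis using insert.hyps by simp
  qed
  finally show ?case .
qed simp

text \<open>
  A disc of squared radius \<open>r\<close> has area \<open>\<pi> r\<close>, so the squared modulus sends planar Lebesgue measure to \<open>\<pi>\<close> times
  Lebesgue measure on the half-line. This uniformity is the reason for averaging over complex vectors:
  with real ones the density \<open>t powr (- 1/2)\<close> would appear, and no divided differences.
\<close>

lemma integral_disc_radial:
  fixes g :: "real \<Rightarrow> real"
  assumes J: "finite J" "card J = 2" and r: "r \<ge> 0" and g: "g \<in> borel_measurable borel"
  defines "Q \<equiv> \<lambda>u. \<Sum>j\<in>J. (u j)\<^sup>2"
  shows "(\<integral>u. indicator {u. Q u \<le> r} u * g (Q u) \<partial>(\<Pi>\<^sub>M j\<in>J. lborel))
     = pi * (\<integral>t. indicator {0..r} t * g t \<partial>lborel)"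
proof -
  let ?P = "\<Pi>\<^sub>M j\<in>J. (lborel :: real measure)"
  have Qm [measurable]: "Q \<in> borel_measurable ?P" unfolding Q_def by measurable
  have Q0: "Q u \<ge> 0" for u by (simp add: Q_def sum_nonneg)
  let ?S = "\<lambda>x. {u \<in> space ?P. Q u \<le> x}"
  have vol0: "emeasure ?P (?S x) = ennreal (pi * x)" if "x > 0" for x
  proof -
    have "?S x = {u. sqrt (Q u) \<le> sqrt x} \<inter> space ?P" by auto
    then show ?thesis
      using emeasure_cball_aux[OF J(1), of "sqrt x"] that J(2)
      by (simp add: Q_def unit_ball_vol_2)
  qed
  have vol: "emeasure ?P (?S x) = ennreal (pi * x)" if "x \<ge> 0" for x
  proof (cases "x = 0")
    case True
    have "emeasure ?P (?S 0) \<le> 0 + ennreal e" if "e > 0" for e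
    proof -
      have "emeasure ?P (?S 0) \<le> emeasure ?P (?S (e / pi))"
        using that by (intro emeasure_mono) (auto intro: order_trans)
      also have "\<dots> = ennreal e" using vol0[of "e/pi"] that by simp
      finally show ?thesis by simp
    qed
    then have "emeasure ?P (?S 0) \<le> 0" by (rule ennreal_le_epsilon)
    then show ?thesis using True by simp
  qed (use that vol0 in auto)
  let ?M = "distr (density ?P (indicator {u. Q u \<le> r})) borel Q"
  let ?N = "density lborel (\<lambda>t. ennreal (pi * indicator {0..r} t))"
  have ind [measurable]: "(\<lambda>u. indicator {u. Q u \<le> r} u :: ennreal) \<in> borel_measurable ?P"
    "(\<lambda>u. indicator {u. Q u \<le> r} u :: real) \<in> borel_measurable ?P"
  proof -
    have "(\<lambda>u. indicator {..r} (Q u) :: ennreal) \<in> borel_measurable ?P"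
      "(\<lambda>u. indicator {..r} (Q u) :: real) \<in> borel_measurable ?P" by measurable
    moreover have "indicator {u. Q u \<le> r} = (\<lambda>u. indicator {..r} (Q u) :: ennreal)"
      "indicator {u. Q u \<le> r} = (\<lambda>u. indicator {..r} (Q u) :: real)"
      by (auto simp: indicator_def fun_eq_iff)
    ultimately show "(\<lambda>u. indicator {u. Q u \<le> r} u :: ennreal) \<in> borel_measurable ?P"
    "(\<lambda>u. indicator {u. Q u \<le> r} u :: real) \<in> borel_measurable ?P" by simp_all
  qed
  have M: "emeasure ?M {x<..} = ennreal (pi * (if x < r then r - max x 0 else 0))" for x
  proof -
    have "emeasure ?M {x<..} = (\<integral>\<^sup>+u. indicator {u. Q u \<le> r} u * indicator (Q -` {x<..} \<inter> space ?P) u \<partial>?P)"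
      by (simp add: emeasure_distr emeasure_density)
    also have "\<dots> = (\<integral>\<^sup>+u. indicator {u \<in> space ?P. x < Q u \<and> Q u \<le> r} u \<partial>?P)"
      by (intro nn_integral_cong) (auto simp: indicator_def)
    also have "\<dots> = emeasure ?P {u \<in> space ?P. x < Q u \<and> Q u \<le> r}"
      by simp
    also have "\<dots> = ennreal (pi * (if x < r then r - max x 0 else 0))"
    proof (cases "x < r")
      case True
      show ?thesis
      proof (cases "x < 0")
        case neg: True
        then have "{u \<in> space ?P. x < Q u \<and> Q u \<le> r} = ?S r" using Q0 by (auto intro: less_le_trans)
        then show ?thesis using vol[OF r] True neg by simp
      next
        case False
        have "{u \<in> space ?P. x < Q u \<and> Q u \<le> r} = ?S r - ?S x" by auto
        also have "emeasure ?P \<dots> = emeasure ?P (?S r) - emeasure ?P (?S x)"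
          using vol[of x] False True by (intro emeasure_Diff) auto
        also have "\<dots> = ennreal (pi * (r - x))"
          using vol[of x] vol[OF r] False True
          by (simp add: ennreal_minus algebra_simps)
        finally show ?thesis using True False by simp
      qed
    next
      case False
      then have "{u \<in> space ?P. x < Q u \<and> Q u \<le> r} = {}" by auto
      then show ?thesis using False by (simp only: emeasure_empty if_False mult_zero_right ennreal_0)
    qed
    finally show ?thesis .
  qed
  have N: "emeasure ?N {x<..} = ennreal (pi * (if x < r then r - max x 0 else 0))" for x
  proof -
    have "emeasure ?N {x<..} = (\<integral>\<^sup>+t. ennreal pi * indicator ({x<..} \<inter> {0..r}) t \<partial>lborel)"
      by (simp add: emeasure_density) (intro nn_integral_cong, auto simp: indicator_def)
    also have "\<dots> = ennreal pi * emeasure lborel ({x<..} \<inter> {0..r})"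
      by (simp add: nn_integral_cmult)
    also have "emeasure lborel ({x<..} \<inter> {0..r}) = ennreal (if x < r then r - max x 0 else 0)"
    proof -
      consider "x < 0" | "0 \<le> x" "x < r" | "r \<le> x" by linarith
      then show ?thesis
      proof cases
        case 1
        then have "{x<..} \<inter> {0..r} = {0..r}" by auto
        with 1 r show ?thesis by simp
      next
        case 2
        then have "{x<..} \<inter> {0..r} = {x<..r}" by auto
        with 2 show ?thesis by simp
      next
        case 3
        then have "{x<..} \<inter> {0..r} = {}" by auto
        with 3 show ?thesis by simp
      qed
    qed
    finally show ?thesis by (simp add: ennreal_mult')
  qed
  have eq: "?M = ?N"
    by (rule measure_eqI_lessThan) (simp_all add: M N)
  have "(\<integral>u. indicator {u. Q u \<le> r} u * g (Q u) \<partial>?P)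
      = (\<integral>u. g (Q u) \<partial>density ?P (\<lambda>u. ennreal (indicator {u. Q u \<le> r} u)))"
    by (subst integral_density) (use g in \<open>auto\<close>)
  also have "\<dots> = (\<integral>t. g t \<partial>?M)"
    using g by (subst integral_distr) (auto simp: ennreal_indicator)
  also have "\<dots> = (\<integral>t. (pi * indicator {0..r} t) * g t \<partial>lborel)"
    unfolding eq using g by (subst integral_density) auto
  also have "\<dots> = pi * (\<integral>t. indicator {0..r} t * g t \<partial>lborel)"
    by (simp add: mult.assoc)
  finally show ?thesis .
qed

lemma integral_lborel_shift_FTC:
  fixes \<phi> :: "real \<Rightarrow> real"
  assumes d: "\<And>t. (\<phi> has_real_derivative \<phi>' t) (at t)" and c: "continuous_on UNIV \<phi>'"
    and r: "r \<ge> 0" and "b \<noteq> p"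
  shows "(\<integral>t. indicator {0..r} t * \<phi>' (c + b * t + (r - t) * p) \<partial>lborel)
     = (\<phi> (c + r * b) - \<phi> (c + r * p)) / (b - p)"
proof -
  have "((\<lambda>t. \<phi> (c + b * t + (r - t) * p) / (b - p)) has_real_derivative
      \<phi>' (c + b * t + (r - t) * p)) (at t)" for t
  proof -
    have "((\<lambda>t. c + b * t + (r - t) * p) has_real_derivative (b - p)) (at t)"
      by (auto intro!: derivative_eq_intros)
    from DERIV_cdivide[OF DERIV_chain2[OF d this], of "b - p"] show ?thesis
      using \<open>b \<noteq> p\<close> by simp
  qed
  moreover have "isCont (\<lambda>t. \<phi>' (c + b * t + (r - t) * p)) t" for t
    by (rule isCont_o2[where g=\<phi>'])
      (use c in \<open>auto simp: continuous_on_eq_continuous_at intro!: continuous_intros\<close>)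
  ultimately have "(\<integral>t. \<phi>' (c + b * t + (r - t) * p) * indicator {0..r} t \<partial>lborel)
    = \<phi> (c + b * r + (r - r) * p) / (b - p) - \<phi> (c + b * 0 + (r - 0) * p) / (b - p)"
    using r by (intro integral_FTC_Icc_real) auto
  then show ?thesis by (simp add: mult.commute diff_divide_distrib)
qed

lemma integrable_ball_PiM:
  fixes g :: "real \<Rightarrow> real" and J :: "'i set"
  assumes J: "finite J" and g: "continuous_on UNIV g"
    and L: "L \<in> borel_measurable (\<Pi>\<^sub>M j\<in>J. lborel)"
    and bd: "\<And>u. (\<Sum>j\<in>J. (u j)\<^sup>2) \<le> (r::real) \<Longrightarrow> \<bar>L u\<bar> \<le> (R::real)"
  shows "integrable (\<Pi>\<^sub>M j\<in>J. lborel) (\<lambda>u. indicator {u. (\<Sum>j\<in>J. (u j)\<^sup>2) \<le> r} u * g (L u))"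
proof -
  let ?P = "\<Pi>\<^sub>M j\<in>J. (lborel :: real measure)"
  let ?A = "{u \<in> space ?P. (\<Sum>j\<in>J. (u j)\<^sup>2) \<le> r}"
  note L [measurable]
  have gm [measurable]: "g \<in> borel_measurable borel"
    using g by (rule borel_measurable_continuous_onI)
  have A: "?A \<in> sets ?P" by measurable
  have sub: "?A \<subseteq> {u. sqrt (\<Sum>j\<in>J. (u j)\<^sup>2) \<le> sqrt (max r 1)} \<inter> space ?P" by auto
  have "emeasure ?P ?A \<le> emeasure ?P ({u. sqrt (\<Sum>j\<in>J. (u j)\<^sup>2) \<le> sqrt (max r 1)} \<inter> space ?P)"
    by (rule emeasure_mono[OF sub]) measurable
  also have "\<dots> < \<infinity>"
    by (subst emeasure_cball_aux[OF J]) auto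
  finally have fin: "emeasure ?P ?A < \<infinity>" .
  have "bounded (g ` {-R..R})"
    by (intro compact_imp_bounded compact_continuous_image continuous_on_subset[OF g]) auto
  then obtain B where B: "\<And>x. x \<in> {-R..R} \<Longrightarrow> norm (g x) \<le> B"
    unfolding bounded_iff by blast
  have gb: "norm (g (L u)) \<le> B" if "(\<Sum>j\<in>J. (u j)\<^sup>2) \<le> r" for u
    using bd[OF that] by (intro B) (auto simp: abs_le_iff)
  have "integrable ?P (\<lambda>u. indicator ?A u *\<^sub>R g (L u))"
    using A fin by (intro integrableI_bounded_set_indicator[where B=B]) (auto intro!: gb AE_I2 simp del: real_norm_def)
  then show ?thesis
    by (rule Bochner_Integration.integrable_cong[THEN iffD1, rotated -1]) (auto simp: indicator_def)
qed

lemma sum_squares_pairs: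
  fixes u :: "'n \<times> bool \<Rightarrow> real"
  shows "(\<Sum>j\<in>I \<times> UNIV. (u j)\<^sup>2) = (\<Sum>i\<in>I. (u (i, True))\<^sup>2 + (u (i, False))\<^sup>2)"
  by (simp add: sum.cartesian_product[symmetric, where g="\<lambda>i b. (u (i, b))\<^sup>2", simplified] UNIV_bool add.commute)

text \<open>
  By \<open>integral_disc_radial\<close>, the squared moduli of the coordinates of a uniformly distributed point of the
  complex ball are uniformly distributed on the simplex of all nonnegative vectors with sum at most \<open>r\<close>. The
  statement is thus the Hermite-Genocchi formula for the divided difference of \<open>\<phi> m\<close> at the nodes
  \<open>c + r p\<close>, where the node \<open>p = 0\<close> comes from the slack in \<open>\<le> r\<close>. Integrating out one coordinate at a time
  adds one node at a time; the constant \<open>c\<close> and the radius \<open>r\<close> record what the other coordinates leave over.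
\<close>

proposition ball_average_divided_difference:
  fixes \<phi> :: "nat \<Rightarrow> real \<Rightarrow> real" and a :: "'n \<Rightarrow> real"
  assumes d: "\<And>m t. (\<phi> m has_real_derivative \<phi> (Suc m) t) (at t)"
    and I: "finite I" "inj_on a I" "\<And>i. i \<in> I \<Longrightarrow> a i \<noteq> 0" and r: "r \<ge> 0"
  defines "s \<equiv> \<lambda>(u :: 'n \<times> bool \<Rightarrow> real) i. (u (i, True))\<^sup>2 + (u (i, False))\<^sup>2"
  shows "(\<integral>u. indicator {u. (\<Sum>i\<in>I. s u i) \<le> r} u * \<phi> (m + card I) (c + (\<Sum>i\<in>I. a i * s u i))
         \<partial>(\<Pi>\<^sub>M j\<in>I \<times> UNIV. lborel))
     = pi ^ card I * (\<Sum>p\<in>insert 0 (a ` I). \<phi> m (c + r * p) / (\<Prod>q\<in>insert 0 (a ` I) - {p}. p - q))"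
  using I r
proof (induction I arbitrary: m c r rule: finite_induct)
  case empty
  interpret product_sigma_finite "\<lambda>_::'n\<times>bool. lborel :: real measure" ..
  show ?case using empty
    by (simp add: PiM_empty lebesgue_integral_count_space_finite)
next
  case (insert k I)
  interpret P: product_sigma_finite "\<lambda>_::'n\<times>bool. lborel :: real measure" ..
  have cont: "continuous_on S (\<phi> m)" for m S
    using d DERIV_isCont continuous_at_imp_continuous_on by blast
  let ?J = "{k} \<times> (UNIV :: bool set)" and ?K = "I \<times> (UNIV :: bool set)"
  let ?m = "m + card (insert k I)"
  define h where "h u = indicator {u. (\<Sum>i\<in>insert k I. s u i) \<le> r} u *
     \<phi> ?m (c + (\<Sum>i\<in>insert k I. a i * s u i))" for u
  \<comment> \<open>The nodes before \<open>a k\<close> is added, with their weights \<open>w\<close> in the divided difference.\<close>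
  define P0 where "P0 = insert 0 (a ` I)"
  define w where "w p = 1 / (\<Prod>q\<in>P0 - {p}. p - q)" for p
  have s0: "s u i \<ge> 0" for u i by (simp add: s_def)
  have un: "?J \<union> ?K = insert k I \<times> UNIV" by auto
  have int: "integrable (\<Pi>\<^sub>M j\<in>?J \<union> ?K. lborel) h"
  proof -
    define Ab where "Ab = (\<Sum>i\<in>insert k I. \<bar>a i\<bar>)"
    have "integrable (\<Pi>\<^sub>M j\<in>?J \<union> ?K. lborel)
       (\<lambda>u. indicator {u. (\<Sum>j\<in>?J \<union> ?K. (u j)\<^sup>2) \<le> r} u * \<phi> ?m (c + (\<Sum>i\<in>insert k I. a i * s u i)))"
    proof (rule integrable_ball_PiM[where R="\<bar>c\<bar> + Ab * r" and g="\<phi> ?m"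
          and L="\<lambda>u. c + (\<Sum>i\<in>insert k I. a i * s u i)"])
      show "(\<lambda>u. c + (\<Sum>i\<in>insert k I. a i * s u i)) \<in> borel_measurable (\<Pi>\<^sub>M j\<in>?J \<union> ?K. lborel)"
        unfolding un s_def by measurable
      fix u :: "'n \<times> bool \<Rightarrow> real" assume "(\<Sum>j\<in>?J \<union> ?K. (u j)\<^sup>2) \<le> r"
      then have le: "(\<Sum>i\<in>insert k I. s u i) \<le> r" by (simp only: un sum_squares_pairs s_def)
      have "s u i \<le> r" if "i \<in> insert k I" for i
        using member_le_sum[of i "insert k I" "s u"] that le s0 insert.hyps by auto
      then have "\<bar>\<Sum>i\<in>insert k I. a i * s u i\<bar> \<le> (\<Sum>i\<in>insert k I. \<bar>a i\<bar> * r)"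
        using s0 by (intro order_trans[OF sum_abs] sum_mono) (auto simp: abs_mult intro!: mult_left_mono)
      then show "\<bar>c + (\<Sum>i\<in>insert k I. a i * s u i)\<bar> \<le> \<bar>c\<bar> + Ab * r"
        unfolding Ab_def sum_distrib_right by linarith
    qed (use insert cont in auto)
    then show ?thesis unfolding h_def un sum_squares_pairs s_def by simp
  qed
  have IHk: "(\<integral>y. h (merge ?J ?K (x, y)) \<partial>(\<Pi>\<^sub>M j\<in>?K. lborel))
     = indicator {x. s x k \<le> r} x *
       (pi ^ card I * (\<Sum>p\<in>P0. \<phi> (Suc m) (c + a k * s x k + (r - s x k) * p) * w p))" for x
  proof -
    have sk: "s (merge ?J ?K (x, y)) k = s x k" for y by (simp add: s_def merge_def)
    have si: "s (merge ?J ?K (x, y)) i = s y i" if "i \<in> I" for y i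
      using that insert.hyps by (auto simp: s_def merge_def)
    have hm: "h (merge ?J ?K (x, y)) = indicator {y. s x k + (\<Sum>i\<in>I. s y i) \<le> r} y *
        \<phi> ?m (c + (a k * s x k + (\<Sum>i\<in>I. a i * s y i)))" for y
      using insert.hyps by (simp add: h_def sk si indicator_def)
    show ?thesis
    proof (cases "s x k \<le> r")
      case False
      have "\<not> s x k + (\<Sum>i\<in>I. s y i) \<le> r" for y
        using False sum_nonneg[of I "s y"] s0 by (simp add: not_le add_strict_increasing)
      then show ?thesis using False by (simp add: hm)
    next
      case True
      have "(\<integral>y. h (merge ?J ?K (x, y)) \<partial>(\<Pi>\<^sub>M j\<in>?K. lborel))
        = (\<integral>u. indicator {u. (\<Sum>i\<in>I. s u i) \<le> r - s x k} u *
             \<phi> (Suc m + card I) ((c + a k * s x k) + (\<Sum>i\<in>I. a i * s u i)) \<partial>(\<Pi>\<^sub>M j\<in>?K. lborel))"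
        unfolding hm using insert.hyps
        by (intro Bochner_Integration.integral_cong refl) (auto simp: indicator_def add_ac algebra_simps)
      also have "\<dots> = pi ^ card I * (\<Sum>p\<in>P0. \<phi> (Suc m) (c + a k * s x k + (r - s x k) * p) * w p)"
        using insert True by (subst insert.IH) (auto simp: P0_def w_def)
      finally show ?thesis using True by simp
    qed
  qed
  define g where "g t = (\<Sum>p\<in>P0. \<phi> (Suc m) (c + a k * t + (r - t) * p) * w p)" for t
  have contg: "continuous_on S g" for S
    unfolding g_def by (intro continuous_intros continuous_on_compose2[OF cont]) auto
  have fP0: "finite P0" using insert by (simp add: P0_def)
  have kP: "a k \<notin> P0" using insert by (auto simp: P0_def inj_on_def)
  have "(\<integral>u. h u \<partial>(\<Pi>\<^sub>M j\<in>insert k I \<times> UNIV. lborel))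
      = (\<integral>x. (\<integral>y. h (merge ?J ?K (x, y)) \<partial>(\<Pi>\<^sub>M j\<in>?K. lborel)) \<partial>(\<Pi>\<^sub>M j\<in>?J. lborel))"
    using int insert.hyps unfolding un[symmetric] by (intro P.product_integral_fold) auto
  also have "\<dots> = pi ^ card I * (\<integral>x. indicator {x. (\<Sum>j\<in>?J. (x j)\<^sup>2) \<le> r} x * g (\<Sum>j\<in>?J. (x j)\<^sup>2) \<partial>(\<Pi>\<^sub>M j\<in>?J. lborel))"
    unfolding IHk sum_squares_pairs by (simp add: s_def g_def mult.left_commute)
  also have "\<dots> = pi ^ card I * (pi * (\<integral>t. indicator {0..r} t * g t \<partial>lborel))"
    using contg insert.prems by (subst integral_disc_radial) (auto intro: borel_measurable_continuous_onI)
  also have "(\<integral>t. indicator {0..r} t * g t \<partial>lborel)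
     = (\<integral>t. (\<Sum>p\<in>P0. w p * (indicator {0..r} t * \<phi> (Suc m) (c + a k * t + (r - t) * p))) \<partial>lborel)"
    by (simp add: g_def sum_distrib_left mult_ac)
  also have "\<dots> = (\<Sum>p\<in>P0. w p * (\<integral>t. indicator {0..r} t * \<phi> (Suc m) (c + a k * t + (r - t) * p) \<partial>lborel))"
  proof (subst Bochner_Integration.integral_sum)
    fix p
    have "continuous_on {0..r} (\<lambda>t. \<phi> (Suc m) (c + a k * t + (r - t) * p))"
      by (intro continuous_intros continuous_on_compose2[OF cont]) auto
    then have "integrable lborel (\<lambda>t. indicator {0..r} t *\<^sub>R \<phi> (Suc m) (c + a k * t + (r - t) * p))"
      by (intro borel_integrable_compact) auto
    then show "integrable lborel (\<lambda>t. w p * (indicator {0..r} t * \<phi> (Suc m) (c + a k * t + (r - t) * p)))"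
      by simp
  qed simp
  also have "\<dots> = (\<Sum>p\<in>P0. w p * ((\<phi> m (c + r * a k) - \<phi> m (c + r * p)) / (a k - p)))"
  proof (intro sum.cong refl arg_cong2[where f="(*)"])
    fix p assume "p \<in> P0"
    with kP have "a k \<noteq> p" by auto
    then show "(\<integral>t. indicator {0..r} t * \<phi> (Suc m) (c + a k * t + (r - t) * p) \<partial>lborel)
        = (\<phi> m (c + r * a k) - \<phi> m (c + r * p)) / (a k - p)"
      using insert.prems by (intro integral_lborel_shift_FTC d cont) auto
  qed
  also have "\<dots> = (\<Sum>p\<in>P0. \<phi> m (c + r * p) * (w p / (p - a k))) + \<phi> m (c + r * a k) * (\<Sum>p\<in>P0. w p / (a k - p))"
  proof -
    have "w p * ((x - y) / (a k - p)) = y * (w p / (p - a k)) + x * (w p / (a k - p))" if "p \<in> P0" for p x y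
    proof -
      have "a k - p \<noteq> 0" "p - a k \<noteq> 0" using that kP by auto
      then show ?thesis by (simp add: divide_simps) (simp add: algebra_simps)
    qed
    then show ?thesis by (simp add: sum.distrib sum_distrib_left)
  qed
  also have "(\<Sum>p\<in>P0. w p / (a k - p)) = 1 / (\<Prod>q\<in>P0. a k - q)"
    using sum_partial_fractions[OF fP0 _ kP] by (simp add: w_def mult.commute P0_def)
  also have "(\<Sum>p\<in>P0. \<phi> m (c + r * p) * (w p / (p - a k)))
     = (\<Sum>p\<in>P0. \<phi> m (c + r * p) / (\<Prod>q\<in>insert (a k) P0 - {p}. p - q))"
  proof (intro sum.cong refl)
    fix p assume p: "p \<in> P0"
    then have "insert (a k) P0 - {p} = insert (a k) (P0 - {p})" using kP by auto
    then show "\<phi> m (c + r * p) * (w p / (p - a k)) = \<phi> m (c + r * p) / (\<Prod>q\<in>insert (a k) P0 - {p}. p - q)"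
      using kP fP0 by (simp add: w_def mult.commute)
  qed
  also have "\<dots> + \<phi> m (c + r * a k) * (1 / (\<Prod>q\<in>P0. a k - q))
     = (\<Sum>p\<in>insert (a k) P0. \<phi> m (c + r * p) / (\<Prod>q\<in>insert (a k) P0 - {p}. p - q))"
    using kP fP0 by simp
  finally show ?case
    using insert.hyps by (simp add: h_def P0_def insert_commute mult_ac)
qed

lemma lborel_vec_eq_distr_PiM:
  "(lborel :: (real^'m) measure) = distr (\<Pi>\<^sub>M j\<in>UNIV. lborel) borel (\<lambda>f. \<chi> i. f i)"
proof (rule lborel_eqI)
  interpret P: product_sigma_finite "\<lambda>_::'m. lborel :: real measure" ..
  have meas [measurable]: "(\<lambda>f. \<chi> i. f i) \<in> borel_measurable (\<Pi>\<^sub>M j\<in>(UNIV :: 'm set). (lborel :: real measure))"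
    by (rule borel_measurable_euclidean_space[THEN iffD2])
       (auto simp: Basis_vec_def inner_axis)
  fix l u :: "real^'m" assume le: "\<And>b. b \<in> Basis \<Longrightarrow> l \<bullet> b \<le> u \<bullet> b"
  then have le': "l $ i \<le> u $ i" for i
    using le[of "axis i 1"] by (simp add: inner_axis axis_in_Basis_iff)
  have "emeasure (distr (\<Pi>\<^sub>M j\<in>UNIV. lborel) borel (\<lambda>f. \<chi> i. f i)) (box l u)
     = emeasure (\<Pi>\<^sub>M j\<in>UNIV. lborel) (Pi\<^sub>E UNIV (\<lambda>i. {l $ i <..< u $ i}))"
    by (subst emeasure_distr) (auto intro!: arg_cong2[where f=emeasure] simp: mem_box_cart space_PiM PiE_def Pi_iff)
  also have "\<dots> = (\<Prod>i\<in>UNIV. ennreal (u $ i - l $ i))"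
    by (subst P.emeasure_PiM) (auto simp: le')
  also have "\<dots> = ennreal (\<Prod>i\<in>UNIV. (u - l) $ i)"
    using le' by (simp add: prod_ennreal)
  also have "(\<Prod>i\<in>UNIV. (u - l) $ i) = (\<Prod>b\<in>Basis. (u - l) \<bullet> b)"
  proof -
    have "(Basis :: (real^'m) set) = range (\<lambda>i. axis i 1)" by (auto simp: Basis_vec_def)
    moreover have inj: "inj (\<lambda>i::'m. axis i (1::real))" by (auto simp: inj_def axis_eq_axis)
    ultimately have "(\<Prod>b\<in>Basis. (u - l) \<bullet> b) = (\<Prod>i\<in>UNIV. (u - l) \<bullet> axis i 1)"
      using prod.reindex[OF inj, of "\<lambda>b. (u - l) \<bullet> b"] by simp
    then show ?thesis by (simp add: inner_axis)
  qed
  finally show "emeasure (distr (\<Pi>\<^sub>M j\<in>UNIV. lborel) borel (\<lambda>f. \<chi> i. f i)) (box l u)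
     = ennreal (\<Prod>b\<in>Basis. (u - l) \<bullet> b)" .
qed simp

text \<open>
  By the Vitali covering theorem an open set is, up to a null set, a countable disjoint union of balls, and
  a ball is mapped to a ball of the same radius. Invariance follows by applying this to the inverse as well.
\<close>

lemma emeasure_orthogonal_image_ge:
  fixes T :: "'a::euclidean_space \<Rightarrow> 'a"
  assumes T: "orthogonal_transformation T" and U: "open U"
  shows "emeasure lborel U \<le> emeasure lborel (T ` U)"
proof -
  define K where "K = {(x, r). 0 < r \<and> ball x r \<subseteq> U}"
  have "\<exists>i. i \<in> K \<and> x \<in> ball (fst i) (snd i) \<and> snd i < d" if x: "x \<in> U" "0 < d" for x d
  proof -
    obtain e where e: "e > 0" "ball x e \<subseteq> U" using U x by (meson openE)
    have "(x, min e (d / 2)) \<in> K" using e x by (auto simp: K_def)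
    then show ?thesis using e x by (intro exI[of _ "(x, min e (d/2))"]) auto
  qed
  from Vitali_covering_theorem_balls[of U K fst snd, OF this]
  obtain C where C: "countable C" "C \<subseteq> K"
     "pairwise (\<lambda>i j. disjnt (ball (fst i) (snd i)) (ball (fst j) (snd j))) C"
     "negligible (U - (\<Union>i \<in> C. ball (fst i) (snd i)))" by blast
  define B where "B i = ball (fst i) (snd i)" for i :: "'a \<times> real"
  have disj: "disjoint_family_on B C"
    using C(3) by (auto simp: B_def disjoint_family_on_def pairwise_def disjnt_def)
  have BU: "(\<Union>i\<in>C. B i) \<subseteq> U" using C(2) by (fastforce simp: K_def B_def subset_eq)
  have TB: "T ` B i = ball (T (fst i)) (snd i)" for i
    unfolding B_def using T by (rule image_orthogonal_transformation_ball)
  have injT: "inj T" using T by (rule orthogonal_transformation_inj)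
  have disjT: "disjoint_family_on (\<lambda>i. T ` B i) C"
    using disj injT unfolding disjoint_family_on_def by (metis image_Int image_empty)
  have openTU: "open (T ` U)"
    using U T by (metis bij_vimage_eq_inv_image continuous_open_vimage inv_inv_eq linear_continuous_on
        linear_conv_bounded_linear orthogonal_transformation_bij orthogonal_transformation_inv
        orthogonal_transformation_linear continuous_on_eq_continuous_at open_UNIV UNIV_I)
  have opB: "open (\<Union>i\<in>C. B i)" by (auto simp: B_def)
  have null: "U - (\<Union>i\<in>C. B i) \<in> null_sets lborel"
  proof -
    have "U - (\<Union>i\<in>C. B i) \<in> sets borel" using U opB by auto
    moreover have "U - (\<Union>i\<in>C. B i) \<in> null_sets lebesgue"
      using C(4) by (simp add: B_def negligible_iff_null_sets)
    ultimately show ?thesis by (simp add: null_sets_def)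
  qed
  have "emeasure lborel U = emeasure lborel ((\<Union>i\<in>C. B i) \<union> (U - (\<Union>i\<in>C. B i)))"
    using BU by (simp add: Un_absorb1)
  also have "\<dots> = emeasure lborel (\<Union>i\<in>C. B i)"
    using null opB by (intro emeasure_Un_null_set) auto
  also have "\<dots> = (\<integral>\<^sup>+i. emeasure lborel (B i) \<partial>count_space C)"
    by (intro emeasure_UN_countable disj C(1)) (auto simp: B_def)
  also have "\<dots> = (\<integral>\<^sup>+i. emeasure lborel (T ` B i) \<partial>count_space C)"
  proof (intro nn_integral_cong)
    fix i assume "i \<in> space (count_space C)"
    then have "snd i > 0" using C(2) by (auto simp: K_def)
    then show "emeasure lborel (B i) = emeasure lborel (T ` B i)"
      unfolding TB unfolding B_def by (simp add: emeasure_ball)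
  qed
  also have "\<dots> = emeasure lborel (\<Union>i\<in>C. T ` B i)"
    using disjT C(1) by (intro emeasure_UN_countable[symmetric]) (auto simp: TB)
  also have "\<dots> \<le> emeasure lborel (T ` U)"
    using BU openTU by (intro emeasure_mono) auto
  finally show ?thesis .
qed

lemma lborel_distr_orthogonal:
  fixes T :: "'a::euclidean_space \<Rightarrow> 'a"
  assumes T: "orthogonal_transformation T"
  shows "distr lborel borel T = lborel"
proof (rule lborel_eqI[symmetric])
  have invT: "orthogonal_transformation (inv T)" using T by (rule orthogonal_transformation_inv)
  have bij: "bij T" using T by (rule orthogonal_transformation_bij)
  have cT: "continuous_on UNIV T"
    using T by (intro linear_continuous_on)
      (simp add: orthogonal_transformation_linear linear_conv_bounded_linear[symmetric])
  have [measurable]: "T \<in> borel_measurable borel"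
    using cT by (intro borel_measurable_continuous_onI)
  fix l u :: "'a" assume le: "\<And>b. b \<in> Basis \<Longrightarrow> l \<bullet> b \<le> u \<bullet> b"
  have im: "T -` box l u = inv T ` box l u" using bij by (rule bij_vimage_eq_inv_image)
  have op: "open (T -` box l u)" using cT by (intro open_vimage) auto
  have img: "T ` (T -` box l u) = box l u" using bij by (simp add: bij_is_surj)
  have "emeasure (distr lborel borel T) (box l u) = emeasure lborel (T -` box l u)"
    by (subst emeasure_distr) auto
  also have "\<dots> = emeasure lborel (box l u)"
    using emeasure_orthogonal_image_ge[OF T op, unfolded img]
      emeasure_orthogonal_image_ge[OF invT open_box, of l u, folded im]
    by (rule antisym)
  also have "\<dots> = ennreal (\<Prod>b\<in>Basis. (u - l) \<bullet> b)"
    using le by (simp add: emeasure_lborel_box_eq)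
  finally show "emeasure (distr lborel borel T) (box l u) = ennreal (\<Prod>b\<in>Basis. (u - l) \<bullet> b)" .
qed simp

section \<open>Hermitian forms averaged over the complex ball\<close>

text \<open>
  A vector indexed by \<open>'n \<times> bool\<close> encodes a complex vector \<open>u\<close>; the two slices are its real and imaginary
  parts. The form \<open>qform u A\<close> is the Hermitian form \<open>u* A u\<close>.
\<close>

definition cslice :: "real^('n::finite \<times> bool) \<Rightarrow> bool \<Rightarrow> real^'n"
  where "cslice u b = (\<chi> i. u $ (i, b))"

definition qform :: "real^('n::finite \<times> bool) \<Rightarrow> 'n symmat \<Rightarrow> real"
  where "qform u A = (\<Sum>b\<in>UNIV. cslice u b \<bullet> (mat_of_symmat A *v cslice u b))"

lemma norm_sq_cslice: "(\<Sum>b\<in>UNIV. (norm (cslice u b))\<^sup>2) = (norm u)\<^sup>2"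
proof -
  have "(\<Sum>b\<in>UNIV. (norm (cslice u b))\<^sup>2) = (\<Sum>b\<in>UNIV. \<Sum>i\<in>UNIV. (u $ (i, b))\<^sup>2)"
    unfolding power2_norm_eq_inner inner_vec_def cslice_def by (simp add: power2_eq_square)
  also have "\<dots> = (\<Sum>i\<in>UNIV. \<Sum>b\<in>UNIV. (u $ (i, b))\<^sup>2)" by (rule sum.swap)
  also have "\<dots> = (\<Sum>j\<in>UNIV \<times> UNIV. (u $ j)\<^sup>2)" by (simp add: sum.cartesian_product)
  also have "\<dots> = (norm u)\<^sup>2"
    unfolding power2_norm_eq_inner inner_vec_def by (simp add: power2_eq_square)
  finally show ?thesis .
qed

lemma norm_matrix_vector_mult_le:
  fixes A :: "real^'n^'m"
  shows "norm (A *v x) \<le> norm A * norm x"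
proof -
  have "norm (A *v x) = L2_set (\<lambda>i. norm ((A *v x) $ i)) UNIV" by (simp add: norm_vec_def)
  also have "\<dots> \<le> L2_set (\<lambda>i. norm (A $ i) * norm x) UNIV"
    by (intro L2_set_mono) (auto simp: matrix_vector_mul_component Cauchy_Schwarz_ineq2)
  also have "\<dots> = norm A * norm x" by (simp add: norm_vec_def[of A] L2_set_right_distrib[symmetric] L2_set_left_distrib)
  finally show ?thesis .
qed

lemma abs_qform_le: "\<bar>qform u A\<bar> \<le> norm A * (norm u)\<^sup>2"
proof -
  have "\<bar>qform u A\<bar> \<le> (\<Sum>b\<in>UNIV. norm A * (norm (cslice u b))\<^sup>2)"
    unfolding qform_def
  proof (intro order_trans[OF sum_abs] sum_mono)
    fix b
    have "\<bar>cslice u b \<bullet> (mat_of_symmat A *v cslice u b)\<bar> \<le> norm (cslice u b) * norm (mat_of_symmat A *v cslice u b)"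
      by (rule Cauchy_Schwarz_ineq2)
    also have "\<dots> \<le> norm (cslice u b) * (norm (mat_of_symmat A) * norm (cslice u b))"
      by (intro mult_left_mono norm_matrix_vector_mult_le) auto
    finally show "\<bar>cslice u b \<bullet> (mat_of_symmat A *v cslice u b)\<bar> \<le> norm A * (norm (cslice u b))\<^sup>2"
      by (simp add: norm_symmat.rep_eq power2_eq_square mult_ac)
  qed
  also have "\<dots> = norm A * (norm u)\<^sup>2" by (simp add: norm_sq_cslice flip: sum_distrib_left)
  finally show ?thesis .
qed

lemma linear_qform: "linear (qform u)"
  by (rule linearI)
     (simp_all add: qform_def plus_symmat.rep_eq scaleR_symmat.rep_eq matrix_vector_mult_add_rdistrib
        inner_add_right sum.distrib sum_distrib_left scaleR_matrix_vector_assoc[symmetric])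

lemma continuous_on_qform: "continuous_on X (\<lambda>u. qform u A)"
proof -
  have "continuous_on X (\<lambda>u. cslice u b)" for b
    unfolding cslice_def by (intro continuous_intros)
  then show ?thesis
    unfolding qform_def
    by (intro continuous_intros continuous_on_compose2[OF matrix_vector_mult_linear_continuous_on[of UNIV]]) auto
qed

lemma qform_diag: "qform u (diag_symmat a) = (\<Sum>i\<in>UNIV. a $ i * ((u $ (i, True))\<^sup>2 + (u $ (i, False))\<^sup>2))"
proof -
  have "(\<Sum>j\<in>UNIV. (if i = j then a $ i else 0) * x j) = a $ i * x i" for i and x :: "'a \<Rightarrow> real"
  proof -
    have "(\<Sum>j\<in>UNIV. (if i = j then a $ i else 0) * x j) = (\<Sum>j\<in>UNIV. if i = j then a $ i * x j else 0)"
      by (intro sum.cong) auto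
    then show ?thesis by simp
  qed
  then have "qform u (diag_symmat a) = (\<Sum>b\<in>UNIV. \<Sum>i\<in>UNIV. a $ i * (u $ (i, b))\<^sup>2)"
    by (simp add: qform_def diag_symmat.rep_eq inner_vec_def matrix_vector_mult_def cslice_def
        power2_eq_square mult_ac)
  also have "\<dots> = (\<Sum>i\<in>UNIV. a $ i * (\<Sum>b\<in>UNIV. (u $ (i, b))\<^sup>2))"
    by (subst sum.swap) (simp add: sum_distrib_left)
  finally show ?thesis by (simp add: UNIV_bool add.commute)
qed

definition rotate_slices :: "real^'n^'n::finite \<Rightarrow> real^('n \<times> bool) \<Rightarrow> real^('n \<times> bool)"
  where "rotate_slices S u = (\<chi> ib. (S *v cslice u (snd ib)) $ fst ib)"

lemma cslice_rotate: "cslice (rotate_slices S u) b = S *v cslice u b"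
  by (simp add: cslice_def rotate_slices_def)

lemma orthogonal_transformation_rotate_slices:
  fixes S :: "real^'n^'n::finite"
  assumes "orthogonal_matrix S"
  shows "orthogonal_transformation (rotate_slices S)"
proof -
  have "linear (rotate_slices S)"
    by (rule linearI)
       (simp_all add: rotate_slices_def cslice_def vec_eq_iff matrix_vector_mult_def sum.distrib
          distrib_left sum_distrib_left mult_ac)
  moreover have "norm (rotate_slices S u) = norm u" for u
  proof -
    have "orthogonal_transformation ((*v) S)"
      using assms by (simp add: orthogonal_transformation_matrix)
    then have "norm (S *v x) = norm x" for x by (simp add: orthogonal_transformation)
    then have "(norm (rotate_slices S u))\<^sup>2 = (norm u)\<^sup>2"
      unfolding norm_sq_cslice[symmetric] cslice_rotate by simp
    then show ?thesis by simp
  qed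
  ultimately show ?thesis by (simp add: orthogonal_transformation)
qed

lemma qform_conj: "qform u (conj_symmat S A) = qform (rotate_slices (transpose S) u) A"
proof -
  have "x \<bullet> ((S ** B ** transpose S) *v x) = (transpose S *v x) \<bullet> (B *v (transpose S *v x))" for x B
    by (metis dot_lmul_matrix matrix_vector_mul_assoc vector_transpose_matrix transpose_transpose)
  then show ?thesis by (simp add: qform_def conj_symmat.rep_eq cslice_rotate)
qed

definition ball_measure :: "(real^'m::finite) measure"
  where "ball_measure = uniform_measure lborel (cball 0 1)"

lemma sets_ball_measure [measurable_cong, simp]: "sets ball_measure = sets borel"
  and space_ball_measure [simp]: "space ball_measure = UNIV"
  by (simp_all add: ball_measure_def)

lemma unit_ball_content_pos: "measure lborel (cball (0::'a::euclidean_space) 1) > 0"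
  using content_cball_pos[of 1 "0::'a"] by simp

lemma emeasure_unit_ball: "emeasure lborel (cball (0::'a::euclidean_space) 1)
    = ennreal (measure lborel (cball (0::'a) 1))"
  using emeasure_compact_finite[of "cball (0::'a) 1"] by (simp add: emeasure_eq_ennreal_measure)

lemma prob_space_ball_measure: "prob_space ball_measure"
  unfolding ball_measure_def
  by (rule prob_space_uniform_measure)
     (use unit_ball_content_pos in \<open>simp_all only: emeasure_unit_ball\<close>, auto)

lemma integral_ball_measure:
  fixes g :: "real^'m::finite \<Rightarrow> real"
  assumes [measurable]: "g \<in> borel_measurable borel"
  shows "(\<integral>u. g u \<partial>ball_measure) =
    (\<integral>u. indicator (cball 0 1) u * g u \<partial>lborel) / measure lborel (cball (0::real^'m) 1)"
proof -
  let ?v = "measure lborel (cball (0::real^'m) 1)"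
  have eq: "ball_measure = density lborel (\<lambda>u. ennreal (indicator (cball (0::real^'m) 1) u / ?v))"
    unfolding ball_measure_def uniform_measure_def emeasure_unit_ball
    by (intro arg_cong2[where f=density] refl ext)
       (use unit_ball_content_pos[where 'a="real^'m"] in \<open>auto simp: indicator_def divide_ennreal[symmetric]\<close>)
  have "(\<integral>u. g u \<partial>ball_measure) = (\<integral>u. (indicator (cball 0 1) u / ?v) * g u \<partial>lborel)"
    unfolding eq
    by (subst integral_density) (auto intro!: borel_measurable_divide borel_measurable_indicator)
  also have "\<dots> = (\<integral>u. indicator (cball 0 1) u * g u / ?v \<partial>lborel)" by simp
  finally show ?thesis by simp
qed

text \<open>
  Orthogonal invariance makes averages over the ball depend on the eigenvalues of a matrix only.
\<close>

lemma integral_ball_measure_orthogonal: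
  fixes g :: "real^'m::finite \<Rightarrow> real" and T :: "real^'m \<Rightarrow> real^'m"
  assumes g [measurable]: "g \<in> borel_measurable borel" and T: "orthogonal_transformation T"
  shows "(\<integral>u. g (T u) \<partial>ball_measure) = (\<integral>u. g u \<partial>ball_measure)"
proof -
  have [measurable]: "T \<in> borel_measurable borel"
    using T by (intro borel_measurable_continuous_onI linear_continuous_on)
      (simp add: orthogonal_transformation_linear linear_conv_bounded_linear[symmetric])
  have n: "norm (T u) = norm u" for u using T by (simp add: orthogonal_transformation)
  have "(\<integral>u. indicator (cball 0 1) u * g (T u) \<partial>lborel)
      = (\<integral>u. (\<lambda>u. indicator (cball 0 1) u * g u) (T u) \<partial>lborel)"
    by (simp add: indicator_def n)
  also have "\<dots> = (\<integral>u. indicator (cball 0 1) u * g u \<partial>distr lborel borel T)"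
    by (subst integral_distr) (auto intro!: borel_measurable_times borel_measurable_indicator)
  also have "\<dots> = (\<integral>u. indicator (cball 0 1) u * g u \<partial>lborel)"
    by (simp add: lborel_distr_orthogonal[OF T])
  finally show ?thesis by (simp add: integral_ball_measure)
qed

definition ball_const :: "'n::finite itself \<Rightarrow> real"
  where "ball_const _ = pi ^ CARD('n) / measure lborel (cball (0::real^('n \<times> bool)) 1)"

lemma ball_const_pos: "ball_const TYPE('n::finite) > 0"
  unfolding ball_const_def using unit_ball_content_pos by simp

text \<open>
  By orthogonal invariance the matrix may be taken diagonal, and the average is a divided difference with
  the nodes \<open>0, a $ 1, ..., a $ n\<close>. The factor \<open>t\<close> in \<open>\<phi> 0\<close> annihilates the node \<open>0\<close> and cancels the factor \<open>a $ i\<close> that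
  this node contributes to the other denominators.
\<close>

theorem ball_average_qform:
  fixes \<phi> :: "nat \<Rightarrow> real \<Rightarrow> real" and a :: "real^'n::finite"
  assumes d: "\<And>m t. (\<phi> m has_real_derivative \<phi> (Suc m) t) (at t)"
    and \<psi>: "\<And>t. \<phi> 0 t = t * \<psi> t"
    and S: "orthogonal_matrix S"
    and a: "inj (($) a)" "\<And>i. a $ i \<noteq> 0"
  shows "(\<integral>u. \<phi> CARD('n) (qform u (conj_symmat S (diag_symmat a))) \<partial>ball_measure)
     = ball_const TYPE('n) * (\<Sum>i\<in>UNIV. \<psi> (a $ i) / (\<Prod>m\<in>UNIV - {i}. a $ i - a $ m))"
proof -
  let ?\<phi> = "\<phi> CARD('n)"
  have cont: "continuous_on X (\<phi> m)" for m X
    using d DERIV_isCont continuous_at_imp_continuous_on by blast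
  have [measurable]: "?\<phi> \<in> borel_measurable borel"
    "(\<lambda>u. qform u (diag_symmat a)) \<in> borel_measurable borel"
    by (auto intro!: borel_measurable_continuous_onI cont continuous_on_qform)
  let ?s = "\<lambda>(u :: 'n \<times> bool \<Rightarrow> real) i. (u (i, True))\<^sup>2 + (u (i, False))\<^sup>2"
  have T: "orthogonal_transformation (rotate_slices (transpose S))"
    using S by (intro orthogonal_transformation_rotate_slices) simp
  have "(\<integral>u. ?\<phi> (qform u (conj_symmat S (diag_symmat a))) \<partial>ball_measure)
      = (\<integral>u. ?\<phi> (qform u (diag_symmat a)) \<partial>ball_measure)"
    unfolding qform_conj
    by (rule integral_ball_measure_orthogonal[OF _ T, where g="\<lambda>u. ?\<phi> (qform u (diag_symmat a))"]) measurable
  also have "\<dots> = (\<integral>u. indicator (cball 0 1) u * ?\<phi> (qform u (diag_symmat a)) \<partial>lborel)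
        / measure lborel (cball (0::real^('n \<times> bool)) 1)"
    by (rule integral_ball_measure) measurable
  also have "(\<integral>u. indicator (cball 0 1) u * ?\<phi> (qform u (diag_symmat a)) \<partial>lborel)
     = (\<integral>f. indicator (cball 0 1) (\<chi> i. f i) * ?\<phi> (qform (\<chi> i. f i) (diag_symmat a))
          \<partial>(\<Pi>\<^sub>M j\<in>UNIV. (lborel :: real measure)))"
  proof (subst lborel_vec_eq_distr_PiM, subst integral_distr)
    show "(\<lambda>f. \<chi> i. f i) \<in> (\<Pi>\<^sub>M j\<in>(UNIV :: ('n \<times> bool) set). (lborel :: real measure)) \<rightarrow>\<^sub>M borel"
      by (rule borel_measurable_euclidean_space[THEN iffD2]) (auto simp: Basis_vec_def inner_axis)
  qed (auto intro!: borel_measurable_times borel_measurable_indicator)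
  also have "\<dots> = (\<integral>u. indicator {u. (\<Sum>i\<in>UNIV. ?s u i) \<le> 1} u * \<phi> (0 + CARD('n)) (0 + (\<Sum>i\<in>UNIV. a $ i * ?s u i))
         \<partial>(\<Pi>\<^sub>M j\<in>UNIV \<times> UNIV. lborel))"
  proof -
    have "indicator (cball 0 1) (\<chi> i. f i) = (indicator {u. (\<Sum>i\<in>UNIV. ?s u i) \<le> 1} f :: real)"
      for f :: "'n \<times> bool \<Rightarrow> real"
    proof -
      have "(norm (\<chi> i. f i))\<^sup>2 = (\<Sum>i\<in>UNIV. ?s f i)"
        using sum_squares_pairs[of f UNIV] unfolding power2_norm_eq_inner inner_vec_def
        by (simp add: power2_eq_square)
      moreover have "norm (\<chi> i. f i) \<le> 1 \<longleftrightarrow> (norm (\<chi> i. f i))\<^sup>2 \<le> 1"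
        by (simp add: abs_square_le_1)
      ultimately show ?thesis by (simp add: indicator_def)
    qed
    then show ?thesis by (simp add: qform_diag)
  qed
  also have "\<dots> = pi ^ CARD('n) * (\<Sum>p\<in>insert 0 (range (($) a)). \<phi> 0 (0 + 1 * p) /
      (\<Prod>q\<in>insert 0 (range (($) a)) - {p}. p - q))"
    using a by (intro ball_average_divided_difference d) auto
  also have "(\<Sum>p\<in>insert 0 (range (($) a)). \<phi> 0 (0 + 1 * p) / (\<Prod>q\<in>insert 0 (range (($) a)) - {p}. p - q))
     = (\<Sum>p\<in>range (($) a). p * \<psi> p / (\<Prod>q\<in>insert 0 (range (($) a)) - {p}. p - q))"
  proof -
    have "0 \<notin> range (($) a)" using a by auto
    then show ?thesis by (simp add: \<psi>)
  qed
  also have "\<dots> = (\<Sum>i\<in>UNIV. a $ i * \<psi> (a $ i) / (\<Prod>q\<in>insert 0 (range (($) a)) - {a $ i}. a $ i - q))"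
    using a by (simp add: sum.reindex)
  also have "\<dots> = (\<Sum>i\<in>UNIV. \<psi> (a $ i) / (\<Prod>m\<in>UNIV - {i}. a $ i - a $ m))"
  proof (intro sum.cong refl)
    fix i
    have "insert 0 (range (($) a)) - {a $ i} = insert 0 (($) a ` (UNIV - {i}))"
      using a by (auto dest: injD)
    moreover have "0 \<notin> ($) a ` (UNIV - {i})" using a by auto
    moreover have "inj_on (($) a) (UNIV - {i})" using a(1) inj_on_subset by blast
    ultimately have "(\<Prod>q\<in>insert 0 (range (($) a)) - {a $ i}. a $ i - q) = a $ i * (\<Prod>m\<in>UNIV - {i}. a $ i - a $ m)"
      by (simp add: prod.reindex)
    then show "a $ i * \<psi> (a $ i) / (\<Prod>q\<in>insert 0 (range (($) a)) - {a $ i}. a $ i - q)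
       = \<psi> (a $ i) / (\<Prod>m\<in>UNIV - {i}. a $ i - a $ m)"
      using a(2)[of i] by simp
  qed
  finally show ?thesis by (simp add: ball_const_def)
qed

section \<open>Averages of functions of Hermitian forms\<close>

text \<open>
  The cut-off makes the bound \<open>\<bar>qball u A\<bar> \<le> norm A\<close> hold for every \<open>u\<close> and not just almost everywhere.
\<close>

definition qball :: "real^('n::finite \<times> bool) \<Rightarrow> 'n symmat \<Rightarrow> real"
  where "qball u A = (if norm u \<le> 1 then qform u A else 0)"

lemma linear_qball: "linear (qball u)"
  using linear_qform[of u] by (cases "norm u \<le> 1") (simp_all add: qball_def[abs_def] linear_zero)

lemma qball_add: "qball u (A + B) = qball u A + qball u B"
  and qball_scaleR: "qball u (r *\<^sub>R A) = r * qball u A"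
  using linear_add[OF linear_qball] linear_scale[OF linear_qball] by auto

lemma abs_qball_le: "\<bar>qball u A\<bar> \<le> norm A"
proof (cases "norm u \<le> 1")
  case True
  then have "(norm u)\<^sup>2 \<le> 1" by (simp add: abs_square_le_1)
  then have "norm A * (norm u)\<^sup>2 \<le> norm A * 1" by (intro mult_left_mono) auto
  then show ?thesis using abs_qform_le[of u A] True by (simp add: qball_def)
qed (simp add: qball_def)

lemma borel_measurable_qform [measurable]: "(\<lambda>u. qform u A) \<in> borel_measurable borel"
  by (intro borel_measurable_continuous_onI continuous_on_qform)

lemma borel_measurable_qball [measurable]: "(\<lambda>u. qball u A) \<in> borel_measurable borel"
  unfolding qball_def by measurable

text \<open>
  \<open>qvec \<omega> A\<close> collects the values of the form at \<open>n\<close> independent vectors. It is linear in \<open>A\<close>, which is what makes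
  derivatives of the averages below as easy to bound as those of \<open>G\<close>.
\<close>

definition qvec :: "('n::finite \<Rightarrow> real^('n \<times> bool)) \<Rightarrow> 'n symmat \<Rightarrow> real^'n"
  where "qvec \<omega> A = (\<chi> j. qball (\<omega> j) A)"

lemma linear_qvec: "linear (qvec \<omega>)"
  by (intro linearI) (simp_all add: qvec_def vec_eq_iff qball_add qball_scaleR)

lemma norm_qvec_le: "norm (qvec \<omega> (A :: 'n::finite symmat)) \<le> CARD('n) * norm A"
proof -
  have "norm (qvec \<omega> A) \<le> (\<Sum>j\<in>UNIV. \<bar>qvec \<omega> A $ j\<bar>)"
    by (rule norm_le_l1_cart)
  also have "\<dots> \<le> (\<Sum>j\<in>(UNIV :: 'n set). norm A)"
    by (intro sum_mono) (simp add: qvec_def abs_qball_le)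
  finally show ?thesis by simp
qed

definition qmeasure :: "('n::finite \<Rightarrow> real^('n \<times> bool)) measure"
  where "qmeasure = (\<Pi>\<^sub>M j\<in>UNIV. ball_measure)"

lemma prob_space_qmeasure: "prob_space qmeasure"
  unfolding qmeasure_def by (intro prob_space_PiM prob_space_ball_measure)

lemma measurable_component_qmeasure [measurable]: "(\<lambda>\<omega>. \<omega> j) \<in> qmeasure \<rightarrow>\<^sub>M borel"
  using measurable_component_singleton[of j UNIV "\<lambda>_. ball_measure"]
  unfolding qmeasure_def by (simp cong: measurable_cong_sets)

lemma measurable_qvec [measurable]: "(\<lambda>\<omega>. qvec \<omega> A) \<in> qmeasure \<rightarrow>\<^sub>M borel"
  unfolding qvec_def
  by (rule borel_measurable_euclidean_space[THEN iffD2]) (auto simp: Basis_vec_def inner_axis)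

text \<open>
  The weight \<open>\<theta>\<close> is there because differentiation of \<open>G (qvec \<omega> A)\<close> in \<open>A\<close> produces factors
  \<open>qball (\<omega> j) B\<close>: with weights, averages are closed under differentiation.
\<close>

definition qaverage :: "(('n::finite \<Rightarrow> real^('n \<times> bool)) \<Rightarrow> real) \<Rightarrow> (real^'n \<Rightarrow> real) \<Rightarrow> 'n symmat \<Rightarrow> real"
  where "qaverage \<theta> G A = (\<integral>\<omega>. \<theta> \<omega> * G (qvec \<omega> A) \<partial>qmeasure)"

lemma qaverage_integrand_bound:
  fixes G :: "real^'n::finite \<Rightarrow> real"
  assumes "\<And>\<omega>. \<bar>\<theta> \<omega>\<bar> \<le> T" "\<And>x. norm x \<le> CARD('n) * norm A \<Longrightarrow> \<bar>G x\<bar> \<le> \<beta>"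
  shows "\<bar>\<theta> \<omega> * G (qvec \<omega> A)\<bar> \<le> T * \<beta>"
proof -
  have "\<bar>\<theta> \<omega>\<bar> \<le> T" "\<bar>G (qvec \<omega> A)\<bar> \<le> \<beta>" using assms norm_qvec_le by blast+
  then have "\<bar>\<theta> \<omega>\<bar> * \<bar>G (qvec \<omega> A)\<bar> \<le> T * \<beta>" by (intro mult_mono) auto
  then show ?thesis by (simp add: abs_mult)
qed

lemma integrable_qaverage:
  fixes G :: "real^'n::finite \<Rightarrow> real"
  assumes \<theta>: "\<theta> \<in> borel_measurable qmeasure" "\<And>\<omega>. \<bar>\<theta> \<omega>\<bar> \<le> T" and G: "continuous_on UNIV G"
  shows "integrable qmeasure (\<lambda>\<omega>. \<theta> \<omega> * G (qvec \<omega> A))"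
proof -
  interpret prob_space "qmeasure :: ('n \<Rightarrow> _) measure" by (rule prob_space_qmeasure)
  have "bounded (G ` cball 0 (CARD('n) * norm A))"
    using G by (intro compact_imp_bounded compact_continuous_image continuous_on_subset[OF G]) auto
  then obtain \<beta> where "\<And>x. norm x \<le> CARD('n) * norm A \<Longrightarrow> \<bar>G x\<bar> \<le> \<beta>"
    unfolding bounded_iff by (metis image_eqI mem_cball_0 real_norm_def)
  with \<theta>(2) have bd: "\<bar>\<theta> \<omega> * G (qvec \<omega> A)\<bar> \<le> T * \<beta>" for \<omega> by (rule qaverage_integrand_bound)
  have [measurable]: "G \<in> borel_measurable borel" using G by (rule borel_measurable_continuous_onI)
  note \<theta>(1)[measurable]
  show ?thesis using bd by (intro integrable_const_bound[where B="T * \<beta>"]) auto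
qed

lemma abs_qaverage_le:
  fixes G :: "real^'n::finite \<Rightarrow> real"
  assumes \<theta>: "\<theta> \<in> borel_measurable qmeasure" "\<And>\<omega>. \<bar>\<theta> \<omega>\<bar> \<le> T" and G: "continuous_on UNIV G"
    and bd: "\<And>x. norm x \<le> CARD('n) * norm A \<Longrightarrow> \<bar>G x\<bar> \<le> \<beta>"
  shows "\<bar>qaverage \<theta> G A\<bar> \<le> T * \<beta>"
proof -
  interpret prob_space "qmeasure :: ('n \<Rightarrow> _) measure" by (rule prob_space_qmeasure)
  have "\<bar>qaverage \<theta> G A\<bar> \<le> (\<integral>\<omega>. \<bar>\<theta> \<omega> * G (qvec \<omega> A)\<bar> \<partial>qmeasure)"
    unfolding qaverage_def by (rule integral_abs_bound)
  also have "\<dots> \<le> (\<integral>\<omega>. T * \<beta> \<partial>(qmeasure :: ('n \<Rightarrow> _) measure))"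
    by (intro integral_mono integrable_abs integrable_qaverage[OF \<theta> G] integrable_const
        qaverage_integrand_bound \<theta> bd)
  also have "\<dots> = T * \<beta>" by (simp add: prob_space)
  finally show ?thesis .
qed

text \<open>
  The remainder in the definition of the derivative is uniform for \<open>x\<close> in a ball, by uniform continuity of
  the partial derivatives on a larger ball and the mean value theorem. This justifies differentiation
  under the integral sign.
\<close>

lemma smooth_uniformly_differentiable:
  fixes G :: "'b::euclidean_space \<Rightarrow> real"
  assumes G: "smooth G" and e: "e > 0"
  obtains d where "d > 0" "\<And>x h. norm x \<le> R \<Longrightarrow> norm h < d \<Longrightarrow>
      \<bar>G (x + h) - G x - (\<Sum>b\<in>Basis. (h \<bullet> b) * partial b G x)\<bar> \<le> e * norm h"
proof -
  let ?e = "e / DIM('b)"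
  have "\<exists>d>0. \<forall>x\<in>cball 0 (R + 1). \<forall>y\<in>cball 0 (R + 1). dist y x < d \<longrightarrow> dist (partial b G y) (partial b G x) < ?e"
    if "b \<in> Basis" for b
  proof -
    have "uniformly_continuous_on (cball 0 (R + 1)) (partial b G)"
      by (intro compact_uniformly_continuous smooth_continuous smooth_partial G that) auto
    then show ?thesis unfolding uniformly_continuous_on_def using e by (simp add: DIM_positive)
  qed
  then obtain \<delta> where \<delta>: "\<And>b. b \<in> Basis \<Longrightarrow> \<delta> b > 0"
    "\<And>b x y. b \<in> Basis \<Longrightarrow> x \<in> cball 0 (R + 1) \<Longrightarrow> y \<in> cball 0 (R + 1) \<Longrightarrow> dist y x < \<delta> b \<Longrightarrow>
        dist (partial b G y) (partial b G x) < ?e"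
    by metis
  define d where "d = min 1 (Min (\<delta> ` Basis))"
  have d: "d > 0" "d \<le> 1" "\<And>b. b \<in> Basis \<Longrightarrow> d \<le> \<delta> b"
    using \<delta>(1) by (auto simp: d_def min_le_iff_disj)
  show ?thesis
  proof (rule that[OF d(1)])
    fix x h :: 'b assume x: "norm x \<le> R" and h: "norm h < d"
    have p: "partial h G y = (\<Sum>b\<in>Basis. (h \<bullet> b) * partial b G y)" for y
      using has_derivative_partials[OF G] by (rule partial_eqI)
    obtain t where t: "0 < t" "t < 1" and
      eq: "G (x + 1 *\<^sub>R h) - G (x + 0 *\<^sub>R h) = (1 - 0) * partial h G (x + t *\<^sub>R h)"
      using MVT2[of 0 1 "\<lambda>t. G (x + t *\<^sub>R h)" "\<lambda>t. partial h G (x + t *\<^sub>R h)"]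
        partial_line_derivative[OF G] by auto
    have th: "norm (t *\<^sub>R h) \<le> norm h" using t by (simp add: mult_left_le_one_le)
    have "\<bar>G (x + h) - G x - (\<Sum>b\<in>Basis. (h \<bullet> b) * partial b G x)\<bar>
       = \<bar>\<Sum>b\<in>Basis. (h \<bullet> b) * (partial b G (x + t *\<^sub>R h) - partial b G x)\<bar>"
      using eq by (simp add: p right_diff_distrib sum_subtractf)
    also have "\<dots> \<le> (\<Sum>b\<in>(Basis :: 'b set). norm h * ?e)"
    proof (intro order_trans[OF sum_abs] sum_mono)
      fix b :: 'b assume b: "b \<in> Basis"
      have "norm (x + t *\<^sub>R h) \<le> R + 1"
        using norm_triangle_ineq[of x "t *\<^sub>R h"] x h th d(2) by linarith
      moreover have "dist (x + t *\<^sub>R h) x < \<delta> b" using th h d(3)[OF b] by (simp add: dist_norm)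
      ultimately have "dist (partial b G (x + t *\<^sub>R h)) (partial b G x) < ?e"
        using x by (intro \<delta>(2) b) auto
      then show "\<bar>(h \<bullet> b) * (partial b G (x + t *\<^sub>R h) - partial b G x)\<bar> \<le> norm h * ?e"
        unfolding abs_mult by (intro mult_mono) (auto simp: dist_real_def Basis_le_norm[OF b])
    qed
    also have "\<dots> = e * norm h" by simp
    finally show "\<bar>G (x + h) - G x - (\<Sum>b\<in>Basis. (h \<bullet> b) * partial b G x)\<bar> \<le> e * norm h" .
  qed
qed

lemma sum_Basis_vec: "(\<Sum>b\<in>(Basis :: (real^'n::finite) set). g b) = (\<Sum>j\<in>UNIV. g (axis j 1))"
proof -
  have "(Basis :: (real^'n) set) = range (\<lambda>j. axis j 1)" by (auto simp: Basis_vec_def)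
  moreover have "inj (\<lambda>j::'n. axis j (1::real))" by (auto simp: inj_def axis_eq_axis)
  ultimately show ?thesis using sum.reindex[of "\<lambda>j::'n. axis j (1::real)" UNIV g] by simp
qed

lemma axis_one_Basis [simp]: "axis j (1::real) \<in> Basis"
  by (simp add: axis_in_Basis_iff)

lemma has_derivative_qaverage:
  fixes G :: "real^'n::finite \<Rightarrow> real"
  assumes \<theta>: "\<theta> \<in> borel_measurable qmeasure" "\<And>\<omega>. \<bar>\<theta> \<omega>\<bar> \<le> T" and G: "smooth G"
  shows "(qaverage \<theta> G has_derivative
     (\<lambda>B. \<Sum>j\<in>UNIV. qaverage (\<lambda>\<omega>. \<theta> \<omega> * qball (\<omega> j) B) (partial (axis j 1) G) A)) (at A)"
proof -
  interpret prob_space "qmeasure :: ('n \<Rightarrow> _) measure" by (rule prob_space_qmeasure)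
  note \<theta>(1)[measurable]
  let ?D = "\<lambda>B. \<Sum>j\<in>UNIV. qaverage (\<lambda>\<omega>. \<theta> \<omega> * qball (\<omega> j) B) (partial (axis j 1) G) A"
  have T0: "T \<ge> 0" using \<theta>(2)[of undefined] by linarith
  have intj: "integrable qmeasure (\<lambda>\<omega>. \<theta> \<omega> * qball (\<omega> j) B * partial (axis j 1) G (qvec \<omega> A))" for j B
  proof (rule integrable_qaverage[where T="T * norm B"])
    show "\<bar>\<theta> \<omega> * qball (\<omega> j) B\<bar> \<le> T * norm B" for \<omega>
      unfolding abs_mult using \<theta>(2) T0 by (intro mult_mono abs_qball_le) auto
  qed (measurable, intro smooth_continuous smooth_partial G axis_one_Basis)
  have D: "?D B = (\<integral>\<omega>. \<theta> \<omega> * (\<Sum>j\<in>UNIV. qball (\<omega> j) B * partial (axis j 1) G (qvec \<omega> A)) \<partial>qmeasure)" for B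
    unfolding qaverage_def using intj
    by (subst Bochner_Integration.integral_sum[symmetric]) (auto simp: sum_distrib_left mult.assoc)
  have intD: "integrable qmeasure (\<lambda>\<omega>. \<theta> \<omega> * (\<Sum>j\<in>UNIV. qball (\<omega> j) B * partial (axis j 1) G (qvec \<omega> A)))" for B
    unfolding sum_distrib_left mult.assoc[symmetric] using intj by (intro Bochner_Integration.integrable_sum) auto
  have int: "integrable qmeasure (\<lambda>\<omega>. \<theta> \<omega> * G (qvec \<omega> B))" for B
    by (intro integrable_qaverage[OF \<theta>] smooth_continuous G)
  have lin: "linear ?D"
  proof (rule linearI)
    fix B1 B2 r B
    have "?D (B1 + B2) = (\<Sum>j\<in>UNIV. qaverage (\<lambda>\<omega>. \<theta> \<omega> * qball (\<omega> j) B1) (partial (axis j 1) G) A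
        + qaverage (\<lambda>\<omega>. \<theta> \<omega> * qball (\<omega> j) B2) (partial (axis j 1) G) A)"
      unfolding qaverage_def
      by (simp add: qball_add distrib_left distrib_right Bochner_Integration.integral_add[OF intj intj])
    then show "?D (B1 + B2) = ?D B1 + ?D B2" by (simp add: sum.distrib)
    have "(\<lambda>\<omega>. \<theta> \<omega> * qball (\<omega> j) (r *\<^sub>R B) * partial (axis j 1) G (qvec \<omega> A))
        = (\<lambda>\<omega>. r * (\<theta> \<omega> * qball (\<omega> j) B * partial (axis j 1) G (qvec \<omega> A)))" for j
      by (simp add: qball_scaleR fun_eq_iff)
    then show "?D (r *\<^sub>R B) = r *\<^sub>R ?D B"
      by (simp add: qaverage_def sum_distrib_left)
  qed
  show ?thesis
    unfolding has_derivative_at_alt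
  proof (intro conjI allI impI)
    show "bounded_linear ?D" using lin by (simp add: linear_conv_bounded_linear)
    fix e :: real assume e: "e > 0"
    \<comment> \<open>The factor \<open>CARD('n)\<close> is the Lipschitz constant of \<open>qvec \<omega>\<close>; \<open>T + 1\<close> instead of \<open>T\<close> keeps \<open>c\<close> positive.\<close>
    define c where "c = (T + 1) * CARD('n)"
    have c: "c > 0" using T0 by (simp add: c_def)
    from e c have "e / c > 0" by simp
    from smooth_uniformly_differentiable[OF G this, of "CARD('n) * norm A"]
    obtain d where d: "d > 0" and dd: "\<And>x h. norm x \<le> CARD('n) * norm A \<Longrightarrow> norm h < d \<Longrightarrow>
      \<bar>G (x + h) - G x - (\<Sum>b\<in>Basis. (h \<bullet> b) * partial b G x)\<bar> \<le> e / c * norm h" by blast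
    show "\<exists>d>0. \<forall>B. norm (B - A) < d \<longrightarrow>
        norm (qaverage \<theta> G B - qaverage \<theta> G A - ?D (B - A)) \<le> e * norm (B - A)"
    proof (intro exI[of _ "d / CARD('n)"] conjI allI impI)
      fix B assume B: "norm (B - A) < d / CARD('n)"
      have "qaverage \<theta> G B - qaverage \<theta> G A - ?D (B - A)
         = (\<integral>\<omega>. \<theta> \<omega> * G (qvec \<omega> B) - \<theta> \<omega> * G (qvec \<omega> A)
             - \<theta> \<omega> * (\<Sum>j\<in>UNIV. qball (\<omega> j) (B - A) * partial (axis j 1) G (qvec \<omega> A)) \<partial>qmeasure)"
        unfolding D using int intD by (simp add: qaverage_def)
      also have "\<bar>\<dots>\<bar> \<le> (\<integral>\<omega>. e * norm (B - A) \<partial>(qmeasure :: ('n \<Rightarrow> _) measure))"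
      proof (rule order_trans[OF integral_abs_bound], rule integral_mono)
        fix \<omega>
        let ?h = "qvec \<omega> (B - A)"
        have h: "qvec \<omega> B = qvec \<omega> A + ?h"
          using linear_diff[OF linear_qvec, of \<omega> B A] by simp
        have nh: "norm ?h \<le> CARD('n) * norm (B - A)" by (rule norm_qvec_le)
        also have "\<dots> < d" using B by (simp add: field_simps)
        finally have "\<bar>G (qvec \<omega> A + ?h) - G (qvec \<omega> A) - (\<Sum>b\<in>Basis. (?h \<bullet> b) * partial b G (qvec \<omega> A))\<bar> \<le> e / c * norm ?h"
          by (intro dd norm_qvec_le)
        also have "\<dots> \<le> e / c * (CARD('n) * norm (B - A))"
          using e c nh by (intro mult_left_mono) auto
        finally have le: "\<bar>G (qvec \<omega> B) - G (qvec \<omega> A)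
            - (\<Sum>j\<in>UNIV. qball (\<omega> j) (B - A) * partial (axis j 1) G (qvec \<omega> A))\<bar> \<le> e / c * (CARD('n) * norm (B - A))"
          unfolding h by (simp add: sum_Basis_vec inner_axis qvec_def)
        have "\<bar>\<theta> \<omega> * G (qvec \<omega> B) - \<theta> \<omega> * G (qvec \<omega> A)
             - \<theta> \<omega> * (\<Sum>j\<in>UNIV. qball (\<omega> j) (B - A) * partial (axis j 1) G (qvec \<omega> A))\<bar>
            = \<bar>\<theta> \<omega>\<bar> * \<bar>G (qvec \<omega> B) - G (qvec \<omega> A)
            - (\<Sum>j\<in>UNIV. qball (\<omega> j) (B - A) * partial (axis j 1) G (qvec \<omega> A))\<bar>"
          unfolding abs_mult[symmetric] by (simp add: right_diff_distrib)
        also have "\<dots> \<le> (T + 1) * (e / c * (CARD('n) * norm (B - A)))"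
          using le T0 \<theta>(2)[of \<omega>] by (intro mult_mono) auto
        also have "\<dots> = e * norm (B - A)"
          using c T0 by (simp add: c_def)
        finally show "\<bar>\<theta> \<omega> * G (qvec \<omega> B) - \<theta> \<omega> * G (qvec \<omega> A)
             - \<theta> \<omega> * (\<Sum>j\<in>UNIV. qball (\<omega> j) (B - A) * partial (axis j 1) G (qvec \<omega> A))\<bar> \<le> e * norm (B - A)" .
      qed (use int intD in \<open>auto intro!: integrable_abs Bochner_Integration.integrable_diff\<close>)
      also have "\<dots> = e * norm (B - A)" by (simp add: prob_space)
      finally show "norm (qaverage \<theta> G B - qaverage \<theta> G A - ?D (B - A)) \<le> e * norm (B - A)" by simp
    qed (use d in simp)
  qed
qed

lemma partial_qaverage:
  fixes G :: "real^'n::finite \<Rightarrow> real"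
  assumes \<theta>: "\<theta> \<in> borel_measurable qmeasure" "\<And>\<omega>. \<bar>\<theta> \<omega>\<bar> \<le> T" and G: "smooth G"
  shows "partial b (qaverage \<theta> G)
     = (\<lambda>A. \<Sum>j\<in>UNIV. qaverage (\<lambda>\<omega>. \<theta> \<omega> * qball (\<omega> j) b) (partial (axis j 1) G) A)"
  using partial_eqI[OF has_derivative_qaverage[OF assms]] by blast

lemma qaverage_weight:
  assumes \<theta>: "\<theta> \<in> borel_measurable qmeasure" "\<And>\<omega>. \<bar>\<theta> \<omega>\<bar> \<le> T" and b: "b \<in> Basis"
  shows "(\<lambda>\<omega>. \<theta> \<omega> * qball (\<omega> j) b) \<in> borel_measurable qmeasure" "\<bar>\<theta> \<omega> * qball (\<omega> j) b\<bar> \<le> T"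
proof -
  note \<theta>(1)[measurable]
  show "(\<lambda>\<omega>. \<theta> \<omega> * qball (\<omega> j) b) \<in> borel_measurable qmeasure" by measurable
  have "\<bar>qball (\<omega> j) b\<bar> \<le> 1" using abs_qball_le[of "\<omega> j" b] b by simp
  then have "\<bar>\<theta> \<omega>\<bar> * \<bar>qball (\<omega> j) b\<bar> \<le> T * 1" using \<theta>(2)[of \<omega>] by (intro mult_mono) auto
  then show "\<bar>\<theta> \<omega> * qball (\<omega> j) b\<bar> \<le> T" by (simp add: abs_mult)
qed

lemma smooth_qaverage:
  fixes G :: "real^'n::finite \<Rightarrow> real"
  assumes \<theta>: "\<theta> \<in> borel_measurable qmeasure" "\<And>\<omega>. \<bar>\<theta> \<omega>\<bar> \<le> T" and G: "smooth G"
  shows "smooth (qaverage \<theta> G)"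
proof -
  have diff: "qaverage \<theta> G differentiable (at A)"
    if "\<theta> \<in> borel_measurable qmeasure" "\<And>\<omega>. \<bar>\<theta> \<omega>\<bar> \<le> T" "smooth G"
    for \<theta> A and G :: "real^'n::finite \<Rightarrow> real"
    using has_derivative_qaverage[OF that] by (rule differentiableI)
  have "C_on k UNIV (qaverage \<theta> G)" for k
    using assms
  proof (induction k arbitrary: \<theta> G)
    case 0
    then show ?case using diff[OF 0]
      by (simp add: continuous_on_eq_continuous_at differentiable_imp_continuous_within)
  next
    case (Suc k)
    have "C_on k UNIV (partial b (qaverage \<theta> G))" if "b \<in> Basis" for b
      unfolding partial_qaverage[OF Suc.prems]
      by (intro C_on_sum Suc.IH qaverage_weight[OF Suc.prems(1,2) that] smooth_partial Suc.prems(3)) auto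
    then show ?case using diff[OF Suc.prems] by simp
  qed
  then show ?thesis by (simp add: smooth_on_def)
qed

text \<open>
  Differentiating an average in a unit direction gives a sum of \<open>n\<close> averages of first-order partial
  derivatives, with weights that do not grow. Hence \<open>l\<close> derivatives cost a factor \<open>n ^ l\<close> but never a derivative
  of \<open>G\<close> of order higher than \<open>l\<close>, and only values of \<open>G\<close> in a ball proportional to \<open>norm A\<close> enter.
\<close>

proposition abs_lpartial_qaverage_le:
  fixes G :: "real^'n::finite \<Rightarrow> real" and T \<beta> :: real
  assumes \<theta>: "\<theta> \<in> borel_measurable qmeasure" "\<And>\<omega>. \<bar>\<theta> \<omega>\<bar> \<le> T" and G: "smooth G"
    and bs: "set bs \<subseteq> Basis"
    and bd: "\<And>cs (x :: real^'n). set cs \<subseteq> Basis \<Longrightarrow> length cs = length bs \<Longrightarrow> norm x \<le> CARD('n) * norm A \<Longrightarrow>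
        \<bar>lpartial cs G x\<bar> \<le> \<beta>"
  shows "\<bar>lpartial bs (qaverage \<theta> G) A\<bar> \<le> T * real CARD('n) ^ length bs * \<beta>"
  using \<theta> G bs bd
proof (induction bs arbitrary: \<theta> G rule: rev_induct)
  case Nil
  show ?case
    using abs_qaverage_le[OF Nil(1,2) smooth_continuous[OF Nil(3)]] Nil(5)[of "[]"] by simp
next
  case (snoc b bs)
  have b: "b \<in> Basis" "set bs \<subseteq> Basis" using snoc.prems by auto
  note w = qaverage_weight[OF snoc.prems(1,2) b(1)]
  have sm: "smooth (partial (axis j 1) G)" for j by (intro smooth_partial snoc.prems) auto
  have each: "\<bar>lpartial bs (qaverage (\<lambda>\<omega>. \<theta> \<omega> * qball (\<omega> j) b) (partial (axis j 1) G)) A\<bar>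
      \<le> T * real CARD('n) ^ length bs * \<beta>" for j
  proof (rule snoc.IH[OF w sm b(2)])
    fix cs :: "(real^'n) list" and x :: "real^'n" assume "set cs \<subseteq> Basis" "length cs = length bs" "norm x \<le> CARD('n) * norm A"
    then show "\<bar>lpartial cs (partial (axis j 1) G) x\<bar> \<le> \<beta>"
      using snoc.prems(5)[of "cs @ [axis j 1]" x] by (simp add: lpartial_append)
  qed
  have "lpartial (bs @ [b]) (qaverage \<theta> G) A
     = (\<Sum>j\<in>UNIV. lpartial bs (qaverage (\<lambda>\<omega>. \<theta> \<omega> * qball (\<omega> j) b) (partial (axis j 1) G)) A)"
    unfolding lpartial_append lpartial_Cons lpartial_Nil partial_qaverage[OF snoc.prems(1-3)]
    by (subst lpartial_sum) (auto intro!: smooth_qaverage[OF w sm] b(2))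
  also have "\<bar>\<dots>\<bar> \<le> (\<Sum>j\<in>(UNIV :: 'n set). T * real CARD('n) ^ length bs * \<beta>)"
    by (intro order_trans[OF sum_abs] sum_mono each)
  finally show ?case by (simp add: mult_ac)
qed

section \<open>The integral representation of isotropic functions\<close>

definition vec_update :: "real^'n \<Rightarrow> 'n \<Rightarrow> real \<Rightarrow> real^'n::finite"
  where "vec_update x k t = (\<chi> j. if j = k then t else x $ j)"

text \<open>
  The operator \<open>h \<mapsto> (d / dx\<^sub>j) ^ n (x\<^sub>j h)\<close>: by \<open>ball_average_qform\<close>, averaging its result over the
  ball in the \<open>j\<close>-th variable returns the divided difference of \<open>h\<close> in that variable.
\<close>

definition euler_deriv :: "'n \<Rightarrow> (real^'n::finite \<Rightarrow> real) \<Rightarrow> real^'n \<Rightarrow> real"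
  where "euler_deriv j h = lpartial (replicate CARD('n) (axis j 1)) (\<lambda>x. x $ j * h x)"

lemma smooth_component_mult: "smooth h \<Longrightarrow> smooth (\<lambda>x. x $ j * h x)"
  using smooth_linear_mult[of h "axis j 1"] by (simp add: inner_axis)

lemma smooth_euler_deriv: "smooth h \<Longrightarrow> smooth (euler_deriv j h)"
  unfolding euler_deriv_def by (intro smooth_lpartial smooth_component_mult) auto

lemma integral_ball_measure_qball:
  fixes g :: "real \<Rightarrow> real"
  assumes "g \<in> borel_measurable borel"
  shows "(\<integral>u. g (qball u A) \<partial>ball_measure) = (\<integral>u. g (qform u A) \<partial>ball_measure)"
proof -
  note assms [measurable]
  have m: "(\<lambda>u. g (qball u A)) \<in> borel_measurable borel" "(\<lambda>u. g (qform u A)) \<in> borel_measurable borel"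
    by measurable
  have "indicator (cball 0 1) u * g (qball u A) = indicator (cball 0 1) u * g (qform u A)" for u
    by (simp add: indicator_def qball_def)
  then show ?thesis by (simp only: integral_ball_measure[OF m(1)] integral_ball_measure[OF m(2)])
qed

lemma ball_average_euler_deriv:
  fixes a z :: "real^'n::finite"
  assumes h: "smooth h" and S: "orthogonal_matrix S" and a: "inj (($) a)" "\<And>i. a $ i \<noteq> 0"
  shows "(\<integral>u. euler_deriv k h (vec_update z k (qball u (conj_symmat S (diag_symmat a)))) \<partial>ball_measure)
     = ball_const TYPE('n) * (\<Sum>i\<in>UNIV. h (vec_update z k (a $ i)) / (\<Prod>m\<in>UNIV - {i}. a $ i - a $ m))"
proof -
  define e where "e = (axis k 1 :: real^'n)"
  define \<phi> where "\<phi> m t = lpartial (replicate m e) (\<lambda>x. x $ k * h x) (vec_update z k 0 + t *\<^sub>R e)" for m t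
  have upd: "vec_update z k 0 + t *\<^sub>R e = vec_update z k t" for t
    by (simp add: vec_update_def e_def vec_eq_iff axis_def)
  have sm: "smooth (lpartial (replicate m e) (\<lambda>x. x $ k * h x))" for m
    by (intro smooth_lpartial smooth_component_mult h) (auto simp: e_def)
  have d: "(\<phi> m has_real_derivative \<phi> (Suc m) t) (at t)" for m t
    unfolding \<phi>_def using partial_line_derivative[OF sm] by simp
  have \<phi>0: "\<phi> 0 t = t * h (vec_update z k t)" for t
    unfolding \<phi>_def upd by (simp add: vec_update_def)
  have \<phi>n: "\<phi> CARD('n) t = euler_deriv k h (vec_update z k t)" for t
    unfolding \<phi>_def upd by (simp add: euler_deriv_def e_def)
  have "continuous_on UNIV (\<phi> CARD('n))"
    using d DERIV_isCont continuous_at_imp_continuous_on by blast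
  then have "\<phi> CARD('n) \<in> borel_measurable borel" by (rule borel_measurable_continuous_onI)
  from trans[OF integral_ball_measure_qball[OF this] ball_average_qform[OF d \<phi>0 S a]]
  show ?thesis by (simp only: \<phi>n)
qed

lemma product_prob_space_ball_measure: "product_prob_space (\<lambda>_. ball_measure)"
proof -
  interpret B: prob_space ball_measure by (rule prob_space_ball_measure)
  show ?thesis by standard
qed

lemma integrable_partial_qvec:
  fixes g :: "real^'n::finite \<Rightarrow> real" and A :: "'n symmat"
  assumes g: "continuous_on UNIV g"
  shows "integrable (\<Pi>\<^sub>M j\<in>J. ball_measure) (\<lambda>\<omega>. g (\<chi> j. if j \<in> J then qball (\<omega> j) A else z $ j))"
proof -
  interpret PP: prob_space "\<Pi>\<^sub>M j\<in>J. ball_measure :: (real^('n \<times> bool)) measure"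
    by (intro prob_space_PiM prob_space_ball_measure)
  let ?v = "\<lambda>\<omega>. \<chi> j. if j \<in> J then qball (\<omega> j) A else z $ j"
  let ?R = "\<Sum>j\<in>UNIV. norm A + \<bar>z $ j\<bar>"
  have nv: "norm (?v \<omega>) \<le> ?R" for \<omega>
  proof (rule order_trans[OF norm_le_l1_cart], rule sum_mono)
    fix j show "\<bar>?v \<omega> $ j\<bar> \<le> norm A + \<bar>z $ j\<bar>"
      using abs_qball_le[of "\<omega> j" A] by (simp add: add_increasing2)
  qed
  have "bounded (g ` cball 0 ?R)"
    by (intro compact_imp_bounded compact_continuous_image continuous_on_subset[OF g]) auto
  then obtain B where "\<And>x. x \<in> cball 0 ?R \<Longrightarrow> norm (g x) \<le> B"
    unfolding bounded_iff by blast
  then have bd: "norm (g (?v \<omega>)) \<le> B" for \<omega> using nv by (metis mem_cball_0)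
  have [measurable]: "g \<in> borel_measurable borel" using g by (rule borel_measurable_continuous_onI)
  have "(\<lambda>\<omega>. if j \<in> J then qball (\<omega> j) A else z $ j) \<in> borel_measurable (\<Pi>\<^sub>M j\<in>J. ball_measure)" for j
  proof (cases "j \<in> J")
    case True
    then have "(\<lambda>\<omega>. qball (\<omega> j) A) \<in> borel_measurable (\<Pi>\<^sub>M j\<in>J. ball_measure)"
      by (intro measurable_compose[OF measurable_component_singleton])
        (auto simp: borel_measurable_qball cong: measurable_cong_sets)
    with True show ?thesis by simp
  qed simp
  then have [measurable]: "?v \<in> borel_measurable (\<Pi>\<^sub>M j\<in>J. ball_measure)"
    by (intro borel_measurable_euclidean_space[THEN iffD2]) (auto simp: Basis_vec_def inner_axis)
  show ?thesis by (rule PP.integrable_const_bound[where B=B]) (use bd in auto)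
qed

lemma sum_PiE_insert:
  assumes "k \<notin> J"
  shows "(\<Sum>\<sigma>\<in>PiE (insert k J) (\<lambda>_. T). g \<sigma>) = (\<Sum>i\<in>T. \<Sum>\<sigma>\<in>PiE J (\<lambda>_. T). g (\<sigma>(k := i)))"
proof -
  have "(\<Sum>\<sigma>\<in>PiE (insert k J) (\<lambda>_. T). g \<sigma>) = (\<Sum>(i, \<sigma>)\<in>T \<times> PiE J (\<lambda>_. T). g (\<sigma>(k := i)))"
    unfolding PiE_insert_eq
    by (subst sum.reindex) (use inj_combinator[OF assms, of "\<lambda>_. T"] in \<open>auto simp: case_prod_unfold\<close>)
  then show ?thesis by (simp add: sum.cartesian_product)
qed

text \<open>
  Integrating out the independent vectors one by one replaces each variable of \<open>h\<close> by an eigenvalue. The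
  eigenvalue is chosen separately for each variable, so all maps \<open>\<sigma>\<close> occur and not just permutations.
\<close>

proposition iterated_ball_average:
  fixes a z :: "real^'n::finite"
  assumes h: "smooth h" and S: "orthogonal_matrix S" and a: "inj (($) a)" "\<And>i. a $ i \<noteq> 0"
    and js: "distinct js"
  defines "d \<equiv> \<lambda>i. 1 / (\<Prod>m\<in>UNIV - {i}. a $ i - a $ m)" and "A \<equiv> conj_symmat S (diag_symmat a)"
  shows "(\<integral>\<omega>. foldr euler_deriv js h (\<chi> j. if j \<in> set js then qball (\<omega> j) A else z $ j)
          \<partial>(\<Pi>\<^sub>M j\<in>set js. ball_measure))
    = ball_const TYPE('n) ^ length js *
      (\<Sum>\<sigma>\<in>PiE (set js) (\<lambda>_. UNIV). (\<Prod>j\<in>set js. d (\<sigma> j)) * h (\<chi> j. if j \<in> set js then a $ \<sigma> j else z $ j))"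
  using js
proof (induction js arbitrary: z)
  case Nil
  show ?case by (simp add: PiM_empty lebesgue_integral_count_space_finite)
next
  case (Cons k ks)
  interpret P: product_prob_space "\<lambda>_::'n. ball_measure :: (real^('n \<times> bool)) measure"
    by (rule product_prob_space_ball_measure)
  let ?c = "ball_const TYPE('n)" and ?J = "set ks"
  have k: "k \<notin> ?J" "distinct ks" using Cons.prems by auto
  let ?v = "\<lambda>z \<omega>. \<chi> j. if j \<in> ?J then qball (\<omega> j) A else z $ j"
  let ?g = "\<lambda>\<omega>. foldr euler_deriv (k # ks) h (\<chi> j. if j \<in> insert k ?J then qball (\<omega> j) A else z $ j)"
  have smk: "smooth (foldr euler_deriv ks h)" by (induction ks) (simp_all add: h smooth_euler_deriv)
  have smk': "smooth (foldr euler_deriv (k # ks) h)" using smk by (simp add: smooth_euler_deriv)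
  have upd: "(\<chi> j. if j \<in> insert k ?J then qball ((w(k := u)) j) A else z $ j) = vec_update (?v z w) k (qball u A)"
    for w u
    using k by (simp add: vec_update_def vec_eq_iff)
  have upd2: "vec_update (?v z \<omega>) k t = ?v (vec_update z k t) \<omega>" for \<omega> t
    using k by (auto simp: vec_update_def vec_eq_iff)
  have "(\<integral>\<omega>. ?g \<omega> \<partial>(\<Pi>\<^sub>M j\<in>insert k ?J. ball_measure))
      = (\<integral>w. (\<integral>u. ?g (w(k := u)) \<partial>ball_measure) \<partial>(\<Pi>\<^sub>M j\<in>?J. ball_measure))"
    using k by (intro P.product_integral_insert integrable_partial_qvec smooth_continuous smk') auto
  also have "\<dots> = (\<integral>\<omega>. ?c * (\<Sum>i\<in>UNIV. d i * foldr euler_deriv ks h (?v (vec_update z k (a $ i)) \<omega>)) \<partial>(\<Pi>\<^sub>M j\<in>?J. ball_measure))"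
    unfolding upd foldr_Cons o_apply
    unfolding A_def
    unfolding ball_average_euler_deriv[OF smk S a] unfolding A_def[symmetric] upd2
    by (simp add: d_def)
  also have "\<dots> = ?c * (\<Sum>i\<in>UNIV. d i * (\<integral>\<omega>. foldr euler_deriv ks h (?v (vec_update z k (a $ i)) \<omega>) \<partial>(\<Pi>\<^sub>M j\<in>?J. ball_measure)))"
    by (simp add: Bochner_Integration.integral_sum integrable_partial_qvec smooth_continuous smk)
  also have "\<dots> = ?c * (\<Sum>i\<in>UNIV. d i * (?c ^ length ks * (\<Sum>\<sigma>\<in>PiE ?J (\<lambda>_. UNIV). (\<Prod>j\<in>?J. d (\<sigma> j)) *
       h (\<chi> j. if j \<in> ?J then a $ \<sigma> j else vec_update z k (a $ i) $ j))))"
    by (simp only: Cons.IH[OF k(2)])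
  also have "\<dots> = ?c ^ length (k # ks) * (\<Sum>i\<in>UNIV. \<Sum>\<sigma>\<in>PiE ?J (\<lambda>_. UNIV). d i * (\<Prod>j\<in>?J. d (\<sigma> j)) *
       h (\<chi> j. if j \<in> ?J then a $ \<sigma> j else vec_update z k (a $ i) $ j))"
    by (simp add: sum_distrib_left mult_ac)
  also have "(\<Sum>i\<in>UNIV. \<Sum>\<sigma>\<in>PiE ?J (\<lambda>_. UNIV). d i * (\<Prod>j\<in>?J. d (\<sigma> j)) *
       h (\<chi> j. if j \<in> ?J then a $ \<sigma> j else vec_update z k (a $ i) $ j))
     = (\<Sum>i\<in>UNIV. \<Sum>\<sigma>\<in>PiE ?J (\<lambda>_. UNIV). (\<Prod>j\<in>insert k ?J. d ((\<sigma>(k := i)) j)) *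
       h (\<chi> j. if j \<in> insert k ?J then a $ (\<sigma>(k := i)) j else z $ j))"
  proof (intro sum.cong refl arg_cong2[where f="(*)"] arg_cong[where f=h])
    fix i \<sigma>
    have "(\<Prod>j\<in>?J. d ((\<sigma>(k := i)) j)) = (\<Prod>j\<in>?J. d (\<sigma> j))"
      using k by (intro prod.cong) auto
    then show "d i * (\<Prod>j\<in>?J. d (\<sigma> j)) = (\<Prod>j\<in>insert k ?J. d ((\<sigma>(k := i)) j))"
      using k by simp
    show "(\<chi> j. if j \<in> ?J then a $ \<sigma> j else vec_update z k (a $ i) $ j)
       = (\<chi> j. if j \<in> insert k ?J then a $ (\<sigma>(k := i)) j else z $ j)"
      using k by (auto simp: vec_eq_iff vec_update_def)
  qed
  also have "\<dots> = (\<Sum>\<sigma>\<in>PiE (insert k ?J) (\<lambda>_. UNIV). (\<Prod>j\<in>insert k ?J. d (\<sigma> j)) *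
       h (\<chi> j. if j \<in> insert k ?J then a $ \<sigma> j else z $ j))"
    using k by (simp add: sum_PiE_insert)
  finally show ?case by simp
qed

text \<open>
  Inserted as a factor of \<open>h\<close> in \<open>iterated_ball_average\<close>, it vanishes at \<open>a \<circ> \<sigma>\<close> and thus removes the terms of
  non-injective \<open>\<sigma>\<close>; for permutations it cancels exactly the product of the weights \<open>d (\<sigma> j)\<close>.
\<close>

definition discriminant :: "real^'n::finite \<Rightarrow> real"
  where "discriminant x = (\<Prod>i\<in>UNIV. \<Prod>m\<in>UNIV - {i}. x $ i - x $ m)"

lemma discriminant_permute:
  assumes "\<sigma> permutes UNIV" shows "discriminant (\<chi> j. x $ \<sigma> j) = discriminant x"
proof -
  have inj: "inj \<sigma>" and sur: "surj \<sigma>" using assms by (auto simp: permutes_inj permutes_surj)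
  have "(\<Prod>m\<in>UNIV - {i}. x $ \<sigma> i - x $ \<sigma> m) = (\<Prod>m\<in>UNIV - {\<sigma> i}. x $ \<sigma> i - x $ m)" for i
  proof (rule prod.reindex_cong[symmetric, where l=\<sigma>])
    show "UNIV - {\<sigma> i} = \<sigma> ` (UNIV - {i})" using inj sur by (auto simp: inj_eq)
  qed (use inj inj_on_subset in blast, auto)
  then have "discriminant (\<chi> j. x $ \<sigma> j) = (\<Prod>i\<in>UNIV. (\<lambda>i. \<Prod>m\<in>UNIV - {i}. x $ i - x $ m) (\<sigma> i))"
    by (simp add: discriminant_def)
  also have "\<dots> = discriminant x"
    using prod.permute[OF assms, of "\<lambda>i. \<Prod>m\<in>UNIV - {i}. x $ i - x $ m"]
    by (simp add: discriminant_def o_def)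
  finally show ?thesis .
qed

definition univ_list :: "'n::finite list"
  where "univ_list = (SOME xs. distinct xs \<and> set xs = UNIV)"

lemma univ_list: "distinct (univ_list :: 'n::finite list)" "set (univ_list :: 'n list) = UNIV"
proof -
  have "\<exists>xs :: 'n list. distinct xs \<and> set xs = UNIV"
    using finite_distinct_list[of "UNIV :: 'n set"] by auto
  from someI_ex[OF this] show "distinct (univ_list :: 'n list)" "set (univ_list :: 'n list) = UNIV"
    unfolding univ_list_def by auto
qed

text \<open>
  The function whose averages over the Hermitian forms reproduce \<open>F\<close> at the eigenvalues, up to \<open>repr_const\<close>.
\<close>

definition companion_density :: "(real^'n::finite \<Rightarrow> real) \<Rightarrow> real^'n \<Rightarrow> real"
  where "companion_density F = foldr euler_deriv univ_list (\<lambda>x. discriminant x * F x)"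

definition repr_const :: "'n::finite itself \<Rightarrow> real"
  where "repr_const _ = ball_const TYPE('n) ^ CARD('n) * card {\<sigma> :: 'n \<Rightarrow> 'n. \<sigma> permutes UNIV}"

lemma repr_const_pos: "repr_const TYPE('n::finite) > 0"
proof -
  have "id \<in> {\<sigma> :: 'n \<Rightarrow> 'n. \<sigma> permutes UNIV}" by (simp add: permutes_id)
  then have "card {\<sigma> :: 'n \<Rightarrow> 'n. \<sigma> permutes UNIV} > 0"
    unfolding card_gt_0_iff using finite_permutations[OF finite, of "UNIV :: 'n set"] by blast
  then show ?thesis unfolding repr_const_def using ball_const_pos[where 'n='n] by simp
qed

lemma smooth_discriminant_mult: "smooth F \<Longrightarrow> smooth (\<lambda>x. discriminant x * F x)"
proof -
  assume F: "smooth F"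
  have "smooth (\<lambda>x. (\<Prod>(i, m)\<in>P. x $ i - x $ m) * F x)" if "finite P" for P :: "('a \<times> 'a) set"
    using that
  proof (induction P)
    case (insert p P)
    have "smooth (\<lambda>x. (x \<bullet> (axis (fst p) 1 - axis (snd p) 1)) * ((\<Prod>(i, m)\<in>P. x $ i - x $ m) * F x))"
      by (intro smooth_linear_mult insert.IH)
    then show ?case using insert.hyps
      by (simp add: inner_diff_right inner_axis case_prod_unfold mult.assoc)
  qed (simp add: F)
  from this[of "Sigma UNIV (\<lambda>i. UNIV - {i})"] show ?thesis
    by (simp add: discriminant_def prod.Sigma)
qed

lemma smooth_companion_density: "smooth F \<Longrightarrow> smooth (companion_density F)"
proof -
  assume F: "smooth F"
  have "smooth (foldr euler_deriv js (\<lambda>x. discriminant x * F x))" for js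
    by (induction js) (simp_all add: smooth_discriminant_mult[OF F] smooth_euler_deriv)
  then show ?thesis by (simp add: companion_density_def)
qed

lemma qaverage_generic:
  fixes a :: "real^'n::finite"
  assumes F: "smooth F" "symmetric_fun F" and S: "orthogonal_matrix S"
    and a: "inj (($) a)" "\<And>i. a $ i \<noteq> 0"
  shows "qaverage (\<lambda>_. 1) (companion_density F) (conj_symmat S (diag_symmat a)) = repr_const TYPE('n) * F a"
proof -
  define d where "d i = 1 / (\<Prod>m\<in>UNIV - {i}. a $ i - a $ m)" for i
  define h where "h = (\<lambda>x. discriminant x * F x)"
  have len: "length (univ_list :: 'n list) = CARD('n)"
    using univ_list[where 'n='n] distinct_card by metis
  have disc: "(\<Prod>j\<in>UNIV. d j) * discriminant a = 1"
  proof -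
    have "discriminant a \<noteq> 0" using a(1) by (auto simp: discriminant_def inj_def)
    then show ?thesis by (simp add: d_def discriminant_def prod_dividef)
  qed
  have "qaverage (\<lambda>_. 1) (companion_density F) (conj_symmat S (diag_symmat a))
     = ball_const TYPE('n) ^ CARD('n) * (\<Sum>\<sigma>\<in>UNIV. (\<Prod>j\<in>UNIV. d (\<sigma> j)) * h (\<chi> j. a $ \<sigma> j))"
    using iterated_ball_average[OF smooth_discriminant_mult[OF F(1)] S a univ_list(1)]
    by (simp add: qaverage_def companion_density_def qmeasure_def univ_list qvec_def len PiE_UNIV_domain
        d_def h_def)
  also have "(\<Sum>\<sigma>\<in>UNIV. (\<Prod>j\<in>UNIV. d (\<sigma> j)) * h (\<chi> j. a $ \<sigma> j))
     = (\<Sum>\<sigma>\<in>{\<sigma> :: 'n \<Rightarrow> 'n. \<sigma> permutes UNIV}. F a)"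
  proof (rule sum.mono_neutral_cong_right)
    show "\<forall>\<sigma>\<in>UNIV - {\<sigma>. \<sigma> permutes UNIV}. (\<Prod>j\<in>UNIV. d (\<sigma> j)) * h (\<chi> j. a $ \<sigma> j) = 0"
    proof
      fix \<sigma> :: "'n \<Rightarrow> 'n" assume "\<sigma> \<in> UNIV - {\<sigma>. \<sigma> permutes UNIV}"
      then have "\<not> inj \<sigma>"
        using finite_UNIV_inj_surj[OF finite, of \<sigma>] bij_imp_permutes[of \<sigma> UNIV] by (auto simp: bij_def)
      then obtain i m where "i \<noteq> m" "\<sigma> i = \<sigma> m" by (auto simp: inj_def)
      then have "discriminant (\<chi> j. a $ \<sigma> j) = 0"
        by (auto simp: discriminant_def intro!: exI[of _ i] bexI[of _ m])
      then show "(\<Prod>j\<in>UNIV. d (\<sigma> j)) * h (\<chi> j. a $ \<sigma> j) = 0" by (simp add: h_def)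
    qed
    fix \<sigma> :: "'n \<Rightarrow> 'n" assume "\<sigma> \<in> {\<sigma>. \<sigma> permutes UNIV}"
    then have p: "\<sigma> permutes UNIV" by simp
    have "(\<Prod>j\<in>UNIV. d (\<sigma> j)) = (\<Prod>j\<in>UNIV. d j)" using prod.permute[OF p, of d] by (simp add: o_def)
    moreover have "F (\<chi> j. a $ \<sigma> j) = F a" using F(2) p by (simp add: symmetric_fun_def)
    ultimately show "(\<Prod>j\<in>UNIV. d (\<sigma> j)) * h (\<chi> j. a $ \<sigma> j) = F a"
      using disc by (simp add: h_def discriminant_permute[OF p] flip: mult.assoc)
  qed auto
  finally show ?thesis by (simp add: repr_const_def)
qed

text \<open>
  Stated through diagonalisations instead of characteristic polynomials, the relation between \<open>f\<close> and \<open>F\<close> is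
  visibly inherited by their products with powers of the norm, as the Frobenius norm is invariant under
  conjugation.
\<close>

definition spectral_companion :: "('n::finite symmat \<Rightarrow> real) \<Rightarrow> (real^'n \<Rightarrow> real) \<Rightarrow> bool"
  where "spectral_companion f F \<longleftrightarrow>
    symmetric_fun F \<and> (\<forall>S a. orthogonal_matrix S \<longrightarrow> f (conj_symmat S (diag_symmat a)) = F a)"

lemma symmetric_companion_imp_spectral: "symmetric_companion f F \<Longrightarrow> spectral_companion f F"
  unfolding symmetric_companion_def spectral_companion_def using eigenvalue_tuple_conj_diag by blast

text \<open>
  For distinct nonzero eigenvalues this is \<open>qaverage_generic\<close>. Every other eigenvalue vector is a limit of
  such vectors along a line on which the eigenvectors stay fixed; both sides are continuous on it.
\<close>

theorem isotropic_integral_representation: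
  fixes f :: "'n::finite symmat \<Rightarrow> real"
  assumes fF: "spectral_companion f F" and F: "smooth F"
  shows "f A = qaverage (\<lambda>_. 1) (companion_density F) A / repr_const TYPE('n)"
proof -
  have sym: "symmetric_fun F" using fF by (simp add: spectral_companion_def)
  obtain S a where S: "orthogonal_matrix S" and A: "A = conj_symmat S (diag_symmat a)"
    using symmat_diagonalise by blast
  have fa: "f A = F a"
    using fF S A by (simp add: spectral_companion_def)
  obtain e :: "'n \<Rightarrow> nat" where e: "inj e"
    using finite_imp_inj_to_nat_seg[of "UNIV :: 'n set"] by auto
  \<comment> \<open>The entries of \<open>v\<close> are distinct and nonzero, so \<open>a + t v\<close> is generic for small \<open>t > 0\<close>.\<close>
  define v where "v = (\<chi> i. real (Suc (e i)))"
  define A' where "A' t = conj_symmat S (diag_symmat (a + t *\<^sub>R v))" for t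
  let ?R = "qaverage (\<lambda>_. 1) (companion_density F)"
  have lin: "A' t = A + t *\<^sub>R conj_symmat S (diag_symmat v)" for t
  proof -
    have "mat_of_symmat (A' t) = mat_of_symmat (A + t *\<^sub>R conj_symmat S (diag_symmat v))"
      unfolding A'_def A plus_symmat.rep_eq scaleR_symmat.rep_eq conj_symmat.rep_eq diag_symmat.rep_eq
      by (simp add: vec_eq_iff matrix_matrix_mult_def sum_distrib_left sum_distrib_right
           algebra_simps if_distrib sum.distrib[symmetric])
         (auto intro!: sum.cong simp: algebra_simps)
    then show ?thesis by (simp add: mat_of_symmat_inject)
  qed
  have smR: "smooth ?R"
    by (intro smooth_qaverage[where T=1] smooth_companion_density F) auto
  have lim1: "((\<lambda>t. ?R (A' t)) \<longlongrightarrow> ?R (A' 0)) (at_right 0)"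
  proof -
    have "continuous_on UNIV (\<lambda>t. ?R (A + t *\<^sub>R conj_symmat S (diag_symmat v)))"
      by (intro continuous_on_compose2[OF smooth_continuous[OF smR, of UNIV]] continuous_intros) auto
    then have "isCont (\<lambda>t. ?R (A' t)) 0"
      unfolding lin by (simp add: continuous_on_eq_continuous_at)
    then show ?thesis unfolding isCont_def by (rule tendsto_mono[OF at_le[OF subset_UNIV]])
  qed
  have lim2: "((\<lambda>t. repr_const TYPE('n) * F (a + t *\<^sub>R v)) \<longlongrightarrow> repr_const TYPE('n) * F (a + 0 *\<^sub>R v)) (at_right 0)"
  proof -
    have "continuous_on UNIV (\<lambda>t. repr_const TYPE('n) * F (a + t *\<^sub>R v))"
      by (intro continuous_intros continuous_on_compose2[OF smooth_continuous[OF F, of UNIV]]) auto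
    then have "isCont (\<lambda>t. repr_const TYPE('n) * F (a + t *\<^sub>R v)) 0"
      by (simp add: continuous_on_eq_continuous_at)
    then show ?thesis unfolding isCont_def by (rule tendsto_mono[OF at_le[OF subset_UNIV]])
  qed
  have ev: "\<forall>\<^sub>F t in at_right 0. ?R (A' t) = repr_const TYPE('n) * F (a + t *\<^sub>R v)"
  proof -
    have nz: "\<forall>\<^sub>F t in at_right (0::real). x + t * y \<noteq> 0" if "y \<noteq> 0" for x y :: real
    proof -
      have "\<forall>\<^sub>F t in at_right (0::real). t \<noteq> - x / y" by (rule eventually_neq_at_within)
      then show ?thesis by (rule eventually_mono) (use that in \<open>auto simp: field_simps\<close>)
    qed
    have "\<forall>\<^sub>F t in at_right (0::real). \<forall>i. (a + t *\<^sub>R v) $ i \<noteq> 0"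
      by (intro eventually_all_finite) (simp add: v_def nz)
    moreover have "\<forall>\<^sub>F t in at_right (0::real). \<forall>i. \<forall>m. i \<noteq> m \<longrightarrow> (a + t *\<^sub>R v) $ i \<noteq> (a + t *\<^sub>R v) $ m"
    proof (intro eventually_all_finite)
      fix i m
      show "\<forall>\<^sub>F t in at_right (0::real). i \<noteq> m \<longrightarrow> (a + t *\<^sub>R v) $ i \<noteq> (a + t *\<^sub>R v) $ m"
      proof (cases "i = m")
        case False
        then have "v $ i - v $ m \<noteq> 0" using e by (simp add: v_def inj_eq)
        from nz[OF this, of "a $ i - a $ m"] show ?thesis
          by (rule eventually_mono) (auto simp: algebra_simps)
      qed simp
    qed
    ultimately show ?thesis
    proof eventually_elim
      case (elim t)
      then have "inj (($) (a + t *\<^sub>R v))" by (meson injI)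
      with elim(1) show ?case unfolding A'_def by (intro qaverage_generic F sym S) auto
    qed
  qed
  have "((\<lambda>t. ?R (A' t)) \<longlongrightarrow> repr_const TYPE('n) * F (a + 0 *\<^sub>R v)) (at_right 0)"
    by (rule tendsto_cong[THEN iffD2, OF ev lim2])
  then have "?R (A' 0) = repr_const TYPE('n) * F (a + 0 *\<^sub>R v)"
    by (rule tendsto_unique[OF trivial_limit_at_right_real lim1])
  then show ?thesis
    using repr_const_pos[where 'n='n] by (simp add: lin fa)
qed

section \<open>Derivative bounds and decay\<close>

text \<open>
  For such a sequence the factor \<open>l\<close> that the Leibniz rule produces is absorbed by raising the index of the
  weight of \<open>l - 1\<close> derivatives by one.
\<close>

definition factorial_growth :: "(nat \<Rightarrow> real) \<Rightarrow> bool"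
  where "factorial_growth M \<longleftrightarrow> 1 \<le> M 0 \<and> (\<forall>k. real (Suc k) * M k \<le> M (Suc k))"

lemma factorial_growth_ge_1:
  assumes "factorial_growth M" shows "1 \<le> M k"
proof (induction k)
  case (Suc k)
  have "1 * M k \<le> real (Suc k) * M k" using Suc by (intro mult_right_mono) auto
  with Suc assms show ?case unfolding factorial_growth_def by (metis mult_1 order_trans)
qed (use assms in \<open>simp add: factorial_growth_def\<close>)

lemma factorial_growth_mono:
  assumes "factorial_growth M" shows "mono M"
proof (rule monoI[OF lift_Suc_mono_le])
  fix k
  have "1 * M k \<le> real (Suc k) * M k" using factorial_growth_ge_1[OF assms, of k]
    by (intro mult_right_mono) auto
  then show "M k \<le> M (Suc k)" using assms unfolding factorial_growth_def by (metis mult_1 order_trans)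
qed

lemma factorial_growth_shift:
  assumes "factorial_growth M" shows "factorial_growth (\<lambda>k. M (k + c))"
  unfolding factorial_growth_def
proof (intro conjI allI)
  fix k
  have "real (Suc k) * M (k + c) \<le> real (Suc (k + c)) * M (k + c)"
    using factorial_growth_ge_1[OF assms, of "k + c"] by (intro mult_right_mono) auto
  also have "\<dots> \<le> M (Suc (k + c))" using assms unfolding factorial_growth_def by blast
  finally show "real (Suc k) * M (k + c) \<le> M (Suc k + c)" by simp
qed (use factorial_growth_ge_1[OF assms] in simp)

lemma factorial_growth_pred:
  assumes "factorial_growth M" shows "real k * M (k - 1) \<le> M k"
  using assms factorial_growth_ge_1[OF assms, of 0] by (cases k) (auto simp: factorial_growth_def)

lemma mono_shift_mult: "mono N \<Longrightarrow> 0 \<le> c \<Longrightarrow> mono (\<lambda>k. c * N (k + m))"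
  for N :: "nat \<Rightarrow> real"
  by (intro monoI mult_left_mono) (auto dest: monoD[of N "_ + m" "_ + m"])

text \<open>
  With separate weights for the decay and for the order, this covers local bounds (\<open>X\<close> a ball of radius \<open>R\<close>,
  \<open>N k\<close> a multiple of \<open>(max 1 R) ^ k\<close>) and Gelfand-Shilov bounds (\<open>X = UNIV\<close>, \<open>N\<close> proportional to \<open>M\<close>) alike.
\<close>

definition deriv_bound :: "'a::euclidean_space set \<Rightarrow> (nat \<Rightarrow> real) \<Rightarrow> (nat \<Rightarrow> real) \<Rightarrow> ('a \<Rightarrow> real) \<Rightarrow> bool"
  where "deriv_bound X N M G \<longleftrightarrow> (\<forall>x\<in>X. \<forall>k bs. set bs \<subseteq> Basis \<longrightarrow>
     norm x ^ k * \<bar>lpartial bs G x\<bar> \<le> N k * M (length bs))"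

lemma deriv_boundD:
  "deriv_bound X N M G \<Longrightarrow> x \<in> X \<Longrightarrow> set bs \<subseteq> Basis \<Longrightarrow> norm x ^ k * \<bar>lpartial bs G x\<bar> \<le> N k * M (length bs)"
  unfolding deriv_bound_def by blast

lemma set_delete_nth_subset: "set (take p bs @ drop (Suc p) bs) \<subseteq> set bs"
  by (auto dest: in_set_takeD in_set_dropD)

text \<open>
  A linear factor costs one power of \<open>norm x\<close>, hence one index of \<open>N\<close>; the derivatives that fall on it
  cost nothing, by \<open>factorial_growth\<close>. The bound \<open>2\<close> on \<open>v\<close> accommodates differences of two coordinates.
\<close>

lemma deriv_bound_linear_mult:
  assumes b: "deriv_bound X N M G" and G: "smooth G" and N: "mono N" "N 0 \<ge> 0"
    and M: "factorial_growth M" and v: "norm v \<le> 2"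
  shows "deriv_bound X (\<lambda>k. 4 * N (Suc k)) M (\<lambda>x. (x \<bullet> v) * G x)"
  unfolding deriv_bound_def
proof (intro ballI allI impI)
  fix x k bs assume x: "x \<in> X" and bs: "set bs \<subseteq> (Basis :: 'a set)"
  let ?l = "length bs"
  let ?d = "\<lambda>p. take p bs @ drop (Suc p) bs"
  have N0: "0 \<le> N j" for j using N by (meson monoD le0 order_trans)
  have v': "\<bar>y \<bullet> v\<bar> \<le> 2 * norm y" for y
    using Cauchy_Schwarz_ineq2[of y v] mult_left_mono[OF v norm_ge_zero[of y]] by (simp add: mult.commute)
  have "norm x ^ k * \<bar>lpartial bs (\<lambda>x. (x \<bullet> v) * G x) x\<bar>
     \<le> norm x ^ k * (\<bar>x \<bullet> v\<bar> * \<bar>lpartial bs G x\<bar> + (\<Sum>p<?l. \<bar>bs ! p \<bullet> v\<bar> * \<bar>lpartial (?d p) G x\<bar>))"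
    unfolding lpartial_linear_mult[OF G bs]
    by (intro mult_left_mono order_trans[OF abs_triangle_ineq] add_mono order_trans[OF sum_abs])
       (auto simp: abs_mult)
  also have "\<dots> = norm x ^ k * (\<bar>x \<bullet> v\<bar> * \<bar>lpartial bs G x\<bar>)
     + (\<Sum>p<?l. \<bar>bs ! p \<bullet> v\<bar> * (norm x ^ k * \<bar>lpartial (?d p) G x\<bar>))"
    by (simp add: distrib_left sum_distrib_left mult_ac)
  also have "\<dots> \<le> 2 * (N (Suc k) * M ?l) + (\<Sum>p<?l. 2 * (N k * M (?l - 1)))"
  proof (intro add_mono sum_mono)
    have "norm x ^ k * (\<bar>x \<bullet> v\<bar> * \<bar>lpartial bs G x\<bar>) \<le> norm x ^ k * ((2 * norm x) * \<bar>lpartial bs G x\<bar>)"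
      by (intro mult_left_mono mult_right_mono v') auto
    also have "\<dots> = 2 * (norm x ^ Suc k * \<bar>lpartial bs G x\<bar>)" by simp
    also have "\<dots> \<le> 2 * (N (Suc k) * M ?l)" using deriv_boundD[OF b x bs, of "Suc k"] by simp
    finally show "norm x ^ k * (\<bar>x \<bullet> v\<bar> * \<bar>lpartial bs G x\<bar>) \<le> 2 * (N (Suc k) * M ?l)" .
    fix p assume p: "p \<in> {..<?l}"
    then have "bs ! p \<in> Basis" using bs by (auto dest: nth_mem)
    then have "\<bar>bs ! p \<bullet> v\<bar> \<le> 2" using v'[of "bs ! p"] by simp
    moreover have "norm x ^ k * \<bar>lpartial (?d p) G x\<bar> \<le> N k * M (?l - 1)"
      using deriv_boundD[OF b x, of "?d p" k] set_delete_nth_subset[of p bs] bs p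
      by (auto simp: min_def)
    ultimately show "\<bar>bs ! p \<bullet> v\<bar> * (norm x ^ k * \<bar>lpartial (?d p) G x\<bar>) \<le> 2 * (N k * M (?l - 1))"
      by (rule mult_mono) auto
  qed
  also have "\<dots> = 2 * (N (Suc k) * M ?l) + 2 * (N k * (real ?l * M (?l - 1)))" by simp
  also have "\<dots> \<le> 2 * (N (Suc k) * M ?l) + 2 * (N (Suc k) * M ?l)"
    using N0 factorial_growth_pred[OF M, of ?l] monoD[OF N(1), of k "Suc k"]
      factorial_growth_ge_1[OF M, of "?l - 1"]
    by (intro add_mono mult_left_mono mult_mono) auto
  finally show "norm x ^ k * \<bar>lpartial bs (\<lambda>x. (x \<bullet> v) * G x) x\<bar> \<le> 4 * N (Suc k) * M ?l" by (simp add: mult_ac)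
qed

lemma deriv_bound_lpartial:
  assumes "deriv_bound X N M G" "set cs \<subseteq> Basis"
  shows "deriv_bound X N (\<lambda>l. M (l + length cs)) (lpartial cs G)"
  unfolding deriv_bound_def lpartial_append[symmetric]
  using assms unfolding deriv_bound_def by (metis length_append set_append Un_subset_iff)

lemma deriv_bound_sum:
  fixes G :: "'i \<Rightarrow> 'a::euclidean_space \<Rightarrow> real"
  assumes "finite I" "\<And>i. i \<in> I \<Longrightarrow> deriv_bound X N M (G i)" "\<And>i. i \<in> I \<Longrightarrow> smooth (G i)"
  shows "deriv_bound X (\<lambda>k. real (card I) * N k) M (\<lambda>x. \<Sum>i\<in>I. G i x)"
  unfolding deriv_bound_def
proof (intro ballI allI impI)
  fix x k bs assume x: "x \<in> X" and bs: "set bs \<subseteq> (Basis :: 'a set)"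
  have "norm x ^ k * \<bar>lpartial bs (\<lambda>x. \<Sum>i\<in>I. G i x) x\<bar> \<le> (\<Sum>i\<in>I. norm x ^ k * \<bar>lpartial bs (G i) x\<bar>)"
    using lpartial_sum[of I G bs] assms(3) bs
    by (simp add: sum_distrib_left[symmetric] mult_left_mono)
  also have "\<dots> \<le> (\<Sum>i\<in>I. N k * M (length bs))"
    by (intro sum_mono deriv_boundD[OF assms(2) x bs])
  finally show "norm x ^ k * \<bar>lpartial bs (\<lambda>x. \<Sum>i\<in>I. G i x) x\<bar> \<le> real (card I) * N k * M (length bs)"
    by simp
qed

lemma deriv_bound_euler_deriv:
  fixes G :: "real^'n::finite \<Rightarrow> real"
  assumes "deriv_bound X N M G" "smooth G" "mono N" "N 0 \<ge> 0" "factorial_growth M"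
  shows "deriv_bound X (\<lambda>k. 4 * N (Suc k)) (\<lambda>l. M (l + CARD('n))) (euler_deriv j G)"
proof -
  have "deriv_bound X (\<lambda>k. 4 * N (Suc k)) M (\<lambda>x. (x \<bullet> axis j 1) * G x)"
    by (rule deriv_bound_linear_mult[OF assms]) simp
  from deriv_bound_lpartial[OF this, of "replicate CARD('n) (axis j 1)"]
  show ?thesis by (simp add: euler_deriv_def inner_axis)
qed

lemma deriv_bound_discriminant_mult:
  fixes G :: "real^'n::finite \<Rightarrow> real"
  assumes b: "deriv_bound X N M G" and G: "smooth G" and N: "mono N" "N 0 \<ge> 0" and M: "factorial_growth M"
  defines "m \<equiv> CARD('n) * (CARD('n) - 1)"
  shows "deriv_bound X (\<lambda>k. 4 ^ m * N (k + m)) M (\<lambda>x. discriminant x * G x)"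
proof -
  have "smooth (\<lambda>x. (\<Prod>(i, j)\<in>P. x $ i - x $ j) * G x) \<and>
     deriv_bound X (\<lambda>k. 4 ^ card P * N (k + card P)) M (\<lambda>x. (\<Prod>(i, j)\<in>P. x $ i - x $ j) * G x)"
    if "finite P" for P :: "('n \<times> 'n) set"
    using that
  proof (induction P)
    case (insert p P)
    let ?v = "axis (fst p) 1 - axis (snd p) 1 :: real^'n"
    let ?G = "\<lambda>x. (\<Prod>(i, j)\<in>P. x $ i - x $ j) * G x"
    have "norm ?v \<le> 2" using norm_triangle_ineq4[of "axis (fst p) (1::real)" "axis (snd p) 1"] by simp
    moreover have "mono (\<lambda>k. 4 ^ card P * N (k + card P))"
      by (intro mono_shift_mult N) auto
    moreover have "0 \<le> 4 ^ card P * N (0 + card P)" using N monoD[OF N(1), of 0 "card P"] by simp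
    ultimately have "deriv_bound X (\<lambda>k. 4 * (4 ^ card P * N (Suc k + card P))) M (\<lambda>x. (x \<bullet> ?v) * ?G x)"
      using insert.IH M by (intro deriv_bound_linear_mult) auto
    moreover have "smooth (\<lambda>x. (x \<bullet> ?v) * ?G x)" using insert.IH by (intro smooth_linear_mult) auto
    ultimately show ?case using insert.hyps
      by (simp add: inner_diff_right inner_axis case_prod_unfold mult.assoc)
  qed (use b G in simp)
  from this[of "Sigma UNIV (\<lambda>i. UNIV - {i})"] show ?thesis
    by (simp add: discriminant_def prod.Sigma m_def card_Diff_singleton)
qed

text \<open>
  The \<open>n (n - 1)\<close> factors of the discriminant and the \<open>n\<close> coordinate factors in the operators \<open>euler_deriv\<close> add up to
  \<open>s = n * n\<close> linear multiplications, and the operators differentiate \<open>n * n\<close> times in all.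
\<close>

lemma deriv_bound_companion_density:
  fixes F :: "real^'n::finite \<Rightarrow> real"
  assumes b: "deriv_bound X N M F" and F: "smooth F" and N: "mono N" "N 0 \<ge> 0" and M: "factorial_growth M"
  defines "s \<equiv> CARD('n) * CARD('n)"
  shows "deriv_bound X (\<lambda>k. 4 ^ s * N (k + s)) (\<lambda>l. M (l + s)) (companion_density F)"
proof -
  let ?m = "CARD('n) * (CARD('n) - 1)" and ?h = "\<lambda>x. discriminant x * F x"
  have smh: "smooth ?h" by (rule smooth_discriminant_mult[OF F])
  have iter: "smooth (foldr euler_deriv js ?h) \<and>
    deriv_bound X (\<lambda>k. 4 ^ (?m + length js) * N (k + (?m + length js)))
      (\<lambda>l. M (l + length js * CARD('n))) (foldr euler_deriv js ?h)" for js
  proof (induction js)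
    case Nil
    then show ?case using deriv_bound_discriminant_mult[OF b F N M] smh by simp
  next
    case (Cons j js)
    let ?q = "?m + length js"
    have "mono (\<lambda>k. 4 ^ ?q * N (k + ?q))"
      by (intro mono_shift_mult N) auto
    moreover have "0 \<le> 4 ^ ?q * N (0 + ?q)" using N monoD[OF N(1), of 0 ?q] by simp
    ultimately have "deriv_bound X (\<lambda>k. 4 * (4 ^ ?q * N (Suc k + ?q))) (\<lambda>l. M (l + CARD('n) + length js * CARD('n)))
        (euler_deriv j (foldr euler_deriv js ?h))"
      using Cons factorial_growth_shift[OF M] by (intro deriv_bound_euler_deriv) auto
    moreover have "smooth (euler_deriv j (foldr euler_deriv js ?h))" using Cons by (intro smooth_euler_deriv) auto
    ultimately show ?case by (simp add: add.assoc mult.assoc)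
  qed
  have len: "length (univ_list :: 'n list) = CARD('n)"
    using univ_list[where 'n='n] distinct_card by metis
  have ms: "?m + CARD('n) = s" by (cases "CARD('n)") (auto simp: s_def)
  from iter[of univ_list] show ?thesis
    unfolding companion_density_def len ms s_def[symmetric] by blast
qed

text \<open>
  Differentiating the averages in the integral representation loses only a geometric factor; the shift by \<open>s\<close>
  is the number of derivatives of \<open>F\<close> that \<open>companion_density F\<close> contains.
\<close>

proposition lpartial_bound_transfer:
  fixes f :: "'n::finite symmat \<Rightarrow> real"
  assumes fF: "spectral_companion f F" and F: "smooth F"
    and b: "deriv_bound (cball 0 R) N M F" and N: "mono N" "N 0 \<ge> 0" and M: "factorial_growth M"
    and A: "CARD('n) * norm A \<le> R" and bs: "set bs \<subseteq> Basis"
  defines "s \<equiv> CARD('n) * CARD('n)"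
  shows "\<bar>lpartial bs f A\<bar> \<le> (4 ^ s / repr_const TYPE('n)) * N s * real CARD('n) ^ length bs * M (length bs + s)"
proof -
  let ?H = "companion_density F" and ?\<kappa> = "repr_const TYPE('n)"
  have smH: "smooth ?H" by (rule smooth_companion_density[OF F])
  have "f = (\<lambda>A. (1 / ?\<kappa>) * qaverage (\<lambda>_. 1) ?H A)"
    using isotropic_integral_representation[OF fF F] by (simp add: fun_eq_iff)
  moreover have "smooth (qaverage (\<lambda>_. 1) ?H)" by (intro smooth_qaverage[where T=1] smH) auto
  ultimately have "lpartial bs f A = (1 / ?\<kappa>) * lpartial bs (qaverage (\<lambda>_. 1) ?H) A"
    using lpartial_cmult[OF _ bs] by metis
  moreover have "\<bar>lpartial bs (qaverage (\<lambda>_. 1) ?H) A\<bar> \<le> 1 * real CARD('n) ^ length bs * (4 ^ s * N s * M (length bs + s))"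
  proof (rule abs_lpartial_qaverage_le[OF _ _ smH bs])
    fix cs :: "(real^'n) list" and x :: "real^'n" assume cs: "set cs \<subseteq> Basis" "length cs = length bs" "norm x \<le> CARD('n) * norm A"
    then have "x \<in> cball 0 R" using A by simp
    from deriv_boundD[OF deriv_bound_companion_density[OF b F N M] this cs(1), of 0]
    show "\<bar>lpartial cs ?H x\<bar> \<le> 4 ^ s * N s * M (length bs + s)" using cs by (simp add: s_def)
  qed auto
  ultimately show ?thesis
    using repr_const_pos[where 'n='n] by (simp add: abs_mult field_simps)
qed

lemma smooth_transfer:
  assumes "spectral_companion f F" "smooth F" shows "smooth f"
proof -
  have eq: "f = (\<lambda>A. (1 / repr_const TYPE('a)) * qaverage (\<lambda>_. 1) (companion_density F) A)"
    using isotropic_integral_representation[OF assms] by (simp add: fun_eq_iff)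
  have "smooth (qaverage (\<lambda>_. 1) (companion_density F))"
    by (intro smooth_qaverage[where T=1] smooth_companion_density assms(2)) auto
  then show ?thesis by (subst eq) (rule smooth_cmult)
qed

lemma norm_sq_mult_eq: "(norm x)\<^sup>2 * g x = (\<Sum>b\<in>Basis. (x \<bullet> b) * ((x \<bullet> b) * g x))"
  unfolding power2_norm_eq_inner by (subst euclidean_inner) (simp add: sum_distrib_right mult.assoc)

lemma smooth_norm_sq_mult: "smooth g \<Longrightarrow> smooth (\<lambda>x. (norm x)\<^sup>2 * g x)"
  unfolding norm_sq_mult_eq by (intro smooth_sum smooth_linear_mult)

lemma smooth_norm_pow_mult: "smooth g \<Longrightarrow> smooth (\<lambda>x. norm x ^ (2 * k) * g x)"
proof (induction k)
  case (Suc k)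
  from smooth_norm_sq_mult[OF Suc.IH[OF Suc.prems]]
  show ?case by (simp add: power2_eq_square mult_ac)
qed simp

lemma deriv_bound_norm_sq_mult:
  fixes G :: "'a::euclidean_space \<Rightarrow> real"
  assumes b: "deriv_bound X N M G" and G: "smooth G" and N: "mono N" "N 0 \<ge> 0" and M: "factorial_growth M"
  shows "deriv_bound X (\<lambda>k. 16 * real DIM('a) * N (k + 2)) M (\<lambda>x. (norm x)\<^sup>2 * G x)"
proof -
  have "deriv_bound X (\<lambda>k. 4 * (4 * N (Suc (Suc k)))) M (\<lambda>x. (x \<bullet> b) * ((x \<bullet> b) * G x))"
    if "b \<in> Basis" for b
  proof (rule deriv_bound_linear_mult[OF deriv_bound_linear_mult[OF b G N M]])
    show "mono (\<lambda>k. 4 * N (Suc k))" using N(1) by (auto simp: mono_def)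
    show "0 \<le> 4 * N (Suc 0)" using N monoD[OF N(1), of 0 1] by simp
  qed (use that M smooth_linear_mult[OF G] in auto)
  from deriv_bound_sum[OF finite_Basis this]
  show ?thesis unfolding norm_sq_mult_eq
    using smooth_linear_mult[OF smooth_linear_mult[OF G]] by (simp add: mult_ac numeral_2_eq_2)
qed

lemma deriv_bound_norm_pow_mult:
  fixes G :: "'a::euclidean_space \<Rightarrow> real"
  assumes b: "deriv_bound X N M G" and G: "smooth G" and N: "mono N" "N 0 \<ge> 0" and M: "factorial_growth M"
  shows "deriv_bound X (\<lambda>j. (16 * real DIM('a)) ^ k * N (j + 2 * k)) M (\<lambda>x. norm x ^ (2 * k) * G x)"
proof (induction k)
  case (Suc k)
  have "mono (\<lambda>j. (16 * real DIM('a)) ^ k * N (j + 2 * k))"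
    by (intro mono_shift_mult N) auto
  moreover have "0 \<le> (16 * real DIM('a)) ^ k * N (0 + 2 * k)" using N monoD[OF N(1), of 0 "2 * k"] by simp
  ultimately have "deriv_bound X (\<lambda>j. 16 * real DIM('a) * ((16 * real DIM('a)) ^ k * N (j + 2 + 2 * k))) M
     (\<lambda>x. (norm x)\<^sup>2 * (norm x ^ (2 * k) * G x))"
    by (intro deriv_bound_norm_sq_mult Suc.IH smooth_norm_pow_mult G M)
  then show ?case by (simp add: power2_eq_square mult_ac add_ac)
qed (use b in simp)

text \<open>
  The bounds for \<open>f\<close> obtained from the representation carry no decay: \<open>qvec \<omega> A\<close> can be small for large
  \<open>A\<close>. But \<open>(norm A) ^ (2 * k) * f A\<close> is isotropic too and so has bounded derivatives. This lemma is the step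
  that moves a factor \<open>(norm x)\<^sup>2\<close> from inside the derivative to the outside.
\<close>

lemma norm_sq_lpartial_le:
  fixes g :: "'a::euclidean_space \<Rightarrow> real"
  assumes g: "smooth g" and bs: "set bs \<subseteq> Basis"
    and \<beta>1: "\<And>cs. set cs \<subseteq> Basis \<Longrightarrow> length cs = length bs - 1 \<Longrightarrow> \<bar>lpartial cs g x\<bar> \<le> \<beta>1"
    and \<beta>2: "\<And>cs. set cs \<subseteq> Basis \<Longrightarrow> length cs = length bs - 2 \<Longrightarrow> \<bar>lpartial cs g x\<bar> \<le> \<beta>2"
  defines "l \<equiv> length bs"
  shows "(norm x)\<^sup>2 * \<bar>lpartial bs g x\<bar> \<le> \<bar>lpartial bs (\<lambda>x. (norm x)\<^sup>2 * g x) x\<bar>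
     + real DIM('a) * (2 * norm x * (real l * \<beta>1) + real l * (real (l - 1) * \<beta>2))"
proof -
  define del where "del p cs = take p cs @ drop (Suc p) cs" for p and cs :: "'a list"
  have del: "set (del p cs) \<subseteq> Basis" if "set cs \<subseteq> Basis" for p cs
    using that set_delete_nth_subset[of p cs] by (auto simp: del_def)
  have ldel: "length (del p cs) = length cs - 1" if "p < length cs" for p cs
    using that by (auto simp: del_def min_def)
  have L: "lpartial cs (\<lambda>x. (x \<bullet> b) * h x) x = (x \<bullet> b) * lpartial cs h x
      + (\<Sum>p<length cs. (cs ! p \<bullet> b) * lpartial (del p cs) h x)"
    if "smooth h" "set cs \<subseteq> Basis" for cs b h
    using lpartial_linear_mult[OF that] by (simp add: del_def)
  have \<beta>: "0 \<le> \<beta>2"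
  proof -
    obtain b0 :: 'a where "b0 \<in> Basis" using nonempty_Basis by blast
    then show ?thesis using \<beta>2[of "replicate (length bs - 2) b0"] by fastforce
  qed
  define E where "E b = lpartial bs (\<lambda>x. (x \<bullet> b) * ((x \<bullet> b) * g x)) x - (x \<bullet> b)\<^sup>2 * lpartial bs g x" for b
  have xb: "\<bar>x \<bullet> b\<bar> \<le> norm x" if "b \<in> Basis" for b using that by (rule Basis_le_norm)
  have bb: "\<bar>cs ! p \<bullet> b\<bar> \<le> 1" if "b \<in> Basis" "set cs \<subseteq> Basis" "p < length cs" for b cs p
  proof -
    have "cs ! p \<in> Basis" using that nth_mem by blast
    then show ?thesis using that(1) by (simp add: inner_Basis)
  qed
  have E: "\<bar>E b\<bar> \<le> 2 * norm x * (real l * \<beta>1) + real l * (real (l - 1) * \<beta>2)" if b: "b \<in> Basis" for b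
  proof -
    have 1: "lpartial bs (\<lambda>x. (x \<bullet> b) * ((x \<bullet> b) * g x)) x = (x \<bullet> b) * ((x \<bullet> b) * lpartial bs g x
        + (\<Sum>p<l. (bs ! p \<bullet> b) * lpartial (del p bs) g x))
        + (\<Sum>p<l. (bs ! p \<bullet> b) * ((x \<bullet> b) * lpartial (del p bs) g x
           + (\<Sum>q<length (del p bs). (del p bs ! q \<bullet> b) * lpartial (del q (del p bs)) g x)))"
      by (simp add: L g bs del smooth_linear_mult l_def)
    have "E b = (x \<bullet> b) * (\<Sum>p<l. (bs ! p \<bullet> b) * lpartial (del p bs) g x)
        + (\<Sum>p<l. (bs ! p \<bullet> b) * ((x \<bullet> b) * lpartial (del p bs) g x
           + (\<Sum>q<length (del p bs). (del p bs ! q \<bullet> b) * lpartial (del q (del p bs)) g x)))"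
      unfolding E_def 1 by (simp add: algebra_simps power2_eq_square)
    also have "\<bar>\<dots>\<bar> \<le> norm x * (\<Sum>p<l. 1 * \<beta>1) + (\<Sum>p<l. 1 * (norm x * \<beta>1 + (\<Sum>q<l - 1. 1 * \<beta>2)))"
    proof (rule order_trans[OF abs_triangle_ineq add_mono])
      have d1: "\<bar>lpartial (del p bs) g x\<bar> \<le> \<beta>1" if "p < l" for p
        using that by (intro \<beta>1 del bs) (simp add: ldel l_def)
      have t: "\<bar>(bs ! p \<bullet> b) * y\<bar> \<le> 1 * z" if "\<bar>y\<bar> \<le> z" "p < l" for p y z
        unfolding abs_mult using that bb[OF b bs] by (intro mult_mono) (auto simp: l_def)
      have "\<bar>\<Sum>p<l. (bs ! p \<bullet> b) * lpartial (del p bs) g x\<bar> \<le> (\<Sum>p<l. 1 * \<beta>1)"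
        by (rule order_trans[OF sum_abs], rule sum_mono, rule t) (auto intro: d1)
      then show "\<bar>(x \<bullet> b) * (\<Sum>p<l. (bs ! p \<bullet> b) * lpartial (del p bs) g x)\<bar> \<le> norm x * (\<Sum>p<l. 1 * \<beta>1)"
        unfolding abs_mult using xb[OF b] by (intro mult_mono) auto
      show "\<bar>\<Sum>p<l. (bs ! p \<bullet> b) * ((x \<bullet> b) * lpartial (del p bs) g x
           + (\<Sum>q<length (del p bs). (del p bs ! q \<bullet> b) * lpartial (del q (del p bs)) g x))\<bar>
         \<le> (\<Sum>p<l. 1 * (norm x * \<beta>1 + (\<Sum>q<l - 1. 1 * \<beta>2)))"
      proof (rule order_trans[OF sum_abs], rule sum_mono, rule t)
        fix p assume "p \<in> {..<l}"
        then have p: "p < l" by simp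
        have lp: "length (del p bs) = l - 1" using ldel[of p bs] p by (simp add: l_def)
        show "\<bar>(x \<bullet> b) * lpartial (del p bs) g x
           + (\<Sum>q<length (del p bs). (del p bs ! q \<bullet> b) * lpartial (del q (del p bs)) g x)\<bar>
           \<le> norm x * \<beta>1 + (\<Sum>q<l - 1. 1 * \<beta>2)"
        proof (rule order_trans[OF abs_triangle_ineq add_mono])
          show "\<bar>(x \<bullet> b) * lpartial (del p bs) g x\<bar> \<le> norm x * \<beta>1"
            unfolding abs_mult using xb[OF b] d1[OF p] by (intro mult_mono) auto
          show "\<bar>\<Sum>q<length (del p bs). (del p bs ! q \<bullet> b) * lpartial (del q (del p bs)) g x\<bar> \<le> (\<Sum>q<l - 1. 1 * \<beta>2)"
            unfolding lp
          proof (rule order_trans[OF sum_abs], rule sum_mono)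
            fix q assume "q \<in> {..<l - 1}"
            then have q: "q < length (del p bs)" by (simp add: lp)
            have "\<bar>lpartial (del q (del p bs)) g x\<bar> \<le> \<beta>2"
              using ldel[OF q] by (intro \<beta>2 del bs) (simp add: lp l_def)
            then show "\<bar>(del p bs ! q \<bullet> b) * lpartial (del q (del p bs)) g x\<bar> \<le> 1 * \<beta>2"
              unfolding abs_mult using bb[OF b del[OF bs] q] by (intro mult_mono) auto
          qed
        qed
      qed simp
    qed
    also have "\<dots> = 2 * norm x * (real l * \<beta>1) + real l * (real (l - 1) * \<beta>2)"
    proof -
      define r where "r = real (l - 1)"
      have "norm x * (\<Sum>p<l. 1 * \<beta>1) + (\<Sum>p<l. 1 * (norm x * \<beta>1 + (\<Sum>q<l - 1. 1 * \<beta>2)))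
         = norm x * (real l * \<beta>1) + real l * (norm x * \<beta>1 + r * \<beta>2)"
        by (simp only: sum_constant card_lessThan mult_1 r_def)
      then show ?thesis unfolding r_def[symmetric] by (simp add: algebra_simps)
    qed
    finally show ?thesis .
  qed
  have "lpartial bs (\<lambda>x. (norm x)\<^sup>2 * g x) x = (\<Sum>b\<in>Basis. lpartial bs (\<lambda>x. (x \<bullet> b) * ((x \<bullet> b) * g x)) x)"
    unfolding norm_sq_mult_eq by (subst lpartial_sum) (auto intro!: smooth_linear_mult g bs)
  also have "\<dots> = (\<Sum>b\<in>Basis. E b) + (norm x)\<^sup>2 * lpartial bs g x"
    unfolding E_def power2_norm_eq_inner euclidean_inner[of x x]
    by (simp add: sum_subtractf sum_distrib_right power2_eq_square)
  finally have "(norm x)\<^sup>2 * lpartial bs g x = lpartial bs (\<lambda>x. (norm x)\<^sup>2 * g x) x - (\<Sum>b\<in>Basis. E b)" by simp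
  then have "(norm x)\<^sup>2 * \<bar>lpartial bs g x\<bar> = \<bar>lpartial bs (\<lambda>x. (norm x)\<^sup>2 * g x) x - (\<Sum>b\<in>Basis. E b)\<bar>"
    by (metis abs_mult abs_power2)
  also have "\<dots> \<le> \<bar>lpartial bs (\<lambda>x. (norm x)\<^sup>2 * g x) x\<bar> + (\<Sum>b\<in>Basis. \<bar>E b\<bar>)"
    by (rule order_trans[OF abs_triangle_ineq4]) simp
  also have "(\<Sum>b\<in>Basis. \<bar>E b\<bar>) \<le> real DIM('a) * (2 * norm x * (real l * \<beta>1) + real l * (real (l - 1) * \<beta>2))"
    using sum_bounded_above[of Basis "\<lambda>b. \<bar>E b\<bar>", OF E] by simp
  finally show ?thesis by simp
qed

text \<open>
  Each step trades two outer powers of the norm for two inner ones, up to terms with fewer derivatives, so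
  the induction is on the order of differentiation and then on the outer exponent \<open>m\<close>. For \<open>m = 1\<close> the
  estimate \<open>norm x \<le> 1 + (norm x)\<^sup>2\<close> reduces to \<open>m = 2\<close>; this is where the index of \<open>N\<close> is raised by one. The
  constant \<open>D\<close> is chosen such that \<open>1 + E + D / 2 + d \<le> D\<close> (for \<open>m = 1\<close>) and \<open>E + 2 * d * D + d \<le> D * D\<close>
  (for \<open>m \<ge> 2\<close>), where \<open>d\<close> is the dimension; the term \<open>D / 2\<close> uses \<open>4 * d \<le> G\<close>.
\<close>

proposition decay_of_norm_pow_bounds:
  fixes f :: "'a::euclidean_space \<Rightarrow> real"
  assumes f: "smooth f" and N: "mono N" "\<And>k. 0 \<le> N k" and P: "factorial_growth P"
    and E: "E \<ge> 1" and G: "G \<ge> 4 * real DIM('a)"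
    and V: "\<And>k bs x. set bs \<subseteq> Basis \<Longrightarrow>
        \<bar>lpartial bs (\<lambda>x. norm x ^ (2 * k) * f x) x\<bar> \<le> E ^ k * G ^ length bs * N (2 * k) * P (length bs)"
  defines "D \<equiv> 2 * E + 3 * real DIM('a) + 2"
  assumes bs: "set bs \<subseteq> Basis"
  shows "norm x ^ m * \<bar>lpartial bs (\<lambda>x. norm x ^ (2 * k) * f x) x\<bar>
     \<le> D ^ m * E ^ k * G ^ length bs * N (2 * k + m + 1) * P (length bs)"
  using bs
proof (induction "length bs" arbitrary: bs k m rule: less_induct)
  case less
  let ?d = "real DIM('a)"
  let ?l = "length bs"
  have d1: "?d \<ge> 1" using DIM_positive[where 'a='a] by linarith
  have G1: "G \<ge> 1" using G d1 by linarith
  have D1: "D \<ge> 1" using d1 E unfolding D_def by linarith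
  have P0: "P j \<ge> 0" for j using factorial_growth_ge_1[OF P, of j] by linarith
  define U where "U m k l = D ^ m * E ^ k * G ^ l * N (2 * k + m + 1) * P l" for m k l
  have U0: "U m k l \<ge> 0" for m k l using D1 E G1 N P0 by (simp add: U_def)
  have IH: "norm x ^ m * \<bar>lpartial cs (\<lambda>x. norm x ^ (2 * k) * f x) x\<bar> \<le> U m k (length cs)"
    if "length cs < ?l" "set cs \<subseteq> Basis" for cs m k
    using less.hyps[OF that] by (simp add: U_def)
  have base: "\<bar>lpartial bs (\<lambda>x. norm x ^ (2 * k) * f x) x\<bar> \<le> E ^ k * G ^ ?l * N (2 * k + j) * P ?l" for k j
  proof -
    have "E ^ k * G ^ ?l * N (2 * k) * P ?l \<le> E ^ k * G ^ ?l * N (2 * k + j) * P ?l"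
      using E G1 P0 by (intro mult_right_mono mult_left_mono monoD[OF N(1)]) auto
    then show ?thesis using V[OF less.prems, of k x] by linarith
  qed
  have lP: "real ?l * P (?l - 1) \<le> P ?l" by (rule factorial_growth_pred[OF P])
  have l2P: "real ?l * (real (?l - 1) * P (?l - 2)) \<le> P ?l"
  proof -
    have "real (?l - 1) * P (?l - 2) \<le> P (?l - 1)"
      using factorial_growth_pred[OF P, of "?l - 1"] by (simp add: numeral_2_eq_2)
    then have "real ?l * (real (?l - 1) * P (?l - 2)) \<le> real ?l * P (?l - 1)" by (intro mult_left_mono) auto
    with lP show ?thesis by linarith
  qed
  have step: "norm x ^ (m + 2) * \<bar>lpartial bs (\<lambda>x. norm x ^ (2 * k) * f x) x\<bar>
     \<le> norm x ^ m * \<bar>lpartial bs (\<lambda>x. norm x ^ (2 * Suc k) * f x) x\<bar>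
       + 2 * ?d * D ^ Suc m * E ^ k * (G ^ ?l / G) * N (2 * k + m + 2) * P ?l
       + ?d * D ^ m * E ^ k * G ^ ?l * N (2 * k + m + 1) * P ?l" for m k
  proof (cases "?l = 0 \<or> norm x = 0")
    case True
    have nn: "0 \<le> 2 * ?d * D ^ Suc m * E ^ k * (G ^ ?l / G) * N (2 * k + m + 2) * P ?l"
      "0 \<le> ?d * D ^ m * E ^ k * G ^ ?l * N (2 * k + m + 1) * P ?l"
      using D1 E G1 N P0 d1 by simp_all
    show ?thesis
    proof (cases "norm x = 0")
      case True
      then show ?thesis using nn by simp
    next
      case False
      with \<open>?l = 0 \<or> norm x = 0\<close> have "bs = []" by simp
      then show ?thesis using nn by (simp add: power_add abs_mult power2_eq_square mult_ac)
    qed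
  next
    case False
    then have l: "?l \<ge> 1" and x: "norm x > 0" by (auto simp: Suc_le_eq)
    let ?g = "\<lambda>x. norm x ^ (2 * k) * f x"
    have smg: "smooth ?g" by (rule smooth_norm_pow_mult[OF f])
    have "(norm x)\<^sup>2 * \<bar>lpartial bs ?g x\<bar> \<le> \<bar>lpartial bs (\<lambda>x. (norm x)\<^sup>2 * ?g x) x\<bar>
     + ?d * (2 * norm x * (real ?l * (U (Suc m) k (?l - 1) / norm x ^ Suc m))
         + real ?l * (real (?l - 1) * (U m k (?l - 2) / norm x ^ m)))"
    proof (rule norm_sq_lpartial_le[OF smg less.prems])
      fix cs :: "'a list" assume cs: "set cs \<subseteq> Basis" "length cs = ?l - 1"
      then show "\<bar>lpartial cs ?g x\<bar> \<le> U (Suc m) k (?l - 1) / norm x ^ Suc m"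
        using IH[of cs "Suc m" k] l x by (simp add: field_simps)
    next
      fix cs :: "'a list" assume cs: "set cs \<subseteq> Basis" "length cs = ?l - 2"
      then show "\<bar>lpartial cs ?g x\<bar> \<le> U m k (?l - 2) / norm x ^ m"
        using IH[of cs m k] l x by (simp add: field_simps)
    qed
    then have "norm x ^ m * ((norm x)\<^sup>2 * \<bar>lpartial bs ?g x\<bar>) \<le> norm x ^ m * (\<bar>lpartial bs (\<lambda>x. (norm x)\<^sup>2 * ?g x) x\<bar>
     + ?d * (2 * norm x * (real ?l * (U (Suc m) k (?l - 1) / norm x ^ Suc m))
         + real ?l * (real (?l - 1) * (U m k (?l - 2) / norm x ^ m))))"
      by (intro mult_left_mono) auto
    also have "\<dots> = norm x ^ m * \<bar>lpartial bs (\<lambda>x. (norm x)\<^sup>2 * ?g x) x\<bar>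
       + 2 * ?d * (real ?l * U (Suc m) k (?l - 1)) + ?d * (real ?l * (real (?l - 1) * U m k (?l - 2)))"
    proof -
      have "norm x ^ m * (?d * (2 * norm x * (real ?l * (u / norm x ^ Suc m)) + real ?l * (real (?l - 1) * (w / norm x ^ m))))
         = 2 * ?d * (real ?l * u) + ?d * (real ?l * (real (?l - 1) * w))" for u w
        using x by (simp add: field_simps)
      then show ?thesis by (simp only: distrib_left add.assoc)
    qed
    also have "2 * ?d * (real ?l * U (Suc m) k (?l - 1)) \<le> 2 * ?d * D ^ Suc m * E ^ k * (G ^ ?l / G) * N (2 * k + m + 2) * P ?l"
    proof -
      have "real ?l * U (Suc m) k (?l - 1) = D ^ Suc m * E ^ k * G ^ (?l - 1) * N (2 * k + m + 2) * (real ?l * P (?l - 1))"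
        by (simp add: U_def mult_ac)
      also have "\<dots> \<le> D ^ Suc m * E ^ k * G ^ (?l - 1) * N (2 * k + m + 2) * P ?l"
        using lP D1 E G1 N by (intro mult_left_mono) auto
      also have "G ^ (?l - 1) = G ^ ?l / G" using l G1 by (simp add: power_diff)
      finally have "2 * ?d * (real ?l * U (Suc m) k (?l - 1))
         \<le> 2 * ?d * (D ^ Suc m * E ^ k * (G ^ ?l / G) * N (2 * k + m + 2) * P ?l)"
        using d1 by (intro mult_left_mono) auto
      then show ?thesis by (simp only: mult.assoc)
    qed
    also have "?d * (real ?l * (real (?l - 1) * U m k (?l - 2))) \<le> ?d * D ^ m * E ^ k * G ^ ?l * N (2 * k + m + 1) * P ?l"
    proof -
      have "real ?l * (real (?l - 1) * U m k (?l - 2)) = D ^ m * E ^ k * G ^ (?l - 2) * N (2 * k + m + 1) * (real ?l * (real (?l - 1) * P (?l - 2)))"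
        by (simp add: U_def mult_ac)
      also have "\<dots> \<le> D ^ m * E ^ k * G ^ ?l * N (2 * k + m + 1) * P ?l"
        using l2P D1 E G1 N P0 by (intro mult_mono mult_left_mono power_increasing) auto
      finally have "?d * (real ?l * (real (?l - 1) * U m k (?l - 2)))
         \<le> ?d * (D ^ m * E ^ k * G ^ ?l * N (2 * k + m + 1) * P ?l)"
        using d1 by (intro mult_left_mono) auto
      then show ?thesis by (simp only: mult.assoc)
    qed
    finally show ?thesis by (simp add: power_add power2_eq_square mult_ac)
  qed
  have "norm x ^ m * \<bar>lpartial bs (\<lambda>x. norm x ^ (2 * k) * f x) x\<bar> \<le> U m k ?l"
  proof (induction m arbitrary: k rule: less_induct)
    case (less m)
    consider "m = 0" | "m = 1" | m' where "m = m' + 2" by (metis One_nat_def add_2_eq_Suc' not0_implies_Suc)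
    then show ?case
    proof cases
      case 1
      then show ?thesis using base[of k 1] by (simp add: U_def)
    next
      case 2
      have "norm x \<le> 1 + (norm x)\<^sup>2" using sum_squares_bound[of 1 "norm x"] norm_ge_zero[of x] by (simp only: one_power2 mult_1)
      let ?w = "\<bar>lpartial bs (\<lambda>x. norm x ^ (2 * k) * f x) x\<bar>"
      let ?u = "E ^ k * G ^ ?l * N (2 * k + 2) * P ?l"
      have u0: "?u \<ge> 0" using E G1 N P0 by simp
      have "norm x * ?w \<le> (1 + (norm x)\<^sup>2) * ?w"
        using \<open>norm x \<le> _\<close> by (intro mult_right_mono) auto
      also have "\<dots> = ?w + norm x ^ (0 + 2) * ?w" by (simp add: distrib_right power2_eq_square)
      also have "\<dots> \<le> ?u + (E * ?u + (D / 2) * ?u + ?d * ?u)"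
      proof (rule add_mono)
        show "?w \<le> ?u" by (rule base)
        have "norm x ^ (0 + 2) * ?w \<le> norm x ^ 0 * \<bar>lpartial bs (\<lambda>x. norm x ^ (2 * Suc k) * f x) x\<bar>
          + 2 * ?d * D ^ Suc 0 * E ^ k * (G ^ ?l / G) * N (2 * k + 0 + 2) * P ?l
          + ?d * D ^ 0 * E ^ k * G ^ ?l * N (2 * k + 0 + 1) * P ?l" by (rule step)
        also have "\<dots> \<le> E * ?u + (D / 2) * ?u + ?d * ?u"
        proof (intro add_mono)
          show "norm x ^ 0 * \<bar>lpartial bs (\<lambda>x. norm x ^ (2 * Suc k) * f x) x\<bar> \<le> E * ?u"
            using base[of "Suc k" 0] by (simp add: mult_ac)
          have "2 * ?d / G \<le> 1 / 2" using G G1 by (simp add: divide_simps)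
          then have "(2 * ?d / G) * (D * ?u) \<le> (1 / 2) * (D * ?u)"
            using u0 D1 by (intro mult_right_mono) auto
          then show "2 * ?d * D ^ Suc 0 * E ^ k * (G ^ ?l / G) * N (2 * k + 0 + 2) * P ?l \<le> (D / 2) * ?u"
            by (simp add: mult_ac)
          have "N (2 * k + 1) \<le> N (2 * k + 2)" by (intro monoD[OF N(1)]) auto
          then have "?d * (E ^ k * G ^ ?l) * N (2 * k + 1) * P ?l \<le> ?d * (E ^ k * G ^ ?l) * N (2 * k + 2) * P ?l"
            using d1 E G1 P0 by (intro mult_right_mono mult_left_mono) auto
          then show "?d * D ^ 0 * E ^ k * G ^ ?l * N (2 * k + 0 + 1) * P ?l \<le> ?d * ?u"
            by (simp add: mult_ac)
        qed
        finally show "norm x ^ (0 + 2) * ?w \<le> E * ?u + (D / 2) * ?u + ?d * ?u" .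
      qed
      also have "\<dots> = (1 + E + D / 2 + ?d) * ?u" by (simp add: algebra_simps)
      also have "\<dots> \<le> D * ?u"
        using u0 d1 by (intro mult_right_mono) (auto simp: D_def)
      finally show ?thesis using 2 by (simp add: U_def mult_ac)
    next
      case (3 m')
      let ?u = "D ^ m' * E ^ k * G ^ ?l * N (2 * k + m + 1) * P ?l"
      have u0: "?u \<ge> 0" using D1 E G1 N P0 by simp
      have "norm x ^ m * \<bar>lpartial bs (\<lambda>x. norm x ^ (2 * k) * f x) x\<bar>
        \<le> norm x ^ m' * \<bar>lpartial bs (\<lambda>x. norm x ^ (2 * Suc k) * f x) x\<bar>
       + 2 * ?d * D ^ Suc m' * E ^ k * (G ^ ?l / G) * N (2 * k + m' + 2) * P ?l
       + ?d * D ^ m' * E ^ k * G ^ ?l * N (2 * k + m' + 1) * P ?l"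
        using step[of m' k] 3 by simp
      also have "\<dots> \<le> E * ?u + 2 * ?d * D * ?u + ?d * ?u"
      proof (intro add_mono)
        show "norm x ^ m' * \<bar>lpartial bs (\<lambda>x. norm x ^ (2 * Suc k) * f x) x\<bar> \<le> E * ?u"
          using less.IH[of m' "Suc k"] 3 by (simp add: U_def mult_ac)
        have Nle: "N (2 * k + m' + 2) \<le> N (2 * k + m + 1)" "N (2 * k + m' + 1) \<le> N (2 * k + m + 1)"
          using 3 by (auto intro!: monoD[OF N(1)])
        have "G ^ ?l / G \<le> G ^ ?l" using G1 by (simp add: divide_le_eq mult_le_cancel_left1)
        then have "2 * ?d * D * (D ^ m' * E ^ k) * (G ^ ?l / G) * N (2 * k + m' + 2) * P ?l
            \<le> 2 * ?d * D * (D ^ m' * E ^ k) * G ^ ?l * N (2 * k + m + 1) * P ?l"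
          using d1 D1 E G1 P0 N Nle by (intro mult_right_mono mult_mono mult_left_mono) auto
        then show "2 * ?d * D ^ Suc m' * E ^ k * (G ^ ?l / G) * N (2 * k + m' + 2) * P ?l \<le> 2 * ?d * D * ?u"
          by (simp add: mult_ac)
        have "?d * (D ^ m' * E ^ k * G ^ ?l) * N (2 * k + m' + 1) * P ?l
            \<le> ?d * (D ^ m' * E ^ k * G ^ ?l) * N (2 * k + m + 1) * P ?l"
          using d1 D1 E G1 P0 N Nle by (intro mult_right_mono mult_left_mono) auto
        then show "?d * D ^ m' * E ^ k * G ^ ?l * N (2 * k + m' + 1) * P ?l \<le> ?d * ?u"
          by (simp add: mult_ac)
      qed
      also have "\<dots> = (E + 2 * ?d * D + ?d) * ?u" by (simp add: algebra_simps)
      also have "\<dots> \<le> (D * D) * ?u"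
      proof (intro mult_right_mono u0)
        define X Y where "X = D * (2 * E + 2)" and "Y = ?d * D"
        have "1 * (2 * E + 2) \<le> X" unfolding X_def using D1 E by (intro mult_right_mono) auto
        with E have EX: "E \<le> X" by simp
        have "?d * 1 \<le> Y" unfolding Y_def using D1 d1 by (intro mult_left_mono) auto
        then have "?d \<le> Y" by simp
        then have "E + 2 * Y + ?d \<le> E + 2 * Y + Y" by (rule add_left_mono)
        also have "\<dots> \<le> X + 3 * Y" using EX by simp
        also have "X + 3 * Y = D * D" by (simp add: X_def Y_def D_def algebra_simps)
        finally show "E + 2 * ?d * D + ?d \<le> D * D" by (simp add: Y_def)
      qed
      finally show ?thesis using 3 by (simp add: U_def mult_ac)
    qed
  qed
  then show ?case by (simp add: U_def)
qed

section \<open>The classes in terms of iterated partial derivatives\<close>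

lemma local_norm_finite_iff:
  assumes f: "smooth f" and \<rho>: "\<rho> > 0" and M: "\<And>k. M k > 0"
  shows "local_norm K \<rho> M f < \<infinity> \<longleftrightarrow>
    (\<exists>C. \<forall>x\<in>K. \<forall>bs. set bs \<subseteq> Basis \<longrightarrow> \<bar>lpartial bs f x\<bar> \<le> C * (\<rho> ^ length bs * M (length bs)))"
    (is "_ \<longleftrightarrow> (\<exists>C. ?B C)")
proof -
  have pos: "\<rho> ^ l * M l > 0" for l using \<rho> M by simp
  have eq: "?B C \<longleftrightarrow> (\<forall>x\<in>K. \<forall>\<alpha>. cmod (mi_D \<alpha> f x) \<le> C * (\<rho> ^ mi_order \<alpha> * M (mi_order \<alpha>)))" for C
    using mi_D_iff_lpartial[OF f, where P="\<lambda>l y. y \<le> C * (\<rho> ^ l * M l)"] by simp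
  have q: "cmod (mi_D \<alpha> f x) / (\<rho> ^ mi_order \<alpha> * M (mi_order \<alpha>)) \<le> C \<longleftrightarrow>
     cmod (mi_D \<alpha> f x) \<le> C * (\<rho> ^ mi_order \<alpha> * M (mi_order \<alpha>))" for x \<alpha> C
    using pos[of "mi_order \<alpha>"] by (simp add: pos_divide_le_eq)
  show ?thesis
  proof
    assume fin: "local_norm K \<rho> M f < \<infinity>"
    then obtain C where C: "C \<ge> 0" "local_norm K \<rho> M f = ennreal C"
      by (metis enn2real_nonneg ennreal_enn2real infinity_ennreal_def)
    have "cmod (mi_D \<alpha> f x) \<le> C * (\<rho> ^ mi_order \<alpha> * M (mi_order \<alpha>))" if "x \<in> K" for x \<alpha>
    proof -
      have "ennreal (cmod (mi_D \<alpha> f x) / (\<rho> ^ mi_order \<alpha> * M (mi_order \<alpha>))) \<le> local_norm K \<rho> M f"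
        unfolding local_norm_def using that by (intro SUP_upper2[of x] SUP_upper) auto
      then show ?thesis using C q by (simp add: ennreal_le_iff)
    qed
    with eq show "\<exists>C. ?B C" by blast
  next
    assume "\<exists>C. ?B C"
    then obtain C where "?B C" by blast
    then have "local_norm K \<rho> M f \<le> ennreal C"
      unfolding eq local_norm_def by (intro SUP_least ennreal_leI) (simp add: q)
    then show "local_norm K \<rho> M f < \<infinity>" by (rule le_less_trans) (simp add: ennreal_less_top)
  qed
qed

text \<open>
  The set where a continuous function exceeds \<open>C\<close> is open, so it is empty as soon as it is null.
\<close>

lemma esssup_le_iff_continuous:
  fixes g :: "'a::euclidean_space \<Rightarrow> real"
  assumes g: "continuous_on UNIV g" and C: "C \<ge> 0"
  shows "esssup lborel (\<lambda>x. ennreal (g x)) \<le> ennreal C \<longleftrightarrow> (\<forall>x. g x \<le> C)"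
proof
  have m: "(\<lambda>x. ennreal (g x)) \<in> borel_measurable lborel"
    using g by (auto intro!: borel_measurable_continuous_onI measurable_compose[OF _ measurable_ennreal])
  assume le: "esssup lborel (\<lambda>x. ennreal (g x)) \<le> ennreal C"
  have "AE x in lborel. ennreal (g x) \<le> ennreal C"
    using esssup_AE[of "\<lambda>x. ennreal (g x)" lborel] by (rule AE_mp) (use le in \<open>auto intro: order_trans\<close>)
  then have ae: "AE x in lborel. g x \<le> C" using C by (simp add: ennreal_le_iff)
  have op: "open {x. C < g x}" using g by (intro open_Collect_less) auto
  have "{x \<in> space lborel. \<not> g x \<le> C} = {x. C < g x}" by auto
  then have "{x. C < g x} \<in> null_sets lborel"
    using AE_iff_null[of lborel "\<lambda>x. g x \<le> C"] ae op by simp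
  then have "negligible {x. C < g x}"
    by (simp add: negligible_iff_null_sets null_sets_completionI)
  then have "{x. C < g x} = {}" using op open_not_negligible by blast
  then show "\<forall>x. g x \<le> C" by (auto simp: not_less[symmetric])
next
  have m: "(\<lambda>x. ennreal (g x)) \<in> borel_measurable lborel"
    using g by (auto intro!: borel_measurable_continuous_onI measurable_compose[OF _ measurable_ennreal])
  assume "\<forall>x. g x \<le> C"
  then show "esssup lborel (\<lambda>x. ennreal (g x)) \<le> ennreal C"
    using m by (intro esssup_I) (auto intro: ennreal_leI)
qed

lemma gs_norm_finite_iff:
  fixes f :: "'a::euclidean_space \<Rightarrow> real"
  assumes f: "smooth f" and \<rho>: "\<rho> > 0" and M: "\<And>k. M k > 0"
  shows "gs_norm \<rho> M f < \<infinity> \<longleftrightarrow>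
    (\<exists>C. \<forall>x k bs. set bs \<subseteq> Basis \<longrightarrow>
       norm x ^ k * \<bar>lpartial bs f x\<bar> \<le> C * (\<rho> ^ (k + length bs) * M k * M (length bs)))"
    (is "_ \<longleftrightarrow> (\<exists>C. ?B C)")
proof -
  define w where "w k l = \<rho> ^ (k + l) * M k * M l" for k l
  have pos: "w k l > 0" for k l using \<rho> M by (simp add: w_def)
  have eq: "?B C \<longleftrightarrow> (\<forall>k \<alpha> x. norm x ^ k * cmod (mi_D \<alpha> f x) \<le> C * w k (mi_order \<alpha>))" for C
    using mi_D_iff_lpartial[OF f, where P="\<lambda>l y. norm x ^ k * y \<le> C * w k l" for x k] unfolding w_def by blast
  have cont: "continuous_on UNIV (\<lambda>x. norm x ^ k * cmod (mi_D \<alpha> f x))" for k \<alpha>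
  proof -
    have "continuous_on UNIV (lpartial (mi_list \<alpha>) f)"
      by (intro smooth_continuous smooth_lpartial f mi_list)
    then show ?thesis
      by (auto simp: mi_D_def norm_mult norm_power mi_partial_eq_lpartial intro!: continuous_intros)
  qed
  let ?e = "\<lambda>k \<alpha>. esssup lborel (\<lambda>x. ennreal (norm x ^ k * cmod (mi_D \<alpha> f x)))"
  have gs: "gs_norm \<rho> M f = (SUP k. SUP l. SUP \<alpha>\<in>{\<alpha>. mi_order \<alpha> = l}. ?e k \<alpha> / ennreal (w k l))"
    by (simp add: gs_norm_def w_def)
  have q: "?e k \<alpha> / ennreal (w k (mi_order \<alpha>)) \<le> ennreal C \<longleftrightarrow>
      (\<forall>x. norm x ^ k * cmod (mi_D \<alpha> f x) \<le> C * w k (mi_order \<alpha>))" if "C \<ge> 0" for k \<alpha> C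
  proof -
    let ?w = "w k (mi_order \<alpha>)"
    have "?e k \<alpha> / ennreal ?w \<le> ennreal C \<longleftrightarrow> ?e k \<alpha> \<le> ennreal C * ennreal ?w"
    proof
      assume "?e k \<alpha> / ennreal ?w \<le> ennreal C"
      then have "?e k \<alpha> / ennreal ?w * ennreal ?w \<le> ennreal C * ennreal ?w" by (rule mult_right_mono) simp
      then show "?e k \<alpha> \<le> ennreal C * ennreal ?w"
        using pos[of k "mi_order \<alpha>"] by (simp add: ennreal_divide_times)
    next
      assume "?e k \<alpha> \<le> ennreal C * ennreal ?w"
      then show "?e k \<alpha> / ennreal ?w \<le> ennreal C"
        using pos[of k "mi_order \<alpha>"] by (intro divide_le_posI_ennreal) (auto simp: mult.commute)
    qed
    also have "ennreal C * ennreal ?w = ennreal (C * ?w)" using that by (simp add: ennreal_mult')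
    also have "?e k \<alpha> \<le> ennreal (C * ?w) \<longleftrightarrow> (\<forall>x. norm x ^ k * cmod (mi_D \<alpha> f x) \<le> C * ?w)"
      using that pos[of k "mi_order \<alpha>"] by (intro esssup_le_iff_continuous cont) (auto intro: less_imp_le)
    finally show ?thesis .
  qed
  show ?thesis
  proof
    assume fin: "gs_norm \<rho> M f < \<infinity>"
    then obtain C where C: "C \<ge> 0" "gs_norm \<rho> M f = ennreal C"
      by (metis enn2real_nonneg ennreal_enn2real infinity_ennreal_def)
    have "norm x ^ k * cmod (mi_D \<alpha> f x) \<le> C * w k (mi_order \<alpha>)" for k \<alpha> x
    proof -
      have "?e k \<alpha> / ennreal (w k (mi_order \<alpha>)) \<le> gs_norm \<rho> M f"
        unfolding gs by (intro SUP_upper2[of k] SUP_upper2[of "mi_order \<alpha>"] SUP_upper) auto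
      then show ?thesis using C q by auto
    qed
    with eq show "\<exists>C. ?B C" by blast
  next
    assume "\<exists>C. ?B C"
    then obtain C where C: "?B C" by blast
    have C0: "C \<ge> 0"
    proof -
      have "norm (0::'a) ^ 0 * \<bar>lpartial [] f 0\<bar> \<le> C * w 0 (length ([] :: 'a list))"
        using C unfolding w_def by (metis empty_subsetI list.set(1))
      then have "0 \<le> C * w 0 0" by (simp add: order_trans[OF abs_ge_zero])
      then show ?thesis using pos[of 0 0] by (simp add: zero_le_mult_iff)
    qed
    have "gs_norm \<rho> M f \<le> ennreal C"
      unfolding gs using C[unfolded eq] q[OF C0] by (intro SUP_least) auto
    then show "gs_norm \<rho> M f < \<infinity>" by (rule le_less_trans) (simp add: ennreal_less_top)
  qed
qed

lemma schwartz_iff: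
  "f \<in> schwartz \<longleftrightarrow> smooth f \<and> (\<exists>c. \<forall>x k bs. set bs \<subseteq> Basis \<longrightarrow>
       norm x ^ k * \<bar>lpartial bs f x\<bar> \<le> c k (length bs))"
proof (intro iffI conjI)
  assume f: "f \<in> schwartz"
  then show sm: "smooth f" by (simp add: schwartz_def)
  have c: "cmod (mi_D \<alpha> f x) = \<bar>lpartial (mi_list \<alpha>) f x\<bar>" for \<alpha> x
    by (simp add: mi_D_def norm_mult norm_power mi_partial_eq_lpartial)
  have ex: "\<exists>b. \<forall>x. norm x ^ k * \<bar>lpartial bs f x\<bar> \<le> b" if bs: "set bs \<subseteq> Basis" for k bs
  proof -
    have "bounded (range (\<lambda>x. norm x ^ k * cmod (mi_D (count_list bs) f x)))"
      using f by (simp add: schwartz_def)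
    then obtain b where "\<And>x. \<bar>norm x ^ k * cmod (mi_D (count_list bs) f x)\<bar> \<le> b"
      unfolding bounded_iff by auto
    moreover have "lpartial (mi_list (count_list bs)) f = lpartial bs f"
      by (intro lpartial_mset_cong sm mset_mi_list bs mi_list)
    ultimately have "\<bar>norm x ^ k * \<bar>lpartial bs f x\<bar>\<bar> \<le> b" for x by (simp add: c)
    then show ?thesis by (meson abs_le_D1)
  qed
  have "\<forall>k bs. \<exists>b. set bs \<subseteq> Basis \<longrightarrow> (\<forall>x. norm x ^ k * \<bar>lpartial bs f x\<bar> \<le> b)"
    using ex by blast
  then obtain b where b: "\<And>k bs x. set bs \<subseteq> Basis \<Longrightarrow> norm x ^ k * \<bar>lpartial bs f x\<bar> \<le> b k bs"
    by metis
  define L where "L l = {bs. set bs \<subseteq> (Basis :: 'a set) \<and> length bs = l}" for l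
  have fin: "finite (L l)" for l unfolding L_def by (rule finite_lists_length_eq) simp
  have "norm x ^ k * \<bar>lpartial bs f x\<bar> \<le> (\<Sum>cs\<in>L (length bs). \<bar>b k cs\<bar>)" if bs: "set bs \<subseteq> Basis" for x k bs
  proof -
    have "norm x ^ k * \<bar>lpartial bs f x\<bar> \<le> \<bar>b k bs\<bar>" using b[OF bs, of x k] by linarith
    also have "\<dots> \<le> (\<Sum>cs\<in>L (length bs). \<bar>b k cs\<bar>)"
      using bs fin by (intro member_le_sum) (auto simp: L_def)
    finally show ?thesis .
  qed
  then show "\<exists>c. \<forall>x k bs. set bs \<subseteq> Basis \<longrightarrow> norm x ^ k * \<bar>lpartial bs f x\<bar> \<le> c k (length bs)"
    by (intro exI[of _ "\<lambda>k l. \<Sum>cs\<in>L l. \<bar>b k cs\<bar>"]) blast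
next
  assume r: "smooth f \<and> (\<exists>c. \<forall>x k bs. set bs \<subseteq> Basis \<longrightarrow>
       norm x ^ k * \<bar>lpartial bs f x\<bar> \<le> c k (length bs))"
  then obtain c where c: "\<And>x k bs. set bs \<subseteq> Basis \<Longrightarrow> norm x ^ k * \<bar>lpartial bs f x\<bar> \<le> c k (length bs)" by blast
  have "bounded (range (\<lambda>x. norm x ^ k * cmod (mi_D \<alpha> f x)))" for k \<alpha>
    unfolding bounded_iff
    by (rule exI[of _ "c k (length (mi_list \<alpha>))"])
       (use c[OF mi_list(2)] in \<open>auto simp: mi_D_def norm_mult norm_power mi_partial_eq_lpartial abs_mult\<close>)
  then show "f \<in> schwartz" using r by (simp add: schwartz_def)
qed

section \<open>Restriction to diagonal matrices\<close>

lemma linear_diag_symmat: "linear diag_symmat"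
  by (rule linearI)
    (auto simp: mat_of_symmat_inject[symmetric] plus_symmat.rep_eq scaleR_symmat.rep_eq diag_symmat.rep_eq vec_eq_iff)

lemma diag_symmat_Basis: "b \<in> Basis \<Longrightarrow> diag_symmat b \<in> Basis"
proof -
  assume "b \<in> Basis"
  then obtain j where b: "b = axis j 1" by (auto simp: Basis_vec_def)
  have "diag_symmat b = sym_unit j j"
    unfolding b by (auto simp: mat_of_symmat_inject[symmetric] sym_unit.rep_eq diag_symmat.rep_eq vec_eq_iff axis_def)
  then show ?thesis by (auto simp: Basis_symmat_def)
qed

lemma norm_diag_symmat: "norm (diag_symmat a) = norm a"
proof -
  have "(norm (diag_symmat a))\<^sup>2 = (norm a)\<^sup>2"
    unfolding power2_norm_eq_inner inner_symmat.rep_eq diag_symmat.rep_eq inner_vec_def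
    by (simp add: if_distrib if_distribR cong: if_cong)
  then show ?thesis by simp
qed

lemma smooth_compose_diag:
  assumes f: "smooth f"
  shows "smooth (\<lambda>x. f (diag_symmat x))"
    and lpartial_compose_diag: "set bs \<subseteq> Basis \<Longrightarrow>
      lpartial bs (\<lambda>x. f (diag_symmat x)) = (\<lambda>x. lpartial (map diag_symmat bs) f (diag_symmat x))"
proof -
  have bl: "bounded_linear diag_symmat" using linear_diag_symmat by (simp add: linear_conv_bounded_linear)
  have d: "((\<lambda>x. g (diag_symmat x)) has_derivative (\<lambda>h. frechet_derivative g (at (diag_symmat x)) (diag_symmat h))) (at x)"
    if "smooth g" for g x
    using has_derivative_compose[OF bounded_linear_imp_has_derivative[OF bl] frechet_derivative_smooth[OF that]] .
  have p: "partial b (\<lambda>x. g (diag_symmat x)) = (\<lambda>x. partial (diag_symmat b) g (diag_symmat x))" if "smooth g" for g b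
    using partial_eqI[OF d[OF that]] by (simp add: partial_def fun_eq_iff)
  show "smooth (\<lambda>x. f (diag_symmat x))"
  proof (rule smooth_coinduct[where X="\<lambda>h. \<exists>g. smooth g \<and> h = (\<lambda>x. g (diag_symmat x))"])
    show "h differentiable (at x)" if "\<exists>g. smooth g \<and> h = (\<lambda>x. g (diag_symmat x))" for h x
      using that d differentiableI by blast
    show "\<exists>g. smooth g \<and> partial b h = (\<lambda>x. g (diag_symmat x))"
      if "\<exists>g. smooth g \<and> h = (\<lambda>x. g (diag_symmat x))" "b \<in> Basis" for h b
      using that p smooth_partial diag_symmat_Basis by metis
  qed (use f in blast)
  show "set bs \<subseteq> Basis \<Longrightarrow>
      lpartial bs (\<lambda>x. f (diag_symmat x)) = (\<lambda>x. lpartial (map diag_symmat bs) f (diag_symmat x))"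
  proof (induction bs)
    case (Cons b bs)
    have "set (map diag_symmat bs) \<subseteq> Basis" using Cons.prems diag_symmat_Basis by auto
    with Cons show ?case by (simp add: p smooth_lpartial f)
  qed simp
qed

lemma map_diag_symmat_Basis: "set bs \<subseteq> Basis \<Longrightarrow> set (map diag_symmat bs) \<subseteq> Basis"
  using diag_symmat_Basis by auto

section \<open>Growth of weight sequences\<close>

lemma weight_sequence_pos: "weight_sequence M \<Longrightarrow> M k > 0"
  by (simp add: weight_sequence_def)

text \<open>
  By log-convexity the quotients \<open>M (Suc k) / M k\<close> increase, and \<open>M (Suc k)\<close> is the product of the first
  \<open>Suc k\<close> of them because \<open>M 0 = 1\<close>.
\<close>

lemma weight_sequence_le_quotient_power:
  assumes M: "weight_sequence M"
  shows "M (Suc k) \<le> (M (Suc k) / M k) ^ Suc k"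
proof (induction k)
  case 0
  then show ?case using M by (simp add: weight_sequence_def)
next
  case (Suc k)
  have p: "M j > 0" for j using M by (rule weight_sequence_pos)
  have "(M (Suc k))\<^sup>2 \<le> M k * M (Suc (Suc k))"
    using M unfolding weight_sequence_def by (metis One_nat_def Suc_eq_plus1 diff_Suc_1 le_add2)
  then have q: "M (Suc k) / M k \<le> M (Suc (Suc k)) / M (Suc k)"
    using p by (simp add: field_simps power2_eq_square)
  have "M (Suc (Suc k)) = M (Suc (Suc k)) / M (Suc k) * M (Suc k)" using p[of "Suc k"] by simp
  also have "\<dots> \<le> M (Suc (Suc k)) / M (Suc k) * (M (Suc k) / M k) ^ Suc k"
    using Suc p[of "Suc k"] p[of "Suc (Suc k)"] by (intro mult_left_mono) auto
  also have "\<dots> \<le> M (Suc (Suc k)) / M (Suc k) * (M (Suc (Suc k)) / M (Suc k)) ^ Suc k"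
    using q p by (intro mult_left_mono power_mono) (auto intro: less_imp_le)
  finally show ?case by simp
qed

lemma power_self_le_exp_fact: "real k ^ k \<le> exp 1 ^ k * fact k"
proof -
  have "real k ^ k / fact k \<le> exp (real k)"
    using summable_exp_generic[of "real k"]
    by (simp add: exp_def divide_inverse_commute[symmetric] scaleR_conv_of_real)
       (rule order_trans[OF _ sum_le_suminf[of _ "{k}"]], auto simp: divide_inverse mult.commute)
  then show ?thesis by (simp add: field_simps exp_of_nat_mult[symmetric])
qed

text \<open>
  Both regularity conditions compare \<open>M k\<close> with \<open>fact k\<close>. Here this is turned into a comparison of successive
  quotients, using \<open>k ^ k \<le> exp k * fact k\<close>.
\<close>

lemma weight_quotient_bound:
  assumes M: "weight_sequence M" and \<epsilon>: "\<epsilon> > 0" and r: "root (Suc k) (fact (Suc k) / M (Suc k)) \<le> \<epsilon>"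
  shows "real (Suc k) * M k \<le> (exp 1 * \<epsilon>) * M (Suc k)"
proof -
  have p: "M j > 0" for j using M by (rule weight_sequence_pos)
  let ?\<mu> = "M (Suc k) / M k" and ?n = "Suc k"
  have "fact ?n / M ?n = root ?n (fact ?n / M ?n) ^ ?n"
    using p[of ?n] by (intro real_root_pow_pos2[symmetric]) (auto intro!: divide_nonneg_nonneg less_imp_le)
  also have "\<dots> \<le> \<epsilon> ^ ?n"
    using r p[of ?n] by (intro power_mono) (auto intro!: real_root_ge_zero divide_nonneg_nonneg less_imp_le)
  finally have "fact ?n \<le> \<epsilon> ^ ?n * M ?n" using p[of ?n] by (simp only: pos_divide_le_eq)
  also have "\<dots> \<le> \<epsilon> ^ ?n * ?\<mu> ^ ?n"
    using weight_sequence_le_quotient_power[OF M] \<epsilon> by (intro mult_left_mono) auto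
  finally have f: "fact ?n \<le> \<epsilon> ^ ?n * ?\<mu> ^ ?n" .
  have "real ?n ^ ?n \<le> exp 1 ^ ?n * fact ?n" by (rule power_self_le_exp_fact)
  also have "\<dots> \<le> exp 1 ^ ?n * (\<epsilon> ^ ?n * ?\<mu> ^ ?n)" using f by (intro mult_left_mono) auto
  also have "\<dots> = (exp 1 * \<epsilon> * ?\<mu>) ^ ?n" by (simp only: power_mult_distrib mult.assoc)
  finally have "real ?n \<le> exp 1 * \<epsilon> * ?\<mu>"
    by (rule power_le_imp_le_base) (use \<epsilon> p in \<open>auto intro!: mult_nonneg_nonneg divide_nonneg_nonneg less_imp_le\<close>)
  then show ?thesis using p[of k] by (simp add: field_simps)
qed

text \<open>
  The majorant is obtained from \<open>\<rho> ^ k * M k\<close> by raising its quotients to at least \<open>Suc k\<close>. Only finitely many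
  quotients change, so majorant and original are equivalent up to a constant factor. In this way \<open>\<rho>\<close>
  is absorbed into the weight, and the Beurling case, with \<open>\<rho>\<close> arbitrarily small, needs no separate treatment:
  all geometric losses further on are independent of \<open>\<rho>\<close>.
\<close>

proposition factorial_growth_majorant:
  assumes M: "weight_sequence M" and \<rho>: "\<rho> > 0"
    and ev: "\<forall>\<^sub>F k in sequentially. real (Suc k) * M k \<le> \<rho> * M (Suc k)"
  obtains M' D where "factorial_growth M'" "D > 0" "\<And>k. \<rho> ^ k * M k \<le> M' k" "\<And>k. M' k \<le> D * \<rho> ^ k * M k"
proof -
  have p: "M j > 0" for j using M by (rule weight_sequence_pos)
  define M' where "M' = rec_nat 1 (\<lambda>k y. max (\<rho> * M (Suc k) / M k) (real (Suc k)) * y)"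
  have M'0: "M' 0 = 1" and M'S: "M' (Suc k) = max (\<rho> * M (Suc k) / M k) (real (Suc k)) * M' k" for k
    by (simp_all add: M'_def)
  have M'1: "M' k \<ge> 1" for k
  proof (induction k)
    case (Suc k)
    have "1 * 1 \<le> max (\<rho> * M (Suc k) / M k) (real (Suc k)) * M' k"
      using Suc by (intro mult_mono) auto
    then show ?case by (simp add: M'S)
  qed (simp add: M'0)
  have g: "factorial_growth M'"
    unfolding factorial_growth_def M'S
  proof (intro conjI allI)
    fix k show "real (Suc k) * M' k \<le> max (\<rho> * M (Suc k) / M k) (real (Suc k)) * M' k"
      using M'1[of k] by (intro mult_right_mono) auto
  qed (simp add: M'0)
  have low: "\<rho> ^ k * M k \<le> M' k" for k
  proof (induction k)
    case (Suc k)
    have "\<rho> ^ Suc k * M (Suc k) = (\<rho> * M (Suc k) / M k) * (\<rho> ^ k * M k)" using p[of k] by simp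
    also have "\<dots> \<le> max (\<rho> * M (Suc k) / M k) (real (Suc k)) * M' k"
      using Suc p[of k] \<rho> by (intro mult_mono) auto
    finally show ?case by (simp add: M'S)
  qed (use M in \<open>simp add: M'0 weight_sequence_def\<close>)
  obtain K where K: "\<And>k. k \<ge> K \<Longrightarrow> real (Suc k) * M k \<le> \<rho> * M (Suc k)"
    using ev unfolding eventually_sequentially by blast
  define q where "q k = M' k / (\<rho> ^ k * M k)" for k
  have q0: "q k > 0" for k using M'1[of k] \<rho> p by (simp add: q_def less_le_trans[OF zero_less_one])
  have qS: "q (Suc k) = q k" if "k \<ge> K" for k
  proof -
    have "real (Suc k) \<le> \<rho> * M (Suc k) / M k" using K[OF that] p[of k] by (simp add: pos_le_divide_eq)
    then have "M' (Suc k) = \<rho> * M (Suc k) / M k * M' k" by (simp add: M'S max_absorb1)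
    then show ?thesis using p[of k] p[of "Suc k"] \<rho> by (simp add: q_def)
  qed
  have qK: "q (K + j) = q K" for j by (induction j) (simp_all add: qS)
  define D where "D = (\<Sum>k\<le>K. q k)"
  have qD: "q k \<le> D" for k
  proof (cases "k \<le> K")
    case True
    then show ?thesis unfolding D_def using q0 by (intro member_le_sum) (auto intro: less_imp_le)
  next
    case False
    then have "q k = q K" using qK[of "k - K"] by simp
    also have "\<dots> \<le> D" unfolding D_def using q0 by (intro member_le_sum) (auto intro: less_imp_le)
    finally show ?thesis .
  qed
  have up: "M' k \<le> D * \<rho> ^ k * M k" for k
  proof -
    have "\<rho> ^ k * M k > 0" using p \<rho> by simp
    then show ?thesis using qD[of k] by (simp add: q_def pos_divide_le_eq mult.assoc)
  qed
  have "D > 0" using q0[of 0] qD[of 0] by linarith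
  from that[OF g this low up] show ?thesis .
qed

lemma beurling_quotient:
  assumes W: "weight_matrix W" and reg: "beurling_regular W" and M: "M \<in> W" and \<rho>: "\<rho> > 0"
  shows "\<forall>\<^sub>F k in sequentially. real (Suc k) * M k \<le> \<rho> * M (Suc k)"
proof -
  have ws: "weight_sequence M" using W M by (simp add: weight_matrix_def)
  have "(\<lambda>k. root k (fact k / M k)) \<longlonglongrightarrow> 0" using reg M by (simp add: beurling_regular_def)
  moreover have "0 < \<rho> / exp 1" using \<rho> by simp
  ultimately have "\<forall>\<^sub>F k in sequentially. root k (fact k / M k) < \<rho> / exp 1" by (rule order_tendstoD(2))
  then have "\<forall>\<^sub>F k in sequentially. root (Suc k) (fact (Suc k) / M (Suc k)) < \<rho> / exp 1"
    by (simp only: eventually_sequentially_Suc[of "\<lambda>k. root k (fact k / M k) < \<rho> / exp 1"])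
  then show ?thesis
  proof eventually_elim
    case (elim k)
    from weight_quotient_bound[OF ws \<open>0 < \<rho> / exp 1\<close>, of k] elim show ?case by simp
  qed
qed

lemma roumieu_quotient:
  assumes W: "weight_matrix W" and reg: "roumieu_regular W" and M: "M \<in> W"
  obtains \<rho>0 where "\<rho>0 > 0" "\<And>\<rho>. \<rho> \<ge> \<rho>0 \<Longrightarrow> \<forall>\<^sub>F k in sequentially. real (Suc k) * M k \<le> \<rho> * M (Suc k)"
proof -
  have ws: "weight_sequence M" using W M by (simp add: weight_matrix_def)
  have "bounded (range (\<lambda>k. root k (fact k / M k)))" using reg M by (simp add: roumieu_regular_def)
  then obtain B where B: "B > 0" "\<And>k. \<bar>root k (fact k / M k)\<bar> \<le> B"
    unfolding bounded_pos by auto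
  show ?thesis
  proof (rule that[of "exp 1 * B"])
    fix \<rho> assume \<rho>: "\<rho> \<ge> exp 1 * B"
    have "real (Suc k) * M k \<le> \<rho> * M (Suc k)" for k
    proof -
      have "real (Suc k) * M k \<le> (exp 1 * B) * M (Suc k)"
        using B(2)[of "Suc k"] by (intro weight_quotient_bound[OF ws B(1)]) linarith
      also have "\<dots> \<le> \<rho> * M (Suc k)" using \<rho> weight_sequence_pos[OF ws] by (intro mult_right_mono) (auto intro: less_imp_le)
      finally show ?thesis .
    qed
    then show "\<forall>\<^sub>F k in sequentially. real (Suc k) * M k \<le> \<rho> * M (Suc k)" by simp
  qed (use B in simp)
qed

section \<open>Transfer of ultradifferentiable bounds\<close>

lemma norm_orthogonal_matrix_mult:
  fixes S B :: "real^'n^'n"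
  assumes "orthogonal_matrix S"
  shows "norm (S ** B) = norm B"
proof -
  have cols: "(norm B)\<^sup>2 = (\<Sum>j\<in>UNIV. (norm (column j B))\<^sup>2)" for B :: "real^'n^'n"
    unfolding power2_norm_eq_inner inner_vec_def column_def
    by (subst sum.swap) simp
  have "column j (S ** B) = S *v column j B" for j
    by (simp add: vec_eq_iff column_def matrix_matrix_mult_def matrix_vector_mult_def)
  moreover have "norm (S *v x) = norm x" for x
    using assms by (metis orthogonal_transformation orthogonal_transformation_matrix matrix_of_matrix_vector_mul matrix_vector_mul_linear)
  ultimately have "(norm (S ** B))\<^sup>2 = (norm B)\<^sup>2" unfolding cols by simp
  then show ?thesis by simp
qed

lemma norm_transpose: "norm (transpose B) = norm (B :: real^'n^'m)"
proof -
  have "(norm (transpose B))\<^sup>2 = (norm B)\<^sup>2"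
    unfolding power2_norm_eq_inner inner_vec_def transpose_def by (subst sum.swap) simp
  then show ?thesis by simp
qed

lemma norm_conj_symmat:
  assumes "orthogonal_matrix S" shows "norm (conj_symmat S A) = norm A"
proof -
  let ?A = "mat_of_symmat A"
  have "norm (conj_symmat S A) = norm (S ** (?A ** transpose S))"
    by (simp add: norm_symmat.rep_eq conj_symmat.rep_eq matrix_mul_assoc)
  also have "\<dots> = norm (transpose (?A ** transpose S))"
    by (simp add: norm_orthogonal_matrix_mult[OF assms] norm_transpose)
  also have "\<dots> = norm (S ** transpose ?A)" by (simp add: matrix_transpose_mul)
  also have "\<dots> = norm A"
    by (simp add: norm_orthogonal_matrix_mult[OF assms] norm_transpose norm_symmat.rep_eq)
  finally show ?thesis .
qed

lemma norm_permute:
  fixes x :: "real^'n::finite"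
  assumes "p permutes UNIV" shows "norm (\<chi> i. x $ p i) = norm x"
proof -
  have "(norm (\<chi> i. x $ p i))\<^sup>2 = (norm x)\<^sup>2"
    unfolding power2_norm_eq_inner inner_vec_def
    using sum.permute[OF assms, of "\<lambda>i. x $ i * x $ i"] by (simp add: o_def)
  then show ?thesis by simp
qed

lemma spectral_companion_norm_pow_mult:
  assumes "spectral_companion f F"
  shows "spectral_companion (\<lambda>A. norm A ^ k * f A) (\<lambda>x. norm x ^ k * F x)"
  using assms
  by (auto simp: spectral_companion_def symmetric_fun_def norm_permute norm_conj_symmat norm_diag_symmat)

text \<open>
  The number of derivatives, and the geometric factor per derivative or power of the norm, that are lost in
  the passage from \<open>F\<close> to \<open>f\<close>. That they depend on \<open>n\<close> only is essential in the Beurling case.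
\<close>

definition loss_order :: "'n::finite itself \<Rightarrow> nat"
  where "loss_order _ = CARD('n) * CARD('n)"

definition loss_factor :: "'n::finite itself \<Rightarrow> real"
  where "loss_factor _ = 2 * (16 * real CARD('n)) + 3 * real DIM('n symmat) + 2
      + 4 * real DIM('n symmat) * real CARD('n)"

text \<open>
  The bounds for \<open>norm A ^ (2 * k) * f A\<close> come from its companion \<open>norm x ^ (2 * k) * F x\<close>, whose bounds are those of
  \<open>F\<close> with the decay index raised by \<open>2 * k\<close>.
\<close>

proposition decay_transfer:
  fixes f :: "'n::finite symmat \<Rightarrow> real"
  assumes fF: "spectral_companion f F" and F: "smooth F" and C: "C \<ge> 0"
    and b: "deriv_bound UNIV (\<lambda>k. C * M k) M F" and M: "factorial_growth M" and bs: "set bs \<subseteq> Basis"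
  defines "s \<equiv> loss_order TYPE('n)"
  shows "norm A ^ m * \<bar>lpartial bs f A\<bar> \<le>
     (4 ^ s / repr_const TYPE('n) * C) * loss_factor TYPE('n) ^ (m + length bs) * M (m + 1 + s) * M (length bs + s)"
proof -
  let ?\<kappa> = "repr_const TYPE('n)" and ?n = "real CARD('n)" and ?d = "real DIM('n symmat)"
  let ?E = "16 * ?n" and ?G = "4 * ?d * ?n"
  let ?D = "2 * ?E + 3 * ?d + 2"
  define N where "N j = 4 ^ s / ?\<kappa> * (C * M (j + s))" for j
  define P where "P l = M (l + s)" for l
  have \<kappa>: "?\<kappa> > 0" by (rule repr_const_pos)
  have M1: "M j \<ge> 1" for j by (rule factorial_growth_ge_1[OF M])
  have M0: "M j \<ge> 0" for j using M1[of j] by linarith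
  have monoM: "mono M" by (rule factorial_growth_mono[OF M])
  have n1: "?n \<ge> 1" by (simp add: Suc_le_eq)
  have d1: "?d \<ge> 1" using DIM_positive[where 'a="'n symmat"] by linarith
  have monoC: "mono (\<lambda>k. C * M k)" using monoM C by (auto intro!: monoI mult_left_mono dest: monoD)
  have sm: "smooth f" by (rule smooth_transfer[OF fF F])
  have G: "?G \<ge> 4 * ?d" using n1 d1 by (simp add: mult_le_cancel_left1)
  have "1 \<le> 4 * ?d" using d1 by linarith
  then have "1 * ?n \<le> (4 * ?d) * ?n" using n1 by (intro mult_right_mono) auto
  then have nG: "?n \<le> ?G" by simp
  have V: "\<bar>lpartial cs (\<lambda>A. norm A ^ (2 * k) * f A) B\<bar> \<le> ?E ^ k * ?G ^ length cs * N (2 * k) * P (length cs)"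
    if cs: "set cs \<subseteq> Basis" for k cs B
  proof -
    let ?R = "?n * norm B"
    have "deriv_bound UNIV (\<lambda>j. (16 * real DIM(real^'n)) ^ k * (C * M (j + 2 * k))) M (\<lambda>x. norm x ^ (2 * k) * F x)"
      using monoC C M0 by (intro deriv_bound_norm_pow_mult[OF b F]) (auto intro: M)
    then have "deriv_bound (cball 0 ?R) (\<lambda>j. ?E ^ k * (C * M (j + 2 * k))) M (\<lambda>x. norm x ^ (2 * k) * F x)"
      by (simp add: deriv_bound_def)
    moreover have "mono (\<lambda>j. ?E ^ k * (C * M (j + 2 * k)))"
      by (rule mono_shift_mult[OF monoC]) simp
    moreover have "0 \<le> ?E ^ k * (C * M (0 + 2 * k))" using C M0 by simp
    ultimately have "\<bar>lpartial cs (\<lambda>A. norm A ^ (2 * k) * f A) B\<bar>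
      \<le> (4 ^ s / ?\<kappa>) * (?E ^ k * (C * M (s + 2 * k))) * ?n ^ length cs * M (length cs + s)"
      unfolding s_def loss_order_def
      by (rule lpartial_bound_transfer[OF spectral_companion_norm_pow_mult[OF fF] smooth_norm_pow_mult[OF F] _ _ _ M order_refl cs])
    also have "\<dots> = ?E ^ k * N (2 * k) * P (length cs) * ?n ^ length cs"
      by (simp add: N_def P_def mult_ac add_ac)
    also have "\<dots> \<le> ?E ^ k * N (2 * k) * P (length cs) * ?G ^ length cs"
      using nG n1 \<kappa> C M0 by (intro mult_left_mono power_mono) (auto simp: N_def P_def)
    finally show ?thesis by (simp add: mult_ac)
  qed
  have "norm A ^ m * \<bar>lpartial bs (\<lambda>A. norm A ^ (2 * 0) * f A) A\<bar>
      \<le> ?D ^ m * ?E ^ 0 * ?G ^ length bs * N (2 * 0 + m + 1) * P (length bs)"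
  proof (rule decay_of_norm_pow_bounds[OF sm _ _ _ _ G V bs])
    show "mono N" unfolding N_def using \<kappa> C by (intro monoI mult_left_mono monoD[OF monoM]) auto
    show "0 \<le> N j" for j using \<kappa> C M0 by (simp add: N_def)
    show "factorial_growth P" unfolding P_def by (rule factorial_growth_shift[OF M])
    show "1 \<le> ?E" using n1 by linarith
  qed
  also have "\<dots> = ?D ^ m * ?G ^ length bs * (N (m + 1) * P (length bs))" by simp
  also have "\<dots> \<le> loss_factor TYPE('n) ^ m * loss_factor TYPE('n) ^ length bs * (N (m + 1) * P (length bs))"
    using n1 d1 \<kappa> C M0 by (intro mult_right_mono mult_mono power_mono) (auto simp: loss_factor_def N_def P_def)
  finally show ?thesis by (simp add: N_def P_def power_add mult_ac)
qed

lemma local_bound_transfer: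
  fixes f :: "'n::finite symmat \<Rightarrow> real"
  assumes fF: "spectral_companion f F" and F: "smooth F"
    and M: "weight_sequence M" and \<rho>: "\<rho> > 0"
    and ev: "\<forall>\<^sub>F k in sequentially. real (Suc k) * M k \<le> \<rho> * M (Suc k)"
    and bd: "\<And>x bs. norm x \<le> R \<Longrightarrow> set bs \<subseteq> Basis \<Longrightarrow> \<bar>lpartial bs F x\<bar> \<le> C * (\<rho> ^ length bs * M (length bs))"
  obtains C' where "\<And>A bs. CARD('n) * norm A \<le> R \<Longrightarrow> set bs \<subseteq> Basis \<Longrightarrow>
      \<bar>lpartial bs f A\<bar> \<le> C' * ((loss_factor TYPE('n) * \<rho>) ^ length bs * M (length bs + loss_order TYPE('n)))"
proof -
  let ?s = "loss_order TYPE('n)" and ?B = "loss_factor TYPE('n)"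
  obtain M' D where M': "factorial_growth M'" and D: "D > 0"
    and low: "\<And>k. \<rho> ^ k * M k \<le> M' k" and up: "\<And>k. M' k \<le> D * \<rho> ^ k * M k"
    using factorial_growth_majorant[OF M \<rho> ev] by blast
  define N where "N k = \<bar>C\<bar> * max 1 R ^ k" for k
  have N: "mono N" "N 0 \<ge> 0" "N k \<ge> 0" for k
    by (auto simp: N_def intro!: monoI mult_left_mono power_increasing)
  have M'0: "M' k \<ge> 0" for k using factorial_growth_ge_1[OF M', of k] by linarith
  have b: "deriv_bound (cball 0 R) N M' F"
    unfolding deriv_bound_def
  proof (intro ballI allI impI)
    fix x :: "real^'n" and k bs assume x: "x \<in> cball 0 R" and bs: "set bs \<subseteq> (Basis :: (real^'n) set)"
    have "\<bar>lpartial bs F x\<bar> \<le> C * (\<rho> ^ length bs * M (length bs))" using bd x bs by simp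
    also have "\<dots> \<le> \<bar>C\<bar> * M' (length bs)"
      using low[of "length bs"] weight_sequence_pos[OF M] \<rho> by (intro mult_mono) (auto intro: less_imp_le)
    finally have "norm x ^ k * \<bar>lpartial bs F x\<bar> \<le> max 1 R ^ k * (\<bar>C\<bar> * M' (length bs))"
      using x by (intro mult_mono power_mono) auto
    then show "norm x ^ k * \<bar>lpartial bs F x\<bar> \<le> N k * M' (length bs)" by (simp add: N_def mult_ac)
  qed
  define K where "K = 4 ^ ?s / repr_const TYPE('n) * N ?s"
  have K: "K \<ge> 0" unfolding K_def using N repr_const_pos[where 'n='n] by simp
  have nB: "real CARD('n) \<le> ?B" by (simp add: loss_factor_def)
  show ?thesis
  proof (rule that[of "K * D * \<rho> ^ ?s"])
    fix A :: "'n symmat" and bs assume A: "CARD('n) * norm A \<le> R" and bs: "set bs \<subseteq> (Basis :: 'n symmat set)"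
    let ?l = "length bs"
    have "\<bar>lpartial bs f A\<bar> \<le> K * real CARD('n) ^ ?l * M' (?l + ?s)"
      using lpartial_bound_transfer[OF fF F b N(1,2) M' A bs] by (simp add: K_def loss_order_def)
    also have "\<dots> \<le> K * ?B ^ ?l * (D * \<rho> ^ (?l + ?s) * M (?l + ?s))"
      using K nB M'0 up by (intro mult_mono mult_left_mono power_mono) auto
    also have "\<dots> = K * D * \<rho> ^ ?s * ((?B * \<rho>) ^ ?l * M (?l + ?s))"
      by (simp add: power_add power_mult_distrib mult_ac)
    finally show "\<bar>lpartial bs f A\<bar> \<le> K * D * \<rho> ^ ?s * ((?B * \<rho>) ^ ?l * M (?l + ?s))" .
  qed
qed

lemma gs_bound_transfer:
  fixes f :: "'n::finite symmat \<Rightarrow> real"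
  assumes fF: "spectral_companion f F" and F: "smooth F"
    and M: "weight_sequence M" and \<rho>: "\<rho> > 0"
    and ev: "\<forall>\<^sub>F k in sequentially. real (Suc k) * M k \<le> \<rho> * M (Suc k)"
    and bd: "\<And>x k bs. set bs \<subseteq> Basis \<Longrightarrow>
        norm x ^ k * \<bar>lpartial bs F x\<bar> \<le> C * (\<rho> ^ (k + length bs) * M k * M (length bs))"
  obtains C' where "\<And>A k bs. set bs \<subseteq> Basis \<Longrightarrow>
      norm A ^ k * \<bar>lpartial bs f A\<bar> \<le> C' * ((loss_factor TYPE('n) * \<rho>) ^ (k + length bs)
         * M (k + (1 + loss_order TYPE('n))) * M (length bs + loss_order TYPE('n)))" "C' \<ge> 0"
proof -
  let ?s = "loss_order TYPE('n)" and ?B = "loss_factor TYPE('n)"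
  obtain M' D where M': "factorial_growth M'" and D: "D > 0"
    and low: "\<And>k. \<rho> ^ k * M k \<le> M' k" and up: "\<And>k. M' k \<le> D * \<rho> ^ k * M k"
    using factorial_growth_majorant[OF M \<rho> ev] by blast
  have M'0: "M' k \<ge> 0" for k using factorial_growth_ge_1[OF M', of k] by linarith
  have M0: "M k \<ge> 0" for k using weight_sequence_pos[OF M, of k] by simp
  have b: "deriv_bound UNIV (\<lambda>k. \<bar>C\<bar> * M' k) M' F"
    unfolding deriv_bound_def
  proof (intro ballI allI impI)
    fix x :: "real^'n" and k bs assume bs: "set bs \<subseteq> (Basis :: (real^'n) set)"
    have "norm x ^ k * \<bar>lpartial bs F x\<bar> \<le> C * (\<rho> ^ (k + length bs) * M k * M (length bs))" by (rule bd[OF bs])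
    also have "\<dots> = C * ((\<rho> ^ k * M k) * (\<rho> ^ length bs * M (length bs)))" by (simp add: power_add mult_ac)
    also have "\<dots> \<le> \<bar>C\<bar> * (M' k * M' (length bs))"
      using low M0 M'0 \<rho> by (intro mult_mono) auto
    finally show "norm x ^ k * \<bar>lpartial bs F x\<bar> \<le> \<bar>C\<bar> * M' k * M' (length bs)" by simp
  qed
  define K where "K = 4 ^ ?s / repr_const TYPE('n) * \<bar>C\<bar>"
  have K: "K \<ge> 0" unfolding K_def using repr_const_pos[where 'n='n] by simp
  have B: "?B \<ge> 0" by (simp add: loss_factor_def)
  show ?thesis
  proof (rule that)
    fix A :: "'n symmat" and k bs assume bs: "set bs \<subseteq> (Basis :: 'n symmat set)"
    let ?l = "length bs"
    have "norm A ^ k * \<bar>lpartial bs f A\<bar> \<le> K * ?B ^ (k + ?l) * M' (k + 1 + ?s) * M' (?l + ?s)"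
      using decay_transfer[OF fF F abs_ge_zero b M' bs] by (simp add: K_def)
    also have "\<dots> \<le> K * ?B ^ (k + ?l) * (D * \<rho> ^ (k + 1 + ?s) * M (k + 1 + ?s)) * (D * \<rho> ^ (?l + ?s) * M (?l + ?s))"
      using K B up[of "k + 1 + ?s"] up[of "?l + ?s"] M'0 M0 D \<rho> by (intro mult_mono mult_left_mono) auto
    also have "\<dots> = K * D * D * \<rho> ^ (1 + ?s + ?s) * ((?B * \<rho>) ^ (k + ?l) * M (k + (1 + ?s)) * M (?l + ?s))"
      by (simp add: power_add power_mult_distrib mult_ac)
    finally show "norm A ^ k * \<bar>lpartial bs f A\<bar> \<le> K * D * D * \<rho> ^ (1 + ?s + ?s)
        * ((?B * \<rho>) ^ (k + ?l) * M (k + (1 + ?s)) * M (?l + ?s))" .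
  qed (use K D \<rho> in simp)
qed

text \<open>
  Arbitrary Schwartz bounds \<open>c k l\<close> are dominated by \<open>M k * M l\<close> for some \<open>M\<close> of factorial growth, because
  \<open>c k l\<close> is at most the \<open>max k l\<close>-th term of a suitable sequence that is at least \<open>1\<close>. So the Schwartz space is
  covered by the weighted estimates.
\<close>

lemma schwartz_transfer:
  assumes fF: "spectral_companion f F" and F: "F \<in> schwartz"
  shows "f \<in> schwartz"
proof -
  have smF: "smooth F" using F by (simp add: schwartz_def)
  obtain c where c: "\<And>x k bs. set bs \<subseteq> Basis \<Longrightarrow> norm x ^ k * \<bar>lpartial bs F x\<bar> \<le> c k (length bs)"
    using F unfolding schwartz_iff by blast
  define m where "m j = 1 + (\<Sum>k\<le>j. \<Sum>l\<le>j. \<bar>c k l\<bar>)" for j :: nat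
  define M where "M = rec_nat (m 0) (\<lambda>k y. max (m (Suc k)) (real (Suc k) * y))"
  have M0: "M 0 = m 0" and MS: "M (Suc k) = max (m (Suc k)) (real (Suc k) * M k)" for k
    by (simp_all add: M_def)
  have mM: "m k \<le> M k" for k by (cases k) (simp_all add: M0 MS)
  have m1: "1 \<le> m j" for j by (simp add: m_def sum_nonneg)
  have M: "factorial_growth M" by (simp add: factorial_growth_def MS M0 m1)
  have cm: "c k l \<le> M k * M l" for k l
  proof -
    have "\<bar>c k l\<bar> \<le> (\<Sum>j\<le>max k l. \<bar>c k j\<bar>)" by (rule member_le_sum) auto
    also have "\<dots> \<le> (\<Sum>i\<le>max k l. \<Sum>j\<le>max k l. \<bar>c i j\<bar>)"
      by (rule member_le_sum[of k "{..max k l}" "\<lambda>i. \<Sum>j\<le>max k l. \<bar>c i j\<bar>"]) (auto intro: sum_nonneg)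
    finally have "c k l \<le> m (max k l)" unfolding m_def by linarith
    also have "\<dots> \<le> M (max k l)" by (rule mM)
    also have "\<dots> \<le> M k * M l"
      using factorial_growth_ge_1[OF M, of k] factorial_growth_ge_1[OF M, of l]
      by (cases "k \<le> l") (auto simp: max_def mult_le_cancel_left1 mult_le_cancel_right1)
    finally show ?thesis .
  qed
  have "deriv_bound UNIV (\<lambda>k. 1 * M k) M F"
    unfolding deriv_bound_def using order_trans[OF c cm] by auto
  note * = decay_transfer[OF fF smF zero_le_one this M]
  show ?thesis
    unfolding schwartz_iff
  proof (intro conjI smooth_transfer[OF fF smF] exI allI impI)
    fix A k and bs :: "'a symmat list" assume "set bs \<subseteq> Basis"
    from *[OF this] show "norm A ^ k * \<bar>lpartial bs f A\<bar> \<le>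
      (\<lambda>k l. (4 ^ loss_order TYPE('a) / repr_const TYPE('a) * 1) * loss_factor TYPE('a) ^ (k + l)
        * M (k + 1 + loss_order TYPE('a)) * M (l + loss_order TYPE('a))) k (length bs)" by simp
  qed
qed

section \<open>Invariance of the ultradifferentiable classes\<close>

lemma E_restrict:
  fixes f :: "'n::finite symmat \<Rightarrow> real"
  assumes fF: "symmetric_companion f F" and f: "smooth f" and K: "compact K" and \<rho>: "\<rho> > 0" and M: "\<And>k. M k > 0"
    and fin: "local_norm (diag_symmat ` K) \<rho> M f < \<infinity>"
  shows "local_norm K \<rho> M F < \<infinity>"
proof -
  have F: "F = (\<lambda>x. f (diag_symmat x))" using symmetric_companion_diag[OF fF] by auto
  have smF: "smooth F" unfolding F by (rule smooth_compose_diag[OF f])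
  from fin obtain C where C: "\<And>x bs. x \<in> K \<Longrightarrow> set bs \<subseteq> Basis \<Longrightarrow>
      \<bar>lpartial bs f (diag_symmat x)\<bar> \<le> C * (\<rho> ^ length bs * M (length bs))"
    unfolding local_norm_finite_iff[OF f \<rho> M] by blast
  have "\<bar>lpartial bs F x\<bar> \<le> C * (\<rho> ^ length bs * M (length bs))" if "x \<in> K" "set bs \<subseteq> Basis" for x bs
    using C[OF that(1) map_diag_symmat_Basis[OF that(2)]] lpartial_compose_diag[OF f that(2)]
    by (simp add: F)
  then show ?thesis unfolding local_norm_finite_iff[OF smF \<rho> M] by blast
qed

lemma compact_diag_image: "compact K \<Longrightarrow> compact (diag_symmat ` K)"
  using linear_diag_symmat
  by (intro compact_continuous_image linear_continuous_on) (simp_all add: linear_conv_bounded_linear)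

lemma smooth_restrict:
  assumes "symmetric_companion f F" "smooth f" shows "smooth F"
proof -
  have "F = (\<lambda>x. f (diag_symmat x))" using symmetric_companion_diag[OF assms(1)] by auto
  then show ?thesis using smooth_compose_diag[OF assms(2)] by simp
qed

lemma gs_restrict:
  fixes f :: "'n::finite symmat \<Rightarrow> real"
  assumes fF: "symmetric_companion f F" and f: "smooth f" and \<rho>: "\<rho> > 0" and M: "\<And>k. M k > 0"
    and fin: "gs_norm \<rho> M f < \<infinity>"
  shows "gs_norm \<rho> M F < \<infinity>"
proof -
  have F: "F = (\<lambda>x. f (diag_symmat x))" using symmetric_companion_diag[OF fF] by auto
  from fin obtain C where C: "\<And>x k bs. set bs \<subseteq> Basis \<Longrightarrow>
      norm x ^ k * \<bar>lpartial bs f x\<bar> \<le> C * (\<rho> ^ (k + length bs) * M k * M (length bs))"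
    unfolding gs_norm_finite_iff[OF f \<rho> M] by blast
  have "norm x ^ k * \<bar>lpartial bs F x\<bar> \<le> C * (\<rho> ^ (k + length bs) * M k * M (length bs))"
    if "set bs \<subseteq> Basis" for x k bs
    using C[OF map_diag_symmat_Basis[OF that], of "diag_symmat x" k] lpartial_compose_diag[OF f that]
    by (simp add: F norm_diag_symmat)
  then show ?thesis unfolding gs_norm_finite_iff[OF smooth_restrict[OF fF f] \<rho> M] by blast
qed

lemma schwartz_restrict:
  fixes f :: "'n::finite symmat \<Rightarrow> real"
  assumes fF: "symmetric_companion f F" and f: "f \<in> schwartz"
  shows "F \<in> schwartz"
proof -
  have F: "F = (\<lambda>x. f (diag_symmat x))" using symmetric_companion_diag[OF fF] by auto
  have sm: "smooth f" using f by (simp add: schwartz_def)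
  obtain c where c: "\<And>x k bs. set bs \<subseteq> Basis \<Longrightarrow> norm x ^ k * \<bar>lpartial bs f x\<bar> \<le> c k (length bs)"
    using f unfolding schwartz_iff by blast
  have "norm x ^ k * \<bar>lpartial bs F x\<bar> \<le> c k (length bs)" if "set bs \<subseteq> Basis" for x k bs
    using c[OF map_diag_symmat_Basis[OF that], of "diag_symmat x" k] lpartial_compose_diag[OF sm that]
    by (simp add: F norm_diag_symmat)
  then show ?thesis unfolding schwartz_iff using smooth_restrict[OF fF sm] by blast
qed

text \<open>
  The inequality between \<open>M\<close> and \<open>L\<close>, which both regularity conditions provide, splits the loss of derivatives off:
  with \<open>s = loss_order\<close>, \<open>M (l + s)\<close> is at most a constant times \<open>c ^ l * L l\<close>.
\<close>

lemma local_norm_transfer: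
  fixes f :: "'n::finite symmat \<Rightarrow> real"
  assumes fF: "symmetric_companion f F" and F: "smooth F"
    and M: "weight_sequence M" and L: "\<And>k. L k > 0" and \<rho>: "\<rho> > 0" and c: "c > 0"
    and ev: "\<forall>\<^sub>F k in sequentially. real (Suc k) * M k \<le> \<rho> * M (Suc k)"
    and growth: "\<And>k l. M (k + l) \<le> c ^ (k + l) * L k * L l"
    and K: "\<And>A. A \<in> K \<Longrightarrow> CARD('n) * norm A \<le> R" and fin: "local_norm (cball 0 R) \<rho> M F < \<infinity>"
  shows "local_norm K (loss_factor TYPE('n) * c * \<rho>) L f < \<infinity>"
proof -
  note sp = symmetric_companion_imp_spectral[OF fF]
  let ?s = "loss_order TYPE('n)" and ?B = "loss_factor TYPE('n)"
  have B: "?B > 0" by (simp add: loss_factor_def add_pos_nonneg)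
  from fin obtain C where C: "\<And>x bs. norm x \<le> R \<Longrightarrow> set bs \<subseteq> Basis \<Longrightarrow>
      \<bar>lpartial bs F x\<bar> \<le> C * (\<rho> ^ length bs * M (length bs))"
    unfolding local_norm_finite_iff[OF F \<rho> weight_sequence_pos[OF M]] by (metis mem_cball_0)
  obtain C' where C': "\<And>A bs. CARD('n) * norm A \<le> R \<Longrightarrow> set bs \<subseteq> Basis \<Longrightarrow>
      \<bar>lpartial bs f A\<bar> \<le> C' * ((?B * \<rho>) ^ length bs * M (length bs + ?s))"
    using local_bound_transfer[OF sp F M \<rho> ev C] by blast
  have "\<bar>lpartial bs f A\<bar> \<le> (\<bar>C'\<bar> * c ^ ?s * L ?s) * ((?B * c * \<rho>) ^ length bs * L (length bs))"
    if "A \<in> K" "set bs \<subseteq> Basis" for A bs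
  proof -
    let ?l = "length bs"
    have "\<bar>lpartial bs f A\<bar> \<le> C' * ((?B * \<rho>) ^ ?l * M (?l + ?s))" by (rule C'[OF K[OF that(1)] that(2)])
    also have "\<dots> \<le> \<bar>C'\<bar> * ((?B * \<rho>) ^ ?l * (c ^ (?l + ?s) * L ?l * L ?s))"
      using B \<rho> growth weight_sequence_pos[OF M] by (intro mult_mono mult_left_mono) (auto intro: less_imp_le)
    also have "\<dots> = (\<bar>C'\<bar> * c ^ ?s * L ?s) * ((?B * c * \<rho>) ^ ?l * L ?l)"
      by (simp add: power_add power_mult_distrib mult_ac)
    finally show ?thesis .
  qed
  moreover have "?B * c * \<rho> > 0" using B c \<rho> by simp
  ultimately show ?thesis
    using local_norm_finite_iff[OF smooth_transfer[OF sp F], of "?B * c * \<rho>" L] L by blast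
qed

lemma gs_norm_transfer:
  fixes f :: "'n::finite symmat \<Rightarrow> real"
  assumes fF: "symmetric_companion f F" and F: "smooth F"
    and M: "weight_sequence M" and L: "\<And>k. L k > 0" and \<rho>: "\<rho> > 0" and c: "c > 0"
    and ev: "\<forall>\<^sub>F k in sequentially. real (Suc k) * M k \<le> \<rho> * M (Suc k)"
    and growth: "\<And>k l. M (k + l) \<le> c ^ (k + l) * L k * L l"
    and fin: "gs_norm \<rho> M F < \<infinity>"
  shows "gs_norm (loss_factor TYPE('n) * c * \<rho>) L f < \<infinity>"
proof -
  note sp = symmetric_companion_imp_spectral[OF fF]
  let ?s = "loss_order TYPE('n)" and ?B = "loss_factor TYPE('n)"
  have B: "?B > 0" by (simp add: loss_factor_def add_pos_nonneg)
  from fin obtain C where C: "\<And>x k bs. set bs \<subseteq> Basis \<Longrightarrow>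
      norm x ^ k * \<bar>lpartial bs F x\<bar> \<le> C * (\<rho> ^ (k + length bs) * M k * M (length bs))"
    unfolding gs_norm_finite_iff[OF F \<rho> weight_sequence_pos[OF M]] by blast
  obtain C' where C': "\<And>A k bs. set bs \<subseteq> Basis \<Longrightarrow>
      norm A ^ k * \<bar>lpartial bs f A\<bar> \<le> C' * ((?B * \<rho>) ^ (k + length bs) * M (k + (1 + ?s)) * M (length bs + ?s))"
      and C'0: "C' \<ge> 0"
    using gs_bound_transfer[OF sp F M \<rho> ev C] by blast
  have "norm A ^ k * \<bar>lpartial bs f A\<bar> \<le> (C' * c ^ (1 + ?s + ?s) * L (1 + ?s) * L ?s)
      * ((?B * c * \<rho>) ^ (k + length bs) * L k * L (length bs))"
    if "set bs \<subseteq> Basis" for A k bs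
  proof -
    let ?l = "length bs"
    have "norm A ^ k * \<bar>lpartial bs f A\<bar> \<le> C' * ((?B * \<rho>) ^ (k + ?l) * M (k + (1 + ?s)) * M (?l + ?s))"
      by (rule C'[OF that])
    also have "\<dots> \<le> C' * ((?B * \<rho>) ^ (k + ?l) * (c ^ (k + (1 + ?s)) * L k * L (1 + ?s)) * (c ^ (?l + ?s) * L ?l * L ?s))"
      using B \<rho> c C'0 growth[of k "1 + ?s"] growth[of ?l ?s] weight_sequence_pos[OF M] L
      by (intro mult_mono mult_left_mono) (auto intro!: mult_nonneg_nonneg less_imp_le)
    also have "\<dots> = (C' * c ^ (1 + ?s + ?s) * L (1 + ?s) * L ?s) * ((?B * c * \<rho>) ^ (k + ?l) * L k * L ?l)"
      by (simp add: power_add power_mult_distrib mult_ac)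
    finally show ?thesis .
  qed
  moreover have "?B * c * \<rho> > 0" using B c \<rho> by simp
  ultimately show ?thesis
    using gs_norm_finite_iff[OF smooth_transfer[OF sp F], of "?B * c * \<rho>" L] L by blast
qed

lemma local_norm_mono_radius:
  assumes f: "smooth f" and \<rho>: "\<rho> > 0" "\<rho> \<le> \<sigma>" and M: "\<And>k. M k > 0" and fin: "local_norm K \<rho> M f < \<infinity>"
  shows "local_norm K \<sigma> M f < \<infinity>"
proof -
  have \<sigma>: "\<sigma> > 0" using \<rho> by linarith
  from fin obtain C where C: "\<And>x bs. x \<in> K \<Longrightarrow> set bs \<subseteq> Basis \<Longrightarrow>
      \<bar>lpartial bs f x\<bar> \<le> C * (\<rho> ^ length bs * M (length bs))"
    unfolding local_norm_finite_iff[OF f \<rho>(1) M] by blast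
  have "C * (\<rho> ^ l * M l) \<le> \<bar>C\<bar> * (\<sigma> ^ l * M l)" for l
    using \<rho> M by (intro mult_mono mult_right_mono power_mono) (auto intro: less_imp_le)
  with C have "\<bar>lpartial bs f x\<bar> \<le> \<bar>C\<bar> * (\<sigma> ^ length bs * M (length bs))" if "x \<in> K" "set bs \<subseteq> Basis" for x bs
    using that by (meson order_trans)
  then show ?thesis unfolding local_norm_finite_iff[OF f \<sigma> M] by blast
qed

lemma gs_norm_mono_radius:
  assumes f: "smooth f" and \<rho>: "\<rho> > 0" "\<rho> \<le> \<sigma>" and M: "\<And>k. M k > 0" and fin: "gs_norm \<rho> M f < \<infinity>"
  shows "gs_norm \<sigma> M f < \<infinity>"
proof -
  have \<sigma>: "\<sigma> > 0" using \<rho> by linarith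
  from fin obtain C where C: "\<And>x k bs. set bs \<subseteq> Basis \<Longrightarrow>
      norm x ^ k * \<bar>lpartial bs f x\<bar> \<le> C * (\<rho> ^ (k + length bs) * M k * M (length bs))"
    unfolding gs_norm_finite_iff[OF f \<rho>(1) M] by blast
  have "C * (\<rho> ^ j * M k * M l) \<le> \<bar>C\<bar> * (\<sigma> ^ j * M k * M l)" for j k l
    using \<rho> M by (intro mult_mono mult_right_mono power_mono) (auto intro!: mult_nonneg_nonneg less_imp_le)
  with C have "norm x ^ k * \<bar>lpartial bs f x\<bar> \<le> \<bar>C\<bar> * (\<sigma> ^ (k + length bs) * M k * M (length bs))"
    if "set bs \<subseteq> Basis" for x k bs
    using that by (meson order_trans)
  then show ?thesis unfolding gs_norm_finite_iff[OF f \<sigma> M] by blast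
qed

theorem theorem10:
  fixes W :: "(nat \<Rightarrow> real) set"
    and f :: "'n::finite symmat \<Rightarrow> real"
    and F :: "real^'n \<Rightarrow> real"
  assumes "weight_matrix W"
    and "isotropic f"
    and "symmetric_companion f F"
  shows "(beurling_regular W \<longrightarrow>
            (f \<in> E_beurling W UNIV \<longleftrightarrow> F \<in> E_beurling W UNIV) \<and>
            (f \<in> S_beurling W \<longleftrightarrow> F \<in> S_beurling W)) \<and>
         (roumieu_regular W \<longrightarrow>
            (f \<in> E_roumieu W UNIV \<longleftrightarrow> F \<in> E_roumieu W UNIV) \<and>
            (f \<in> S_roumieu W \<longleftrightarrow> F \<in> S_roumieu W))"
proof -
  note W = assms(1) and fF = assms(3)
  note sp = symmetric_companion_imp_spectral[OF fF]
  let ?B = "loss_factor TYPE('n)"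
  have B: "?B > 0" by (simp add: loss_factor_def add_pos_nonneg)
  have ws: "weight_sequence M" if "M \<in> W" for M using W that by (simp add: weight_matrix_def)
  have pos: "M k > 0" if "M \<in> W" for M k using weight_sequence_pos[OF ws[OF that]] .
  have radius: "\<exists>R. \<forall>A\<in>K. CARD('n) * norm A \<le> R" if K: "compact K" for K :: "'n symmat set"
  proof -
    obtain b where "\<And>A. A \<in> K \<Longrightarrow> norm A \<le> b"
      using compact_imp_bounded[OF K] unfolding bounded_iff by blast
    then show ?thesis by (intro exI[of _ "CARD('n) * b"]) (auto intro!: mult_left_mono)
  qed
  have E_smooth: "smooth h" if "h \<in> E_beurling W UNIV \<or> h \<in> E_roumieu W UNIV" for h :: "'z::euclidean_space \<Rightarrow> real"
    using that by (auto simp: E_beurling_def E_roumieu_def)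
  have S_smooth: "smooth h" if "h \<in> schwartz" for h :: "'z::euclidean_space \<Rightarrow> real"
    using that by (simp add: schwartz_def)
  have "F \<in> E_beurling W UNIV" if f: "f \<in> E_beurling W UNIV"
  proof -
    have sm: "smooth f" using E_smooth f by blast
    have "local_norm K \<rho> M F < \<infinity>" if K: "compact K" and M: "M \<in> W" and \<rho>: "\<rho> > 0" for K M \<rho>
      using f compact_diag_image[OF K] M \<rho>
      by (intro E_restrict[OF fF sm K \<rho> pos[OF M]]) (simp add: E_beurling_def)
    then show ?thesis using smooth_restrict[OF fF sm] by (simp add: E_beurling_def)
  qed
  moreover have "F \<in> E_roumieu W UNIV" if f: "f \<in> E_roumieu W UNIV"
  proof -
    have sm: "smooth f" using E_smooth f by blast
    have "\<exists>M\<in>W. \<exists>\<rho>>0. local_norm K \<rho> M F < \<infinity>" if K: "compact K" for K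
    proof -
      have "\<exists>M\<in>W. \<exists>\<rho>>0. local_norm (diag_symmat ` K) \<rho> M f < \<infinity>"
        using f compact_diag_image[OF K] by (simp add: E_roumieu_def)
      then obtain M \<rho> where M: "M \<in> W" "\<rho> > 0" "local_norm (diag_symmat ` K) \<rho> M f < \<infinity>" by blast
      have "local_norm K \<rho> M F < \<infinity>" by (rule E_restrict[OF fF sm K M(2) pos[OF M(1)] M(3)])
      with M show ?thesis by blast
    qed
    then show ?thesis using smooth_restrict[OF fF sm] by (simp add: E_roumieu_def)
  qed
  moreover have "F \<in> S_beurling W" if f: "f \<in> S_beurling W"
  proof -
    have sch: "f \<in> schwartz" using f by (simp add: S_beurling_def)
    have "gs_norm \<rho> M F < \<infinity>" if M: "M \<in> W" and \<rho>: "\<rho> > 0" for M \<rho>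
      using f M \<rho> by (intro gs_restrict[OF fF S_smooth[OF sch] \<rho> pos[OF M]]) (simp add: S_beurling_def)
    then show ?thesis using schwartz_restrict[OF fF sch] by (simp add: S_beurling_def)
  qed
  moreover have "F \<in> S_roumieu W" if f: "f \<in> S_roumieu W"
  proof -
    have sch: "f \<in> schwartz" using f by (simp add: S_roumieu_def)
    have "\<exists>M\<in>W. \<exists>\<rho>>0. gs_norm \<rho> M f < \<infinity>" using f by (simp add: S_roumieu_def)
    then obtain M \<rho> where M: "M \<in> W" "\<rho> > 0" "gs_norm \<rho> M f < \<infinity>" by blast
    have "gs_norm \<rho> M F < \<infinity>" by (rule gs_restrict[OF fF S_smooth[OF sch] M(2) pos[OF M(1)] M(3)])
    with M show ?thesis using schwartz_restrict[OF fF sch] unfolding S_roumieu_def by blast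
  qed
  moreover have "f \<in> E_beurling W UNIV" if reg: "beurling_regular W" and F: "F \<in> E_beurling W UNIV"
  proof -
    have sm: "smooth F" using E_smooth F by blast
    \<comment> \<open>The radius \<open>\<sigma>\<close> for \<open>F\<close> is chosen such that the factors \<open>?B\<close> and \<open>c\<close> lead back to the prescribed \<open>\<rho>\<close>.\<close>
    have "local_norm K \<rho> M f < \<infinity>" if K: "compact K" and M: "M \<in> W" and \<rho>: "\<rho> > 0" for K M \<rho>
    proof -
      obtain R where R: "\<And>A. A \<in> K \<Longrightarrow> CARD('n) * norm A \<le> R" using radius[OF K] by blast
      obtain L c where L: "L \<in> W" "c > 0" "\<And>k l. L (k + l) \<le> c ^ (k + l) * M k * M l"
        using reg M unfolding beurling_regular_def by blast
      define \<sigma> where "\<sigma> = \<rho> / (?B * c)"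
      have \<sigma>: "\<sigma> > 0" "?B * c * \<sigma> = \<rho>" using \<rho> B L(2) by (simp_all add: \<sigma>_def)
      have "local_norm (cball 0 R) \<sigma> L F < \<infinity>" using F L(1) \<sigma>(1) by (simp add: E_beurling_def)
      from local_norm_transfer[OF fF sm ws[OF L(1)] pos[OF M] \<sigma>(1) L(2) beurling_quotient[OF W reg L(1) \<sigma>(1)] L(3) R this]
      show ?thesis by (simp add: \<sigma>)
    qed
    then show ?thesis using smooth_transfer[OF sp sm] by (simp add: E_beurling_def)
  qed
  moreover have "f \<in> S_beurling W" if reg: "beurling_regular W" and F: "F \<in> S_beurling W"
  proof -
    have sch: "F \<in> schwartz" using F by (simp add: S_beurling_def)
    have "gs_norm \<rho> M f < \<infinity>" if M: "M \<in> W" and \<rho>: "\<rho> > 0" for M \<rho>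
    proof -
      obtain L c where L: "L \<in> W" "c > 0" "\<And>k l. L (k + l) \<le> c ^ (k + l) * M k * M l"
        using reg M unfolding beurling_regular_def by blast
      define \<sigma> where "\<sigma> = \<rho> / (?B * c)"
      have \<sigma>: "\<sigma> > 0" "?B * c * \<sigma> = \<rho>" using \<rho> B L(2) by (simp_all add: \<sigma>_def)
      have "gs_norm \<sigma> L F < \<infinity>" using F L(1) \<sigma>(1) by (simp add: S_beurling_def)
      from gs_norm_transfer[OF fF S_smooth[OF sch] ws[OF L(1)] pos[OF M] \<sigma>(1) L(2) beurling_quotient[OF W reg L(1) \<sigma>(1)] L(3) this]
      show ?thesis by (simp add: \<sigma>)
    qed
    then show ?thesis using schwartz_transfer[OF sp sch] by (simp add: S_beurling_def)
  qed
  moreover have "f \<in> E_roumieu W UNIV" if reg: "roumieu_regular W" and F: "F \<in> E_roumieu W UNIV"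
  proof -
    have sm: "smooth F" using E_smooth F by blast
    have "\<exists>N\<in>W. \<exists>\<rho>>0. local_norm K \<rho> N f < \<infinity>" if K: "compact K" for K
    proof -
      obtain R where R: "\<And>A. A \<in> K \<Longrightarrow> CARD('n) * norm A \<le> R" using radius[OF K] by blast
      have "\<exists>M\<in>W. \<exists>\<rho>>0. local_norm (cball 0 R) \<rho> M F < \<infinity>"
        using F by (simp add: E_roumieu_def)
      then obtain M \<rho> where M: "M \<in> W" "\<rho> > 0" "local_norm (cball 0 R) \<rho> M F < \<infinity>" by blast
      obtain \<rho>0 where \<rho>0: "\<rho>0 > 0" "\<And>\<rho>. \<rho> \<ge> \<rho>0 \<Longrightarrow> \<forall>\<^sub>F k in sequentially. real (Suc k) * M k \<le> \<rho> * M (Suc k)"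
        using roumieu_quotient[OF W reg M(1)] by blast
      obtain N c where N: "N \<in> W" "c > 0" "\<And>k l. M (k + l) \<le> c ^ (k + l) * N k * N l"
        using reg M(1) unfolding roumieu_regular_def by blast
      define \<sigma> where "\<sigma> = max \<rho> \<rho>0"
      have \<sigma>: "\<sigma> > 0" "\<sigma> \<ge> \<rho>0" "\<rho> \<le> \<sigma>" using M(2) by (auto simp: \<sigma>_def)
      have "local_norm (cball 0 R) \<sigma> M F < \<infinity>" by (rule local_norm_mono_radius[OF sm M(2) \<sigma>(3) pos[OF M(1)] M(3)])
      from local_norm_transfer[OF fF sm ws[OF M(1)] pos[OF N(1)] \<sigma>(1) N(2) \<rho>0(2)[OF \<sigma>(2)] N(3) R this]
      moreover have "?B * c * \<sigma> > 0" using N(2) B \<sigma>(1) by simp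
      ultimately show ?thesis using N(1) by blast
    qed
    then show ?thesis using smooth_transfer[OF sp sm] by (simp add: E_roumieu_def)
  qed
  moreover have "f \<in> S_roumieu W" if reg: "roumieu_regular W" and F: "F \<in> S_roumieu W"
  proof -
    have sch: "F \<in> schwartz" using F by (simp add: S_roumieu_def)
    have "\<exists>M\<in>W. \<exists>\<rho>>0. gs_norm \<rho> M F < \<infinity>" using F by (simp add: S_roumieu_def)
    then obtain M \<rho> where M: "M \<in> W" "\<rho> > 0" "gs_norm \<rho> M F < \<infinity>" by blast
    obtain \<rho>0 where \<rho>0: "\<rho>0 > 0" "\<And>\<rho>. \<rho> \<ge> \<rho>0 \<Longrightarrow> \<forall>\<^sub>F k in sequentially. real (Suc k) * M k \<le> \<rho> * M (Suc k)"
      using roumieu_quotient[OF W reg M(1)] by blast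
    obtain N c where N: "N \<in> W" "c > 0" "\<And>k l. M (k + l) \<le> c ^ (k + l) * N k * N l"
      using reg M(1) unfolding roumieu_regular_def by blast
    define \<sigma> where "\<sigma> = max \<rho> \<rho>0"
    have \<sigma>: "\<sigma> > 0" "\<sigma> \<ge> \<rho>0" "\<rho> \<le> \<sigma>" using M(2) by (auto simp: \<sigma>_def)
    have "gs_norm \<sigma> M F < \<infinity>" by (rule gs_norm_mono_radius[OF S_smooth[OF sch] M(2) \<sigma>(3) pos[OF M(1)] M(3)])
    from gs_norm_transfer[OF fF S_smooth[OF sch] ws[OF M(1)] pos[OF N(1)] \<sigma>(1) N(2) \<rho>0(2)[OF \<sigma>(2)] N(3) this]
    moreover have "?B * c * \<sigma> > 0" using N(2) B \<sigma>(1) by simp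
    ultimately show ?thesis
      using schwartz_transfer[OF sp sch] N(1) unfolding S_roumieu_def by blast
  qed
  ultimately show ?thesis by blast
qed

end
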